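(* Let $E$ be a split structure on $M$. Then $E$ is a generalized local product structure if and only if $E$ is a generalized almost product structure and $d_E^2=0$.
   Context: $M$ is a connected finite-dimensional smooth manifold, $\Omega_M=\Gamma(\wedge^\bullet T^*M)$, $\mathbb{T}M=TM\oplus T^*M$ with projection $\pi:\mathbb{T}M\to TM$ and pairing $\langle X+\alpha,Y+\beta\rangle=2(\alpha(Y)+\beta(X))$. A split structure of rank $2r$ is a subbundle $E\subseteq\mathbb{T}M$ of rank $2r$ on which $\langle\,,\,\rangle$ is non-degenerate of signature $(r,r)$; $E^\perp$ is its orthogonal complement. A generalized almost product structure is a split structure $E$ of some rank $2r$ such that $\pi|_E$ has rank exactly $r$ everywhere. A generalized local product structure is a split structure $E$ such that $\pi(E)$ and $\pi(E^\perp)$ are constant-rank foliations (involutive subbundles of $TM$) with $TM=\pi(E)\oplus\pi(E^\perp)$. If $E$ is a generalized almost product structure, then $T^*M=(T^*M\cap E)\oplus(T^*M\cap E^\perp)$, which gives a bigrading $\Omega_E^{p,q}=\Gamma(\wedge^p(T^*M\cap E)\otimes\wedge^q(T^*M\cap E^\perp))$ of $\Omega_M$; the de Rham operator $d$ has components of bidegrees $(1,0),(-1,2),(0,1),(2,-1)$ only, and $d_E$ is the sum of its components of bidegrees $(1,0)$ and $(-1,2)$. *)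

theory Defs
  imports "HOL-Analysis.Analysis" "HOL-Library.Function_Algebras"
begin

text \<open>Pointwise real vector space structure on functions, so that \<^const>\<open>subspace\<close>,
  \<^const>\<open>span\<close> and \<^const>\<open>dim\<close> apply to tangent vectors, covectors and forms.\<close>

instantiation "fun" :: (type, real_vector) real_vector
begin

definition scaleR_fun :: "real \<Rightarrow> ('a \<Rightarrow> 'b) \<Rightarrow> 'a \<Rightarrow> 'b"
  where "scaleR_fun c f = (\<lambda>x. c *\<^sub>R f x)"

instance
  by standard (auto simp: scaleR_fun_def fun_eq_iff scaleR_add_right scaleR_add_left)

end

definition linear_fun_on :: "'v::real_vector set \<Rightarrow> ('v \<Rightarrow> real) \<Rightarrow> bool" where
  "linear_fun_on V f \<longleftrightarrow>
     (\<forall>u\<in>V. \<forall>v\<in>V. \<forall>a b. f (a *\<^sub>R u + b *\<^sub>R v) = a * f u + b * f v)"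

definition direct_sum :: "'v::real_vector set \<Rightarrow> 'v set \<Rightarrow> 'v set \<Rightarrow> bool" where
  "direct_sum V P N \<longleftrightarrow> V = {p + n | p n. p \<in> P \<and> n \<in> N} \<and> P \<inter> N = {0}"


text \<open>\<open>Ck k S f\<close> says that \<open>f\<close> is of class C^k on the open set \<open>S\<close>; this uses that the domain
  is finite-dimensional, so that it is enough to differentiate in each fixed direction.\<close>

primrec Ck :: "nat \<Rightarrow> 'b::real_normed_vector set \<Rightarrow> ('b \<Rightarrow> 'c::real_normed_vector) \<Rightarrow> bool" where
  "Ck 0 S f \<longleftrightarrow> continuous_on S f"
| "Ck (Suc k) S f \<longleftrightarrow> (\<forall>x\<in>S. f differentiable (at x)) \<and>
     (\<forall>v. Ck k S (\<lambda>x. frechet_derivative f (at x) v))"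

definition smooth_on :: "'b::real_normed_vector set \<Rightarrow> ('b \<Rightarrow> 'c::real_normed_vector) \<Rightarrow> bool" where
  "smooth_on S f \<longleftrightarrow> (\<forall>k. Ck k S f)"

text \<open>A chart is a pair of its domain and its coordinate map. The points of the manifold are all
  points of the type \<open>'a\<close>; the Hausdorff and second countability axioms are carried by type classes.
  The model space is a finite-dimensional real inner product space \<open>'b\<close>. Every such space has the
  Heine-Borel property, so the sort \<open>heine_borel\<close> is no restriction; the class \<open>euclidean_space\<close>
  is not used because it excludes dimension zero.\<close>

type_synonym ('a, 'b) atlas = "('a set \<times> ('a \<Rightarrow> 'b)) set"

definition smooth_manifold ::
  "('a::{t2_space, second_countable_topology}, 'b::{real_inner, heine_borel}) atlas \<Rightarrow> bool" where
  "smooth_manifold A \<longleftrightarrow>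
     (\<exists>B::'b set. finite B \<and> span B = UNIV) \<and>
     (\<Union>(U, \<phi>)\<in>A. U) = UNIV \<and>
     (\<forall>(U, \<phi>)\<in>A. open U \<and> open (\<phi> ` U) \<and> homeomorphism U (\<phi> ` U) \<phi> (inv_into U \<phi>)) \<and>
     (\<forall>(U, \<phi>)\<in>A. \<forall>(V, \<psi>)\<in>A. smooth_on (\<phi> ` (U \<inter> V)) (\<psi> \<circ> inv_into U \<phi>))"

definition smooth_fun_on ::
  "('a::topological_space, 'b::real_normed_vector) atlas \<Rightarrow> 'a set \<Rightarrow> ('a \<Rightarrow> real) \<Rightarrow> bool" where
  "smooth_fun_on A W f \<longleftrightarrow> (\<forall>(U, \<phi>)\<in>A. smooth_on (\<phi> ` (U \<inter> W)) (f \<circ> inv_into U \<phi>))"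

definition smooth_funs ::
  "('a::topological_space, 'b::real_normed_vector) atlas \<Rightarrow> ('a \<Rightarrow> real) set" where
  "smooth_funs A = {f. smooth_fun_on A UNIV f}"


text \<open>Tangent vectors are derivations at a point of the algebra of smooth functions. Partial
  operations are made total by the value \<open>0\<close> outside of their domain, so that equality of HOL
  functions is equality of the mathematical objects.\<close>

type_synonym 'a tvec = "('a \<Rightarrow> real) \<Rightarrow> real"
type_synonym 'a covec = "'a tvec \<Rightarrow> real"

definition tangent_space ::
  "('a::topological_space, 'b::real_normed_vector) atlas \<Rightarrow> 'a \<Rightarrow> 'a tvec set" where
  "tangent_space A x = {v. linear_fun_on (smooth_funs A) v \<and>
     (\<forall>f\<in>smooth_funs A. \<forall>g\<in>smooth_funs A. v (\<lambda>y. f y * g y) = f x * v g + g x * v f) \<and>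
     (\<forall>f. f \<notin> smooth_funs A \<longrightarrow> v f = 0)}"

definition cotangent_space ::
  "('a::topological_space, 'b::real_normed_vector) atlas \<Rightarrow> 'a \<Rightarrow> 'a covec set" where
  "cotangent_space A x = {\<alpha>. linear_fun_on (tangent_space A x) \<alpha> \<and>
     (\<forall>v. v \<notin> tangent_space A x \<longrightarrow> \<alpha> v = 0)}"

text \<open>Smoothness over an open set \<open>W\<close> is tested on global functions and, for covector fields, on
  global vector fields. By cutoff functions this is the same as testing on local ones.\<close>

definition vector_field_on ::
  "('a::topological_space, 'b::real_normed_vector) atlas \<Rightarrow> 'a set \<Rightarrow> ('a \<Rightarrow> 'a tvec) \<Rightarrow> bool" where
  "vector_field_on A W X \<longleftrightarrow> (\<forall>x\<in>W. X x \<in> tangent_space A x) \<and>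
     (\<forall>f\<in>smooth_funs A. smooth_fun_on A W (\<lambda>x. X x f))"

definition vector_fields ::
  "('a::topological_space, 'b::real_normed_vector) atlas \<Rightarrow> ('a \<Rightarrow> 'a tvec) set" where
  "vector_fields A = {X. vector_field_on A UNIV X}"

definition covector_field_on ::
  "('a::topological_space, 'b::real_normed_vector) atlas \<Rightarrow> 'a set \<Rightarrow> ('a \<Rightarrow> 'a covec) \<Rightarrow> bool" where
  "covector_field_on A W \<xi> \<longleftrightarrow> (\<forall>x\<in>W. \<xi> x \<in> cotangent_space A x) \<and>
     (\<forall>X\<in>vector_fields A. smooth_fun_on A W (\<lambda>x. \<xi> x (X x)))"

definition lie_bracket ::
  "('a::topological_space, 'b::real_normed_vector) atlas \<Rightarrow>
     ('a \<Rightarrow> 'a tvec) \<Rightarrow> ('a \<Rightarrow> 'a tvec) \<Rightarrow> 'a \<Rightarrow> 'a tvec" where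
  "lie_bracket A X Y = (\<lambda>x f. if f \<in> smooth_funs A
     then X x (\<lambda>y. Y y f) - Y x (\<lambda>y. X y f) else 0)"


text \<open>\<open>secs W s\<close> says that \<open>s\<close> is a smooth section over \<open>W\<close> of the ambient bundle.\<close>

definition subbundle ::
  "('a::topological_space \<Rightarrow> 'v::real_vector set) \<Rightarrow> ('a set \<Rightarrow> ('a \<Rightarrow> 'v) \<Rightarrow> bool) \<Rightarrow>
     nat \<Rightarrow> ('a \<Rightarrow> 'v set) \<Rightarrow> bool" where
  "subbundle fibre secs k F \<longleftrightarrow>
     (\<forall>x. subspace (F x) \<and> F x \<subseteq> fibre x) \<and>
     (\<forall>x. \<exists>W s. open W \<and> x \<in> W \<and> (\<forall>i<k. secs W (s i)) \<and>
        (\<forall>y\<in>W. inj_on (\<lambda>i. s i y) {..<k} \<and> independent ((\<lambda>i. s i y) ` {..<k}) \<and>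
           span ((\<lambda>i. s i y) ` {..<k}) = F y))"

definition involutive ::
  "('a::topological_space, 'b::real_normed_vector) atlas \<Rightarrow> ('a \<Rightarrow> 'a tvec set) \<Rightarrow> bool" where
  "involutive A F \<longleftrightarrow> (\<forall>X\<in>vector_fields A. \<forall>Y\<in>vector_fields A.
     (\<forall>x. X x \<in> F x) \<longrightarrow> (\<forall>x. Y x \<in> F x) \<longrightarrow> (\<forall>x. lie_bracket A X Y x \<in> F x))"

definition foliation ::
  "('a::topological_space, 'b::real_normed_vector) atlas \<Rightarrow> ('a \<Rightarrow> 'a tvec set) \<Rightarrow> bool" where
  "foliation A F \<longleftrightarrow>
     (\<exists>k. subbundle (tangent_space A) (vector_field_on A) k F) \<and> involutive A F"


type_synonym 'a gvec = "'a tvec \<times> 'a covec"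

definition gen_tangent_space ::
  "('a::topological_space, 'b::real_normed_vector) atlas \<Rightarrow> 'a \<Rightarrow> 'a gvec set" where
  "gen_tangent_space A x = tangent_space A x \<times> cotangent_space A x"

definition gen_section_on ::
  "('a::topological_space, 'b::real_normed_vector) atlas \<Rightarrow> 'a set \<Rightarrow> ('a \<Rightarrow> 'a gvec) \<Rightarrow> bool" where
  "gen_section_on A W s \<longleftrightarrow>
     vector_field_on A W (\<lambda>x. fst (s x)) \<and> covector_field_on A W (\<lambda>x. snd (s x))"

fun pairing :: "'a gvec \<Rightarrow> 'a gvec \<Rightarrow> real" where
  "pairing (X, \<alpha>) (Y, \<beta>) = 2 * (\<alpha> Y + \<beta> X)"

definition nondegenerate_on :: "'v::zero set \<Rightarrow> ('v \<Rightarrow> 'v \<Rightarrow> real) \<Rightarrow> bool" where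
  "nondegenerate_on V b \<longleftrightarrow> (\<forall>u\<in>V. (\<forall>v\<in>V. b u v = 0) \<longrightarrow> u = 0)"

definition has_signature ::
  "'v::real_vector set \<Rightarrow> ('v \<Rightarrow> 'v \<Rightarrow> real) \<Rightarrow> nat \<Rightarrow> nat \<Rightarrow> bool" where
  "has_signature V b p q \<longleftrightarrow> (\<exists>P N. subspace P \<and> subspace N \<and> dim P = p \<and> dim N = q \<and>
     direct_sum V P N \<and>
     (\<forall>u\<in>P. u \<noteq> 0 \<longrightarrow> b u u > 0) \<and> (\<forall>v\<in>N. v \<noteq> 0 \<longrightarrow> b v v < 0) \<and>
     (\<forall>u\<in>P. \<forall>v\<in>N. b u v = 0))"

definition split_structure_of_rank ::
  "('a::topological_space, 'b::real_normed_vector) atlas \<Rightarrow> nat \<Rightarrow> ('a \<Rightarrow> 'a gvec set) \<Rightarrow> bool" where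
  "split_structure_of_rank A m E \<longleftrightarrow>
     (\<exists>r. m = 2 * r \<and> subbundle (gen_tangent_space A) (gen_section_on A) (2 * r) E \<and>
        (\<forall>x. nondegenerate_on (E x) pairing \<and> has_signature (E x) pairing r r))"

definition split_structure ::
  "('a::topological_space, 'b::real_normed_vector) atlas \<Rightarrow> ('a \<Rightarrow> 'a gvec set) \<Rightarrow> bool" where
  "split_structure A E \<longleftrightarrow> (\<exists>m. split_structure_of_rank A m E)"

definition orth_compl ::
  "('a::topological_space, 'b::real_normed_vector) atlas \<Rightarrow> ('a \<Rightarrow> 'a gvec set) \<Rightarrow> 'a \<Rightarrow> 'a gvec set" where
  "orth_compl A E x = {w \<in> gen_tangent_space A x. \<forall>e\<in>E x. pairing w e = 0}"

definition gen_almost_product ::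
  "('a::topological_space, 'b::real_normed_vector) atlas \<Rightarrow> ('a \<Rightarrow> 'a gvec set) \<Rightarrow> bool" where
  "gen_almost_product A E \<longleftrightarrow>
     (\<exists>r. split_structure_of_rank A (2 * r) E \<and> (\<forall>x. dim (fst ` E x) = r))"

definition gen_local_product ::
  "('a::topological_space, 'b::real_normed_vector) atlas \<Rightarrow> ('a \<Rightarrow> 'a gvec set) \<Rightarrow> bool" where
  "gen_local_product A E \<longleftrightarrow> split_structure A E \<and>
     foliation A (\<lambda>x. fst ` E x) \<and> foliation A (\<lambda>x. fst ` orth_compl A E x) \<and>
     (\<forall>x. direct_sum (tangent_space A x) (fst ` E x) (fst ` orth_compl A E x))"


text \<open>A \<open>k\<close>-form takes a point and a list of \<open>k\<close> tangent vectors at this point.\<close>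

type_synonym 'a form = "'a \<Rightarrow> 'a tvec list \<Rightarrow> real"

definition tangent_lists ::
  "('a::topological_space, 'b::real_normed_vector) atlas \<Rightarrow> nat \<Rightarrow> 'a \<Rightarrow> 'a tvec list set" where
  "tangent_lists A k x = {vs. length vs = k \<and> set vs \<subseteq> tangent_space A x}"

definition alternating_forms ::
  "('a::topological_space, 'b::real_normed_vector) atlas \<Rightarrow> nat \<Rightarrow> 'a \<Rightarrow> ('a tvec list \<Rightarrow> real) set" where
  "alternating_forms A k x = {\<eta>.
     (\<forall>vs\<in>tangent_lists A k x. \<forall>i<k. linear_fun_on (tangent_space A x) (\<lambda>v. \<eta> (vs[i := v]))) \<and>
     (\<forall>vs\<in>tangent_lists A k x. \<forall>j<k. \<forall>i<j. vs ! i = vs ! j \<longrightarrow> \<eta> vs = 0) \<and>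
     (\<forall>vs. vs \<notin> tangent_lists A k x \<longrightarrow> \<eta> vs = 0)}"

definition forms ::
  "('a::topological_space, 'b::real_normed_vector) atlas \<Rightarrow> nat \<Rightarrow> 'a form set" where
  "forms A k = {\<omega>. (\<forall>x. \<omega> x \<in> alternating_forms A k x) \<and>
     (\<forall>Xs. length Xs = k \<and> set Xs \<subseteq> vector_fields A \<longrightarrow>
        (\<lambda>x. \<omega> x (map (\<lambda>X. X x) Xs)) \<in> smooth_funs A)}"

definition omit :: "nat \<Rightarrow> 'c list \<Rightarrow> 'c list" where
  "omit i xs = take i xs @ drop (Suc i) xs"

text \<open>The right-hand side of the invariant (Koszul) formula for the de Rham operator.\<close>

definition koszul ::
  "('a::topological_space, 'b::real_normed_vector) atlas \<Rightarrow> nat \<Rightarrow> 'a form \<Rightarrow>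
     ('a \<Rightarrow> 'a tvec) list \<Rightarrow> 'a \<Rightarrow> real" where
  "koszul A k \<omega> Xs x =
     (\<Sum>i\<le>k. (-1) ^ i * (Xs ! i) x (\<lambda>y. \<omega> y (map (\<lambda>X. X y) (omit i Xs)))) +
     (\<Sum>j\<le>k. \<Sum>i<j. (-1) ^ (i + j) *
        \<omega> x (map (\<lambda>X. X x) (lie_bracket A (Xs ! i) (Xs ! j) # omit i (omit j Xs))))"

definition de_rham ::
  "('a::topological_space, 'b::real_normed_vector) atlas \<Rightarrow> nat \<Rightarrow> 'a form \<Rightarrow> 'a form" where
  "de_rham A k \<omega> = (THE \<eta>. \<eta> \<in> forms A (Suc k) \<and>
     (\<forall>Xs. length Xs = Suc k \<and> set Xs \<subseteq> vector_fields A \<longrightarrow>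
        (\<forall>x. \<eta> x (map (\<lambda>X. X x) Xs) = koszul A k \<omega> Xs x)))"


definition cotangent_part ::
  "('a::topological_space, 'b::real_normed_vector) atlas \<Rightarrow> ('a \<Rightarrow> 'a gvec set) \<Rightarrow> 'a \<Rightarrow> 'a covec set" where
  "cotangent_part A E x = {\<alpha> \<in> cotangent_space A x. (0, \<alpha>) \<in> E x}"

definition wedge ::
  "('a::topological_space, 'b::real_normed_vector) atlas \<Rightarrow> 'a \<Rightarrow> 'a covec list \<Rightarrow>
     'a tvec list \<Rightarrow> real" where
  "wedge A x \<alpha>s vs = (if vs \<in> tangent_lists A (length \<alpha>s) x
     then \<Sum>\<sigma> | \<sigma> permutes {..<length \<alpha>s}.
            of_int (sign \<sigma>) * (\<Prod>i<length \<alpha>s. (\<alpha>s ! i) (vs ! \<sigma> i))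
     else 0)"

text \<open>The fibre of \<open>\<and>^p (T*M \<inter> E) \<otimes> \<and>^q (T*M \<inter> E^\<bottom>)\<close>, regarded as a subspace of \<open>\<and>^(p+q) T*M\<close>.\<close>

definition bigraded_fibre ::
  "('a::topological_space, 'b::real_normed_vector) atlas \<Rightarrow> ('a \<Rightarrow> 'a gvec set) \<Rightarrow>
     nat \<Rightarrow> nat \<Rightarrow> 'a \<Rightarrow> ('a tvec list \<Rightarrow> real) set" where
  "bigraded_fibre A E p q x = span {wedge A x (\<alpha>s @ \<beta>s) | \<alpha>s \<beta>s.
     length \<alpha>s = p \<and> set \<alpha>s \<subseteq> cotangent_part A E x \<and>
     length \<beta>s = q \<and> set \<beta>s \<subseteq> cotangent_part A (orth_compl A E) x}"

definition bigraded_forms ::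
  "('a::topological_space, 'b::real_normed_vector) atlas \<Rightarrow> ('a \<Rightarrow> 'a gvec set) \<Rightarrow>
     nat \<Rightarrow> nat \<Rightarrow> 'a form set" where
  "bigraded_forms A E p q = {\<omega> \<in> forms A (p + q). \<forall>x. \<omega> x \<in> bigraded_fibre A E p q x}"

text \<open>The component of bidegree \<open>(p, k - p)\<close> of a \<open>k\<close>-form, which is \<open>0\<close> if \<open>p\<close> or \<open>k - p\<close> is
  negative. It is meaningful if \<open>E\<close> is a generalized almost product structure.\<close>

definition bidegree_component ::
  "('a::topological_space, 'b::real_normed_vector) atlas \<Rightarrow> ('a \<Rightarrow> 'a gvec set) \<Rightarrow>
     nat \<Rightarrow> int \<Rightarrow> 'a form \<Rightarrow> 'a form" where
  "bidegree_component A E k p \<omega> = (if 0 \<le> p \<and> p \<le> int k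
     then THE \<eta>. \<exists>c. (\<forall>i\<le>k. c i \<in> bigraded_forms A E i (k - i)) \<and>
            \<omega> = (\<Sum>i\<le>k. c i) \<and> \<eta> = c (nat p)
     else 0)"

text \<open>On forms of bidegree \<open>(p, k - p)\<close>, the parts of \<open>d\<close> of bidegree \<open>(1, 0)\<close> and \<open>(-1, 2)\<close> are the
  components of \<open>d\<close> with first degree \<open>p + 1\<close> and \<open>p - 1\<close>.\<close>

definition d_E ::
  "('a::topological_space, 'b::real_normed_vector) atlas \<Rightarrow> ('a \<Rightarrow> 'a gvec set) \<Rightarrow>
     nat \<Rightarrow> 'a form \<Rightarrow> 'a form" where
  "d_E A E k \<omega> = (\<Sum>p\<in>{0..int k}.
     let \<eta> = de_rham A k (bidegree_component A E k p \<omega>)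
     in bidegree_component A E (Suc k) (p + 1) \<eta> + bidegree_component A E (Suc k) (p - 1) \<eta>)"

end

theory Submission
  imports Defs "HOL-Combinatorics.List_Permutation" "Jordan_Normal_Form.Determinant"
begin

no_notation Matrix.scalar_prod (infix \<open>\<bullet>\<close> 70)

text \<open>Let \<open>P = \<pi>(E)\<close> and \<open>Q = \<pi>(E\<^sup>\<bottom>)\<close>. Both conditions force \<open>TM = P \<oplus> Q\<close>, with
  \<open>E \<inter> T\<^sup>*M\<close> the annihilator of \<open>Q\<close> and \<open>E\<^sup>\<bottom> \<inter> T\<^sup>*M\<close> the annihilator of \<open>P\<close>; hence a form has
  bidegree \<open>(p, q)\<close> iff it vanishes on lists of vectors from \<open>P \<union> Q\<close> unless exactly \<open>p\<close> of them
  lie in \<open>P\<close>. The orthogonal projection onto \<open>E\<close> is smooth, because the inverse of a Gram matrix is,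
  and it induces the projection \<open>J\<close> of \<open>TM\<close> onto \<open>P\<close> along \<open>Q\<close>.

  If \<open>P\<close> and \<open>Q\<close> are involutive, the invariant formula shows that \<open>d\<close> has only the components
  \<open>(1, 0)\<close> and \<open>(0, 1)\<close>; so \<open>d_E\<close> is the component \<open>(1, 0)\<close>, and its square is the component
  \<open>(2, 0)\<close> of \<open>d\<^sup>2 = 0\<close>. Conversely \<open>d_E f = df \<circ> J\<close> on functions, and \<open>d_E (d_E f)\<close> takes the
  value \<open>([X, Y] - J [X, Y]) f\<close> on sections of \<open>P\<close> and \<open>- (J [X, Y]) f\<close> on sections of \<open>Q\<close>.\<close>

section \<open>Calculus of class C^k functions\<close>

text \<open>Tangent vectors act on global functions and covector fields are tested on global vector
  fields, so coordinates enter only through cutoff functions; Hadamard's formula then identifies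
  derivations with coordinate vectors. The operators \<open>de_rham\<close> and
  \<open>bidegree_component\<close> are definite descriptions and carry no information until
  existence and uniqueness are shown: for \<open>de_rham\<close> this rests on tensoriality over the
  smooth functions, for \<open>bidegree_component\<close> on the smoothness of \<open>J\<close>. In
  the converse the part of \<open>d_E\<close> of bidegree (1, 0) sends \<open>df \<circ> J\<close>
  to bidegree (2, 0), where brackets of sections of \<open>P\<close> are visible, and the part of
  bidegree (-1, 2) sends it to (0, 2), where brackets of sections of \<open>Q\<close> are. The two
  targets are different bidegrees, so one equation \<open>d_E (d_E f) = 0\<close> yields both
  involutivity conditions.\<close>

lemma frechet_derivative_cong_open:
  assumes "open S" "x \<in> S" "\<And>y. y \<in> S \<Longrightarrow> f y = g y"
  shows "frechet_derivative f (at x) = frechet_derivative g (at x)"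
proof -
  have "(f has_derivative f') (at x) \<longleftrightarrow> (g has_derivative f') (at x)" for f'
    using assms has_derivative_transform_within_open[of f f' x UNIV S g]
      has_derivative_transform_within_open[of g f' x UNIV S f] by auto
  then show ?thesis by (simp add: frechet_derivative_def)
qed

lemma differentiable_cong_open:
  assumes "open S" "x \<in> S" "\<And>y. y \<in> S \<Longrightarrow> f y = g y" "f differentiable (at x)"
  shows "g differentiable (at x)"
  using assms has_derivative_transform_within_open[of f _ x UNIV S g]
  unfolding differentiable_def by blast

lemma Ck_cong:
  assumes "open S" "\<And>y. y \<in> S \<Longrightarrow> f y = g y" "Ck k S f"
  shows "Ck k S g"
  using assms
proof (induction k arbitrary: f g)
  case 0
  then show ?case using continuous_on_cong by force
next
  case (Suc k)
  have "Ck k S (\<lambda>x. frechet_derivative g (at x) v)" for v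
    using Suc.IH[of "\<lambda>x. frechet_derivative f (at x) v" "\<lambda>x. frechet_derivative g (at x) v"]
      Suc.prems frechet_derivative_cong_open[OF Suc.prems(1), of _ f g] by simp
  then show ?case using Suc.prems differentiable_cong_open[OF Suc.prems(1), of _ f g] by auto
qed

lemma Ck_subset: "Ck k S f \<Longrightarrow> T \<subseteq> S \<Longrightarrow> Ck k T f"
  by (induction k arbitrary: f) (auto intro: continuous_on_subset)

lemma Ck_SucD: "open S \<Longrightarrow> Ck (Suc k) S f \<Longrightarrow> Ck k S f"
proof (induction k arbitrary: f)
  case 0
  then show ?case
    by (auto intro!: continuous_at_imp_continuous_on differentiable_imp_continuous_within)
next
  case (Suc k)
  then show ?case by auto
qed

lemma Ck_local:
  assumes "\<And>x. x \<in> S \<Longrightarrow> \<exists>T. open T \<and> x \<in> T \<and> Ck k T f"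
  shows "Ck k S f"
  using assms
proof (induction k arbitrary: f)
  case 0
  show ?case
  proof (simp, rule continuous_at_imp_continuous_on, safe)
    fix x assume "x \<in> S"
    with 0 obtain T where "open T" "x \<in> T" "Ck 0 T f" by blast
    then show "isCont f x" by (simp add: continuous_on_eq_continuous_at)
  qed
next
  case (Suc k)
  have "Ck k S (\<lambda>x. frechet_derivative f (at x) v)" for v
  proof (rule Suc.IH)
    fix x assume "x \<in> S"
    from Suc.prems[OF this] obtain T where "open T" "x \<in> T" "Ck (Suc k) T f" by blast
    then show "\<exists>T. open T \<and> x \<in> T \<and> Ck k T (\<lambda>x. frechet_derivative f (at x) v)"
      by (intro exI[of _ T]) simp
  qed
  moreover have "f differentiable (at x)" if "x \<in> S" for x
    using Suc.prems[OF that] by auto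
  ultimately show ?case by simp
qed

text \<open>Derivatives at a point are unique, so an explicit formula \<open>f'\<close> may stand
  for the chosen \<open>frechet_derivative\<close>. Together with \<open>Ck_SucE\<close> this turns
  each closure property below into a rule of calculus and an induction on \<open>k\<close>.\<close>

lemma Ck_SucI:
  assumes "open S" "\<And>x. x \<in> S \<Longrightarrow> (f has_derivative f' x) (at x)"
    "\<And>v. Ck k S (\<lambda>x. f' x v)"
  shows "Ck (Suc k) S f"
proof -
  have "frechet_derivative f (at x) = f' x" if "x \<in> S" for x
    using assms(2)[OF that] frechet_derivative_at by metis
  then have "Ck k S (\<lambda>x. frechet_derivative f (at x) v)" for v
    using Ck_cong[OF assms(1) _ assms(3)[of v]] by simp
  with assms(2) show ?thesis by (auto simp: differentiable_def)
qed

lemma Ck_SucE: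
  assumes "Ck (Suc k) S f"
  obtains f' where "\<And>x. x \<in> S \<Longrightarrow> (f has_derivative f' x) (at x)" "\<And>v. Ck k S (\<lambda>x. f' x v)"
proof (rule that)
  show "(f has_derivative frechet_derivative f (at x)) (at x)" if "x \<in> S" for x
    using assms that by (simp add: frechet_derivative_works)
  show "Ck k S (\<lambda>x. frechet_derivative f (at x) v)" for v
    using assms by simp
qed

lemma Ck_const [simp]: "Ck k S (\<lambda>x. c)"
proof (induction k arbitrary: c)
  case (Suc k)
  then show ?case by (simp add: frechet_derivative_const)
qed simp

lemma Ck_bounded_linear:
  assumes "bounded_linear L" "open S" "Ck k S f"
  shows "Ck k S (\<lambda>x. L (f x))"
  using assms(3)
proof (induction k arbitrary: f)
  case 0
  then show ?case using assms(1) by (simp add: bounded_linear.continuous_on)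
next
  case (Suc k)
  from Ck_SucE[OF Suc.prems] obtain f' where
    f': "\<And>x. x \<in> S \<Longrightarrow> (f has_derivative f' x) (at x)" "\<And>v. Ck k S (\<lambda>x. f' x v)" by blast
  show ?case
    by (rule Ck_SucI[OF assms(2), where f' = "\<lambda>x v. L (f' x v)"])
      (auto intro: Suc.IH f' bounded_linear.has_derivative[OF assms(1)])
qed

lemma Ck_add:
  assumes "open S" "Ck k S f" "Ck k S g"
  shows "Ck k S (\<lambda>x. f x + g x)"
  using assms(2,3)
proof (induction k arbitrary: f g)
  case 0
  then show ?case by (simp add: continuous_on_add)
next
  case (Suc k)
  from Ck_SucE[OF Suc.prems(1)] obtain f' where
    f': "\<And>x. x \<in> S \<Longrightarrow> (f has_derivative f' x) (at x)" "\<And>v. Ck k S (\<lambda>x. f' x v)" by blast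
  from Ck_SucE[OF Suc.prems(2)] obtain g' where
    g': "\<And>x. x \<in> S \<Longrightarrow> (g has_derivative g' x) (at x)" "\<And>v. Ck k S (\<lambda>x. g' x v)" by blast
  show ?case
    by (rule Ck_SucI[OF assms(1), where f' = "\<lambda>x v. f' x v + g' x v"])
      (auto intro: Suc.IH f' g' has_derivative_add)
qed

lemma Ck_sum:
  assumes "open S" "finite I" "\<And>i. i \<in> I \<Longrightarrow> Ck k S (f i)"
  shows "Ck k S (\<lambda>x. \<Sum>i\<in>I. f i x)"
  using assms(2,3) by (induction I) (auto intro: Ck_add[OF assms(1)])

lemma Ck_mult:
  fixes f g :: "'b::real_normed_vector \<Rightarrow> real"
  assumes "open S" "Ck k S f" "Ck k S g"
  shows "Ck k S (\<lambda>x. f x * g x)"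
  using assms(2,3)
proof (induction k arbitrary: f g)
  case 0
  then show ?case by (simp add: continuous_on_mult)
next
  case (Suc k)
  note fg = Ck_SucD[OF assms(1) Suc.prems(1)] Ck_SucD[OF assms(1) Suc.prems(2)]
  from Ck_SucE[OF Suc.prems(1)] obtain f' where
    f': "\<And>x. x \<in> S \<Longrightarrow> (f has_derivative f' x) (at x)" "\<And>v. Ck k S (\<lambda>x. f' x v)" by blast
  from Ck_SucE[OF Suc.prems(2)] obtain g' where
    g': "\<And>x. x \<in> S \<Longrightarrow> (g has_derivative g' x) (at x)" "\<And>v. Ck k S (\<lambda>x. g' x v)" by blast
  show ?case
    by (rule Ck_SucI[OF assms(1), where f' = "\<lambda>x v. f x * g' x v + f' x v * g x"])
      (intro has_derivative_mult f' g' Ck_add[OF assms(1)] Suc.IH fg; assumption)+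
qed

text \<open>Up to sign the derivative of \<open>1 / f\<close> is a product of two factors
  \<open>1 / f\<close> and one factor \<open>f'\<close>; the first two are of class C^k by the
  induction hypothesis.\<close>

lemma Ck_inverse:
  fixes f :: "'b::real_normed_vector \<Rightarrow> real"
  assumes "open S" "Ck k S f" "\<And>x. x \<in> S \<Longrightarrow> f x \<noteq> 0"
  shows "Ck k S (\<lambda>x. inverse (f x))"
  using assms(2)
proof (induction k)
  case 0
  then show ?case using assms(3) by (simp add: continuous_on_inverse)
next
  case (Suc k)
  from Ck_SucE[OF Suc.prems(1)] obtain f' where
    f': "\<And>x. x \<in> S \<Longrightarrow> (f has_derivative f' x) (at x)" "\<And>v. Ck k S (\<lambda>x. f' x v)" by blast
  note inv = Suc.IH[OF Ck_SucD[OF assms(1) Suc.prems(1)]]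
  show ?case
  proof (rule Ck_SucI[OF assms(1), where f' = "\<lambda>x v. (- 1) * (inverse (f x) * f' x v * inverse (f x))"])
    fix x assume "x \<in> S"
    then show "((\<lambda>x. inverse (f x)) has_derivative
        (\<lambda>v. (- 1) * (inverse (f x) * f' x v * inverse (f x)))) (at x)"
      using Deriv.has_derivative_inverse[OF assms(3) f'(1)] by simp
  next
    fix v
    show "Ck k S (\<lambda>x. (- 1) * (inverse (f x) * f' x v * inverse (f x)))"
      by (intro Ck_mult[OF assms(1)] inv f' Ck_const)
  qed
qed

lemma Ck_id: "open S \<Longrightarrow> Ck k S (\<lambda>x. x)"
proof (induction k)
  case (Suc k)
  show ?case by (rule Ck_SucI[OF Suc.prems, where f' = "\<lambda>x v. v"]) (auto intro: has_derivative_ident)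
qed simp

section \<open>Orthonormal coordinates and composition of C^k maps\<close>

definition orthonormal_basis :: "nat \<Rightarrow> (nat \<Rightarrow> 'b::real_inner) \<Rightarrow> bool" where
  "orthonormal_basis n e \<longleftrightarrow> (\<forall>i<n. \<forall>j<n. e i \<bullet> e j = (if i = j then 1 else 0)) \<and>
     (\<forall>v. v = (\<Sum>i<n. (v \<bullet> e i) *\<^sub>R e i))"

text \<open>The sort of the model space admits dimension zero and provides no \<open>Basis\<close>.
  Coordinates come from an orthogonalised spanning set whose nonzero elements are normalised and
  numbered.\<close>

lemma orthonormal_basis_exists:
  fixes B :: "'b::real_inner set"
  assumes "finite B" "span B = UNIV"
  obtains n and e :: "nat \<Rightarrow> 'b" where "orthonormal_basis n e"
proof -
  from basis_orthogonal[OF assms(1)] assms(2) obtain C :: "'b set" where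
    C: "finite C" "span C = UNIV" "pairwise real_inner_class.orthogonal C" by auto
  define D where "D = (\<lambda>c. c /\<^sub>R norm c) ` (C - {0})"
  have finD: "finite D" using C(1) by (simp add: D_def)
  have normD: "d \<bullet> d = 1" if "d \<in> D" for d
  proof -
    from that obtain c where c: "d = c /\<^sub>R norm c" "c \<noteq> 0" unfolding D_def by blast
    then show ?thesis by (simp add: dot_square_norm power2_eq_square)
  qed
  have orthD: "d \<bullet> d' = 0" if "d \<in> D" "d' \<in> D" "d \<noteq> d'" for d d'
  proof -
    from that obtain c c' where "c \<in> C" "c' \<in> C" "c \<noteq> c'" "d = c /\<^sub>R norm c" "d' = c' /\<^sub>R norm c'"
      unfolding D_def by blast
    then show ?thesis using C(3) by (auto simp: pairwise_def real_inner_class.orthogonal_def)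
  qed
  have "C \<subseteq> span D"
  proof
    fix c assume "c \<in> C"
    show "c \<in> span D"
    proof (cases "c = 0")
      case False
      with \<open>c \<in> C\<close> have "c /\<^sub>R norm c \<in> span D" by (auto simp: D_def intro!: span_base)
      from span_scale[OF this, of "norm c"] False show ?thesis by simp
    qed (simp add: span_zero)
  qed
  then have spanD: "span D = UNIV" using C(2) span_mono span_span by blast
  have expand: "v = (\<Sum>d\<in>D. (v \<bullet> d) *\<^sub>R d)" for v
  proof -
    have "v \<in> span D" using spanD by simp
    then show ?thesis
    proof (induction rule: span_induct_alt)
      case base
      then show ?case by simp
    next
      case (step c d v)
      have "(\<Sum>d'\<in>D. (d \<bullet> d') *\<^sub>R d') = (\<Sum>d'\<in>D. if d' = d then d else 0)"
        using step normD orthD by (intro sum.cong) auto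
      also have "\<dots> = d" using step finD by simp
      finally have "(\<Sum>d'\<in>D. (d \<bullet> d') *\<^sub>R d') = d" .
      then have "(\<Sum>d'\<in>D. ((c *\<^sub>R d) \<bullet> d') *\<^sub>R d') = c *\<^sub>R d"
        by (simp add: scaleR_sum_right[symmetric] flip: scaleR_scaleR)
      with step show ?case by (simp add: inner_add_left scaleR_add_left sum.distrib)
    qed
  qed
  obtain e where e: "bij_betw e {..<card D} D"
    using finD by (metis bij_betw_from_nat_into_finite)
  have inj: "inj_on e {..<card D}" and img: "e ` {..<card D} = D" using e by (auto simp: bij_betw_def)
  have "orthonormal_basis (card D) e"
    unfolding orthonormal_basis_def
  proof (intro conjI allI impI)
    fix i j assume "i < card D" "j < card D"
    then show "e i \<bullet> e j = (if i = j then 1 else 0)"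
      using normD orthD inj img by (metis image_eqI inj_onD lessThan_iff)
  next
    fix v
    show "v = (\<Sum>i<card D. (v \<bullet> e i) *\<^sub>R e i)"
      using expand[of v] sum.reindex_bij_betw[OF e, of "\<lambda>d. (v \<bullet> d) *\<^sub>R d"] by simp
  qed
  then show ?thesis by (rule that)
qed

lemma linear_orthonormal_expand:
  assumes "orthonormal_basis n e" "linear L"
  shows "L v = (\<Sum>i<n. (v \<bullet> e i) *\<^sub>R L (e i))"
proof -
  have "v = (\<Sum>i<n. (v \<bullet> e i) *\<^sub>R e i)" using assms(1) unfolding orthonormal_basis_def by blast
  from arg_cong[OF this, of L] show ?thesis
    by (simp add: linear_sum[OF assms(2)] linear_scale[OF assms(2)])
qed

text \<open>In the chain rule the direction \<open>h' x v\<close> depends on \<open>x\<close>,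
  whereas \<open>Ck\<close> differentiates in fixed directions. Expanding it in the basis
  \<open>e\<close> leaves products of coordinates of \<open>h' x v\<close> with
  \<open>g' (h x) (e i)\<close>, and the induction hypothesis applies to the latter.\<close>

lemma Ck_compose:
  fixes e :: "nat \<Rightarrow> 'b::real_inner" and g :: "'b \<Rightarrow> real" and h :: "'d::real_normed_vector \<Rightarrow> 'b"
  assumes "orthonormal_basis n e" "open S" "open T" "h ` S \<subseteq> T" "Ck k S h" "Ck k T g"
  shows "Ck k S (\<lambda>x. g (h x))"
  using assms(4-6)
proof (induction k arbitrary: g)
  case 0
  then show ?case using continuous_on_compose2[of T g S h] by auto
next
  case (Suc k)
  from Ck_SucE[OF Suc.prems(2)] obtain h' where
    h': "\<And>x. x \<in> S \<Longrightarrow> (h has_derivative h' x) (at x)" "\<And>v. Ck k S (\<lambda>x. h' x v)" by blast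
  from Ck_SucE[OF Suc.prems(3)] obtain g' where
    g': "\<And>x. x \<in> T \<Longrightarrow> (g has_derivative g' x) (at x)" "\<And>v. Ck k T (\<lambda>x. g' x v)" by blast
  note h = Ck_SucD[OF assms(2) Suc.prems(2)]
  show ?case
  proof (rule Ck_SucI[OF assms(2), where f' = "\<lambda>x v. \<Sum>i<n. (h' x v \<bullet> e i) * g' (h x) (e i)"])
    fix x assume x: "x \<in> S"
    with assms(4) have "h x \<in> T" by auto
    note g'x = g'(1)[OF this]
    have "((\<lambda>x. g (h x)) has_derivative (\<lambda>v. g' (h x) (h' x v))) (at x)"
      using diff_chain_at[OF h'(1)[OF x] g'x] by (simp add: o_def)
    moreover have "(\<lambda>v. g' (h x) (h' x v)) = (\<lambda>v. \<Sum>i<n. (h' x v \<bullet> e i) * g' (h x) (e i))"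
    proof
      fix v
      show "g' (h x) (h' x v) = (\<Sum>i<n. (h' x v \<bullet> e i) * g' (h x) (e i))"
        using linear_orthonormal_expand[OF assms(1) has_derivative_linear[OF g'x], of "h' x v"]
        unfolding real_scaleR_def .
    qed
    ultimately show "((\<lambda>x. g (h x)) has_derivative (\<lambda>v. \<Sum>i<n. (h' x v \<bullet> e i) * g' (h x) (e i))) (at x)"
      by (simp only:)
  next
    fix v
    have "Ck k S (\<lambda>x. h' x v \<bullet> e i)" for i
      using Ck_bounded_linear[OF bounded_linear_inner_left assms(2) h'(2)] .
    then show "Ck k S (\<lambda>x. \<Sum>i<n. (h' x v \<bullet> e i) * g' (h x) (e i))"
      by (intro Ck_sum Ck_mult assms(2) Suc.IH Suc.prems(1) h g'(2)) auto
  qed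
qed

section \<open>Flat functions and bump functions\<close>

definition flat :: "nat \<Rightarrow> real \<Rightarrow> real" where
  "flat m t = (if t > 0 then exp (- inverse t) * inverse t ^ m else 0)"

text \<open>For \<open>t > 0\<close> this is the product rule for
  \<open>exp (- 1 / t) / t ^ m\<close>. The index \<open>m\<close> exists because differentiation
  leads out of \<open>flat 0\<close>, but not out of the linear span of the whole family.\<close>

lemma flat_has_derivative:
  "(flat m has_real_derivative (flat (m + 2) t - of_nat m * flat (m + 1) t)) (at t)"
proof (cases t "0::real" rule: linorder_cases)
  case greater
  have "((\<lambda>t. inverse t ^ m) has_real_derivative
      of_nat m * inverse t ^ (m - 1) * (- (inverse t)\<^sup>2)) (at t)"
    using greater by (auto intro!: derivative_eq_intros simp: power2_eq_square)
  moreover have "of_nat m * inverse t ^ (m - 1) * (- (inverse t)\<^sup>2) = - (of_nat m * inverse t ^ (m + 1))"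
    by (cases m) (simp_all add: power2_eq_square)
  ultimately have 1: "((\<lambda>t. inverse t ^ m) has_real_derivative - (of_nat m * inverse t ^ (m + 1))) (at t)"
    by (simp only:)
  have 2: "((\<lambda>t. exp (- inverse t)) has_real_derivative exp (- inverse t) * (inverse t)\<^sup>2) (at t)"
    using greater by (auto intro!: derivative_eq_intros simp: power2_eq_square)
  from DERIV_mult[OF 2 1]
have "((\<lambda>t. exp (- inverse t) * inverse t ^ m) has_real_derivative
      (flat (m + 2) t - of_nat m * flat (m + 1) t)) (at t)"
    using greater by (simp add: flat_def power2_eq_square algebra_simps)
  then show ?thesis
    by (rule DERIV_cong_ev[THEN iffD1, rotated -1])
      (use greater in \<open>auto simp: flat_def eventually_nhds intro!: exI[of _ "{0<..}"]\<close>)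
next
  case less
  have "((\<lambda>t. 0) has_real_derivative 0) (at t)" by simp
  then have "(flat m has_real_derivative 0) (at t)"
    by (rule DERIV_cong_ev[THEN iffD1, rotated -1])
      (use less in \<open>auto simp: flat_def eventually_nhds intro!: exI[of _ "{..<0}"]\<close>)
  with less show ?thesis by (simp add: flat_def)
next
  case equal
  \<comment> \<open>This is the difference quotient of \<open>flat m\<close> at 0 from the right;
    the substitution \<open>x = 1 / t\<close> turns it into \<open>x ^ (m + 1) / exp x\<close> at
    infinity.\<close>
  have lim: "((\<lambda>t. exp (- inverse t) * inverse t ^ (Suc m)) \<longlongrightarrow> 0) (at_right (0::real))"
  proof -
    have "((\<lambda>x::real. x ^ Suc m / exp x) \<longlongrightarrow> 0) at_top"
      by (rule tendsto_power_div_exp_0)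
    from filterlim_compose[OF this filterlim_inverse_at_top_right]
    show ?thesis by (simp add: exp_minus field_simps)
  qed
  have "((\<lambda>h. flat m h / h) \<longlongrightarrow> 0) (at 0)"
  proof (rule filterlim_split_at)
    have "\<forall>\<^sub>F h in at_left 0. 0 = flat m h / h"
      by (simp add: eventually_at_filter flat_def)
    then show "((\<lambda>h. flat m h / h) \<longlongrightarrow> 0) (at_left 0)"
      by (rule Lim_transform_eventually[rotated]) simp
    have "\<forall>\<^sub>F h in at_right 0. exp (- inverse h) * inverse h ^ (Suc m) = flat m h / h"
      by (simp add: eventually_at_filter flat_def field_simps)
    then show "((\<lambda>h. flat m h / h) \<longlongrightarrow> 0) (at_right 0)"
      by (rule Lim_transform_eventually[OF lim])
  qed
  with equal show ?thesis by (simp add: DERIV_def flat_def)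
qed

text \<open>The induction runs over all \<open>m\<close> at once, as the derivative involves
  \<open>flat (m + 1)\<close> and \<open>flat (m + 2)\<close>.\<close>

lemma flat_compose_Ck:
  fixes u :: "'b::real_normed_vector \<Rightarrow> real"
  assumes "open S" "Ck k S u"
  shows "Ck k S (\<lambda>x. flat m (u x))"
  using assms(2)
proof (induction k arbitrary: m)
  case 0
  have "continuous_on UNIV (flat m)"
    by (meson DERIV_isCont continuous_at_imp_continuous_on flat_has_derivative)
  with 0 show ?case by (simp add: continuous_on_compose2)
next
  case (Suc k)
  from Ck_SucE[OF Suc.prems(1)] obtain u' where
    u': "\<And>x. x \<in> S \<Longrightarrow> (u has_derivative u' x) (at x)" "\<And>v. Ck k S (\<lambda>x. u' x v)" by blast
  note u = Ck_SucD[OF assms(1) Suc.prems(1)]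
  show ?case
  proof (rule Ck_SucI[OF assms(1), where f' = "\<lambda>x v. (flat (m + 2) (u x) + (- of_nat m) * flat (m + 1) (u x)) * u' x v"])
    fix x assume x: "x \<in> S"
    show "((\<lambda>x. flat m (u x)) has_derivative
        (\<lambda>v. (flat (m + 2) (u x) + (- of_nat m) * flat (m + 1) (u x)) * u' x v)) (at x)"
      using diff_chain_at[OF u'(1)[OF x] flat_has_derivative[of m "u x", unfolded has_field_derivative_def]]
      by (simp add: o_def)
  next
    fix v
    show "Ck k S (\<lambda>x. (flat (m + 2) (u x) + (- of_nat m) * flat (m + 1) (u x)) * u' x v)"
      by (intro Ck_mult Ck_add assms(1) Suc.IH u u' Ck_const)
  qed
qed

text \<open>The function is \<open>p / (p + q)\<close>, where \<open>p\<close> is positive exactly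
  inside the ball of radius \<open>R\<close> and \<open>q\<close> exactly outside the closed ball of
  radius \<open>R / 2\<close>; these regions cover the space, so the denominator never vanishes. The
  squared distance \<open>s\<close> is quadratic and hence smooth also at the centre.\<close>

lemma smooth_bump_exists:
  fixes z :: "'b::real_inner"
  assumes "0 < R"
  obtains \<beta> :: "'b \<Rightarrow> real" and r where "smooth_on UNIV \<beta>" "0 < r" "r < R"
    "\<forall>y. dist z y < r \<longrightarrow> \<beta> y = 1" "\<forall>y. dist z y \<ge> R \<longrightarrow> \<beta> y = 0"
proof -
  define s where "s y = (y - z) \<bullet> (y - z)" for y
  define p where "p y = flat 0 (R\<^sup>2 - s y)" for y
  define q where "q y = flat 0 (s y - (R/2)\<^sup>2)" for y
  have s: "s y = (dist z y)\<^sup>2" for y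
    by (simp add: s_def dist_norm power2_norm_eq_inner norm_minus_commute)
  have nonneg: "flat 0 t \<ge> 0" for t by (simp add: flat_def)
  have pos: "t > 0 \<Longrightarrow> flat 0 t > 0" for t by (simp add: flat_def)
  have pq: "p y + q y > 0" for y
  proof (cases "s y < R\<^sup>2")
    case True
    then show ?thesis using pos[of "R\<^sup>2 - s y"] nonneg by (simp add: p_def q_def add_pos_nonneg)
  next
    case False
    then have "s y - (R/2)\<^sup>2 > 0" using assms by (simp add: power2_eq_square) (smt (verit) mult_pos_pos)
    then show ?thesis using pos nonneg by (simp add: p_def q_def add_nonneg_pos)
  qed
  have Cs: "Ck k UNIV s" for k
  proof (cases k)
    case 0
    then show ?thesis unfolding s_def by (auto intro!: continuous_intros)
  next
    case (Suc j)
    have "bounded_linear (\<lambda>x::'b. 2 * (x \<bullet> v))" for v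
      by (intro bounded_linear_intros)
    moreover have "Ck j UNIV (\<lambda>y. y + (- z))" by (intro Ck_add Ck_id Ck_const open_UNIV)
    ultimately have lin: "Ck j UNIV (\<lambda>x. 2 * ((x + (- z)) \<bullet> v))" for v
      using Ck_bounded_linear[OF _ open_UNIV] by blast
    have "Ck (Suc j) UNIV s"
      unfolding s_def
      by (rule Ck_SucI[where f' = "\<lambda>x v. 2 * ((x + (- z)) \<bullet> v)", OF open_UNIV _ lin])
        (auto intro!: derivative_eq_intros simp: inner_commute algebra_simps)
    with Suc show ?thesis by simp
  qed
  have "smooth_on UNIV (\<lambda>y. p y * inverse (p y + q y))"
    unfolding smooth_on_def
  proof
    fix k
    have "Ck k UNIV (\<lambda>y. R\<^sup>2 + (- 1) * s y)" "Ck k UNIV (\<lambda>y. s y + (- (R/2)\<^sup>2))"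
      by (intro Ck_add Ck_mult Ck_const Cs open_UNIV)+
    then have "Ck k UNIV p" "Ck k UNIV q"
      unfolding p_def q_def by (auto dest!: flat_compose_Ck[OF open_UNIV, of _ _ 0])
    then show "Ck k UNIV (\<lambda>y. p y * inverse (p y + q y))"
      by (intro Ck_mult Ck_inverse Ck_add open_UNIV) (metis pq less_irrefl)+
  qed
  moreover have "p y * inverse (p y + q y) = 1" if "dist z y < R/2" for y
  proof -
    have "s y \<le> (R/2)\<^sup>2" using that by (simp add: s power_mono)
    then have "q y = 0" by (simp add: q_def flat_def)
    with pq[of y] show ?thesis by simp
  qed
  moreover have "p y * inverse (p y + q y) = 0" if "dist z y \<ge> R" for y
  proof -
    have "s y \<ge> R\<^sup>2" using that assms by (simp add: s power_mono)
    then have "p y = 0" by (simp add: p_def flat_def)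
    then show ?thesis by simp
  qed
  ultimately show ?thesis using assms by (intro that[of "\<lambda>y. p y * inverse (p y + q y)" "R/2"]) auto
qed

text \<open>Differentiation under the integral sign. The linearisation error of \<open>F\<close>
  along the segment is at most \<open>\<epsilon> * t * norm h\<close>, uniformly in
  \<open>t\<close>, because the gradient is uniformly continuous on a closed ball inside
  \<open>ball x0 R\<close>. Each differentiation brings down a factor \<open>t\<close>, whence the
  weight \<open>t ^ m\<close>.\<close>

lemma segment_integral_has_derivative:
  fixes e :: "nat \<Rightarrow> 'b::{real_inner, heine_borel}" and F :: "'b \<Rightarrow> real"
  assumes ob: "orthonormal_basis n e"
    and F': "\<And>z. z \<in> ball x0 R \<Longrightarrow> (F has_derivative F' z) (at z)"
    and contF': "\<And>v. continuous_on (ball x0 R) (\<lambda>z. F' z v)"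
    and y: "y \<in> ball x0 R"
  shows "((\<lambda>y. integral {0..1} (\<lambda>t. t ^ m * F (x0 + t *\<^sub>R (y - x0)))) has_derivative
    (\<lambda>h. \<Sum>i<n. (h \<bullet> e i) * integral {0..1} (\<lambda>t. t ^ Suc m * F' (x0 + t *\<^sub>R (y - x0)) (e i)))) (at y)"
  (is "(?I has_derivative ?D) _")
  unfolding has_derivative_at_alt
proof (intro conjI allI impI)
  show "bounded_linear ?D"
    by (intro bounded_linear_sum bounded_linear_mult_const bounded_linear_inner_left)
  define p where "p y t = x0 + t *\<^sub>R (y - x0)" for y and t :: real
  \<comment> \<open>Continuity of \<open>F'\<close> is given for each direction separately. Since
    \<open>F' z h = h \<bullet> grad z\<close>, uniform continuity of the single map
    \<open>grad\<close> bounds the operator norm of differences of \<open>F'\<close>.\<close>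
  define grad where "grad z = (\<Sum>i<n. F' z (e i) *\<^sub>R e i)" for z
  have F'_grad: "F' z h = h \<bullet> grad z" if "z \<in> ball x0 R" for z h
    using linear_orthonormal_expand[OF ob has_derivative_linear[OF F'[OF that]], of h]
    by (simp add: grad_def inner_sum_right mult.commute)
  have contF: "continuous_on (ball x0 R) F"
    by (meson F' continuous_at_imp_continuous_on has_derivative_continuous)
  fix \<epsilon> :: real assume \<epsilon>: "\<epsilon> > 0"
  obtain \<rho> where \<rho>: "norm (y - x0) < \<rho>" "\<rho> < R"
    using y dense by (metis dist_norm mem_ball norm_minus_commute)
  have sub: "cball x0 \<rho> \<subseteq> ball x0 R" using \<rho> by auto
  have "continuous_on (cball x0 \<rho>) grad"
    unfolding grad_def using contF' sub
    by (intro continuous_on_sum continuous_on_scaleR continuous_on_const) (meson continuous_on_subset)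
  then have "uniformly_continuous_on (cball x0 \<rho>) grad"
    by (rule compact_uniformly_continuous) simp
  then obtain \<delta> where \<delta>: "\<delta> > 0"
    "\<And>z z'. z \<in> cball x0 \<rho> \<Longrightarrow> z' \<in> cball x0 \<rho> \<Longrightarrow> dist z' z < \<delta> \<Longrightarrow> dist (grad z') (grad z) < \<epsilon>"
    using \<epsilon> unfolding uniformly_continuous_on_def by metis
  have pK: "p y' t \<in> cball x0 \<rho>" if "norm (y' - x0) \<le> \<rho>" "t \<in> {0..1}" for y' t
    using that mult_left_le_one_le[of "norm (y' - x0)" t] by (simp add: p_def dist_norm)
  have contp: "continuous_on {0..1} (p y')" for y' unfolding p_def by (intro continuous_intros)
  have int: "(\<lambda>t. t ^ j * G (p y' t)) integrable_on {0..1}"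
    if "norm (y' - x0) \<le> \<rho>" "continuous_on (ball x0 R) G" for y' j and G :: "'b \<Rightarrow> real"
  proof (rule integrable_continuous_real, intro continuous_on_mult continuous_on_power continuous_on_id)
    show "continuous_on {0..1} (\<lambda>t. G (p y' t))"
      by (rule continuous_on_compose2[OF that(2) contp]) (use pK that(1) sub in blast)
  qed
  show "\<exists>d>0. \<forall>y'. norm (y' - y) < d \<longrightarrow> norm (?I y' - ?I y - ?D (y' - y)) \<le> \<epsilon> * norm (y' - y)"
  \<comment> \<open>The bound \<open>\<delta>\<close> serves uniform continuity; the other one keeps
    \<open>y'\<close>, and with it the segment from \<open>x0\<close>, inside
    \<open>cball x0 \<rho>\<close>.\<close>
  proof (intro exI[of _ "min \<delta> (\<rho> - norm (y - x0))"] conjI allI impI)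
    show "0 < min \<delta> (\<rho> - norm (y - x0))" using \<delta> \<rho> by simp
    fix y' assume y': "norm (y' - y) < min \<delta> (\<rho> - norm (y - x0))"
    define h where "h = y' - y"
    have ny': "norm (y' - x0) \<le> \<rho>"
      using y' norm_triangle_ineq[of "y' - y" "y - x0"] by simp
    have ny: "norm (y - x0) \<le> \<rho>" using \<rho> by simp
    have D: "?D h = integral {0..1} (\<lambda>t. t ^ Suc m * F' (p y t) h)"
    proof -
      have i: "(\<lambda>t. t ^ Suc m * F' (p y t) (e i)) integrable_on {0..1}" for i
        by (rule int[OF ny contF'])
      have "?D h = (\<Sum>i<n. integral {0..1} (\<lambda>t. (h \<bullet> e i) * (t ^ Suc m * F' (p y t) (e i))))"
        by (simp add: p_def)
      also have "\<dots> = integral {0..1} (\<lambda>t. \<Sum>i<n. (h \<bullet> e i) * (t ^ Suc m * F' (p y t) (e i)))"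
        by (intro integral_sum[symmetric] integrable_on_mult_right i) simp
      also have "\<dots> = integral {0..1} (\<lambda>t. t ^ Suc m * F' (p y t) h)"
      proof (intro integral_cong)
        fix t :: real assume "t \<in> {0..1}"
        then have "p y t \<in> ball x0 R" using pK ny sub by blast
        then show "(\<Sum>i<n. (h \<bullet> e i) * (t ^ Suc m * F' (p y t) (e i))) = t ^ Suc m * F' (p y t) h"
          using linear_orthonormal_expand[OF ob has_derivative_linear[OF F'], of "p y t" h]
          by (simp add: sum_distrib_left mult_ac)
      qed
      finally show ?thesis .
    qed
    have "?I y' - ?I y - ?D h =
      integral {0..1} (\<lambda>t. t ^ m * F (p y' t) - t ^ m * F (p y t) - t ^ Suc m * F' (p y t) h)"
      unfolding D using int[OF ny' contF, of m] int[OF ny contF, of m] int[OF ny contF', of "Suc m" h]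
      by (simp add: integral_diff integrable_diff p_def)
    moreover have "norm (integral {0..1} (\<lambda>t. t ^ m * F (p y' t) - t ^ m * F (p y t) - t ^ Suc m * F' (p y t) h))
      \<le> integral {0..1} (\<lambda>t::real. \<epsilon> * norm h)"
    proof (rule integral_norm_bound_integral)
      show "(\<lambda>t. t ^ m * F (p y' t) - t ^ m * F (p y t) - t ^ Suc m * F' (p y t) h) integrable_on {0..1}"
        by (intro integrable_diff int ny ny' contF contF')
      show "(\<lambda>t::real. \<epsilon> * norm h) integrable_on {0..1}" by (rule integrable_const_ivl)
      fix t :: real assume t: "t \<in> {0..1}"
      have ba: "p y' t - p y t = t *\<^sub>R h" by (simp add: p_def h_def algebra_simps)
      have K: "p y t \<in> cball x0 \<rho>" "p y' t \<in> cball x0 \<rho>" using pK ny ny' t by auto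
      have seg: "closed_segment (p y t) (p y' t) \<subseteq> cball x0 \<rho>"
        by (rule closed_segment_subset[OF K convex_cball])
      have "norm (F (p y' t) - F (p y t) - F' (p y t) (p y' t - p y t)) \<le> norm (p y' t - p y t) * \<epsilon>"
      proof (rule differentiable_bound_linearization[where S = "closed_segment (p y t) (p y' t)"])
        show "p y t + s *\<^sub>R (p y' t - p y t) \<in> closed_segment (p y t) (p y' t)" if "s \<in> {0..1}" for s
          using that by (auto simp: in_segment algebra_simps intro!: exI[of _ s])
        fix z assume z: "z \<in> closed_segment (p y t) (p y' t)"
        then have zb: "z \<in> ball x0 R" using seg sub by blast
        show "(F has_derivative F' z) (at z within closed_segment (p y t) (p y' t))"
          using F'[OF zb] has_derivative_at_withinI by blast
        have "norm (z - p y t) \<le> norm (p y' t - p y t)"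
          using segment_bound(1)[OF z] by (simp add: norm_minus_commute)
        also have "\<dots> \<le> norm h" using t by (simp add: ba mult_left_le_one_le)
        finally have "dist z (p y t) < \<delta>" using y' by (simp add: dist_norm h_def)
        then have g: "norm (grad z - grad (p y t)) \<le> \<epsilon>"
          using \<delta>(2)[of "p y t" z] seg z K by (simp add: dist_norm subset_iff less_imp_le)
        show "onorm (F' z - F' (p y t)) \<le> \<epsilon>"
        proof (rule onorm_bound)
          fix v
          have "F' z v - F' (p y t) v = v \<bullet> (grad z - grad (p y t))"
            using F'_grad zb K sub by (simp add: inner_diff_right subset_iff)
          then have "norm (F' z v - F' (p y t) v) \<le> norm v * norm (grad z - grad (p y t))"
            using Cauchy_Schwarz_ineq2[of v] by simp
          also have "\<dots> \<le> norm v * \<epsilon>" using g by (intro mult_left_mono) auto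
          finally show "norm ((F' z - F' (p y t)) v) \<le> \<epsilon> * norm v" by (simp add: mult.commute)
        qed (use \<epsilon> in simp)
      qed simp
      moreover have "F' (p y t) (t *\<^sub>R h) = t * F' (p y t) h"
        using F' K sub linear_scale[OF has_derivative_linear[OF F']] by (simp add: subset_iff)
      ultimately have "\<bar>F (p y' t) - F (p y t) - t * F' (p y t) h\<bar> \<le> t * (norm h * \<epsilon>)"
        using t by (simp add: ba)
      also have "\<dots> \<le> norm h * \<epsilon>" using t \<epsilon> by (intro mult_left_le_one_le) auto
      finally have 1: "\<bar>F (p y' t) - F (p y t) - t * F' (p y t) h\<bar> \<le> norm h * \<epsilon>" .
      have "t ^ m * F (p y' t) - t ^ m * F (p y t) - t ^ Suc m * F' (p y t) h
        = t ^ m * (F (p y' t) - F (p y t) - t * F' (p y t) h)"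
        by (simp add: algebra_simps)
      then have "norm (t ^ m * F (p y' t) - t ^ m * F (p y t) - t ^ Suc m * F' (p y t) h)
        = t ^ m * \<bar>F (p y' t) - F (p y t) - t * F' (p y t) h\<bar>"
        using t by (simp add: abs_mult)
      also have "\<dots> \<le> \<bar>F (p y' t) - F (p y t) - t * F' (p y t) h\<bar>"
        using t by (intro mult_left_le_one_le power_le_one) auto
      also note 1
      finally show "norm (t ^ m * F (p y' t) - t ^ m * F (p y t) - t ^ Suc m * F' (p y t) h) \<le> \<epsilon> * norm h"
        by (simp only: mult.commute)
    qed
    ultimately show "norm (?I y' - ?I y - ?D (y' - y)) \<le> \<epsilon> * norm (y' - y)"
      by (simp add: h_def)
  qed
qed

text \<open>The derivative is a sum of integrals of the same kind, with \<open>F\<close> replaced by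
  a directional derivative and \<open>m\<close> by \<open>Suc m\<close>; hence both vary in the
  induction.\<close>

lemma Ck_segment_integral:
  fixes e :: "nat \<Rightarrow> 'b::{real_inner, heine_borel}" and F :: "'b \<Rightarrow> real"
  assumes ob: "orthonormal_basis n e" and "smooth_on (ball x0 R) F"
  shows "Ck k (ball x0 R) (\<lambda>y. integral {0..1} (\<lambda>t. t ^ m * F (x0 + t *\<^sub>R (y - x0))))"
  using assms(2)
proof (induction k arbitrary: F m)
  case (0 F)
  then have "Ck (Suc 0) (ball x0 R) F" by (simp only: smooth_on_def)
  from Ck_SucE[OF this] obtain F' where
    F': "\<And>x. x \<in> ball x0 R \<Longrightarrow> (F has_derivative F' x) (at x)" "\<And>v. Ck 0 (ball x0 R) (\<lambda>x. F' x v)" by blast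
  have "continuous_on (ball x0 R) (\<lambda>x. F' x v)" for v using F'(2) by simp
  from has_derivative_continuous[OF segment_integral_has_derivative[OF ob F'(1) this]]
  show ?case unfolding Ck.simps by (intro continuous_at_imp_continuous_on ballI)
next
  case (Suc k F)
  have sm: "smooth_on (ball x0 R) (\<lambda>z. frechet_derivative F (at z) v)" for v
    unfolding smooth_on_def
  proof
    fix j
    have "Ck (Suc j) (ball x0 R) F" using Suc.prems unfolding smooth_on_def by blast
    then show "Ck j (ball x0 R) (\<lambda>z. frechet_derivative F (at z) v)" by simp
  qed
  have F': "(F has_derivative frechet_derivative F (at z)) (at z)" if "z \<in> ball x0 R" for z
  proof -
    have "Ck (Suc 0) (ball x0 R) F" using Suc.prems unfolding smooth_on_def by blast
    with that show ?thesis by (simp add: frechet_derivative_works)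
  qed
  have cont: "continuous_on (ball x0 R) (\<lambda>z. frechet_derivative F (at z) v)" for v
    using sm[of v] unfolding smooth_on_def by (metis Ck.simps(1))
  show ?case
    by (rule Ck_SucI[OF open_ball segment_integral_has_derivative[OF ob F' cont]])
      (assumption | intro Ck_sum Ck_mult Ck_const Suc.IH sm open_ball finite_lessThan)+
qed

text \<open>The derivative of \<open>f\<close> is integrated along the segment from
  \<open>x0\<close> to \<open>y\<close>, and \<open>g i\<close> is the integral of the
  \<open>i\<close>-th partial derivative. What matters later is that the \<open>g i\<close> are
  smooth: by the Leibniz rule a derivation at \<open>x0\<close> sees only their values
  there.\<close>

lemma Hadamard:
  fixes e :: "nat \<Rightarrow> 'b::{real_inner, heine_borel}" and f :: "'b \<Rightarrow> real"
  assumes ob: "orthonormal_basis n e" and sm: "smooth_on (ball x0 R) f" and "0 < R"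
  obtains g where "\<forall>i. smooth_on (ball x0 R) (g i)"
    "\<forall>y\<in>ball x0 R. f y = f x0 + (\<Sum>i<n. ((y - x0) \<bullet> e i) * g i y)"
    "\<forall>i. g i x0 = frechet_derivative f (at x0) (e i)"
proof -
  let ?f' = "\<lambda>z. frechet_derivative f (at z)"
  define g where "g i y = integral {0..1} (\<lambda>t. t ^ 0 * ?f' (x0 + t *\<^sub>R (y - x0)) (e i))" for i y
  have sm': "smooth_on (ball x0 R) (\<lambda>z. ?f' z v)" for v
    unfolding smooth_on_def
  proof
    fix j
    have "Ck (Suc j) (ball x0 R) f" using sm unfolding smooth_on_def by blast
    then show "Ck j (ball x0 R) (\<lambda>z. frechet_derivative f (at z) v)" by simp
  qed
  have f': "(f has_derivative ?f' z) (at z)" if "z \<in> ball x0 R" for z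
  proof -
    have "Ck (Suc 0) (ball x0 R) f" using sm unfolding smooth_on_def by blast
    with that show ?thesis by (simp add: frechet_derivative_works)
  qed
  have cont: "continuous_on (ball x0 R) (\<lambda>z. ?f' z v)" for v
    using sm'[of v] unfolding smooth_on_def by (metis Ck.simps(1))
  show ?thesis
  proof (rule that; intro allI ballI)
    show "smooth_on (ball x0 R) (g i)" for i
      unfolding smooth_on_def g_def using Ck_segment_integral[OF ob sm'] by blast
    show "g i x0 = ?f' x0 (e i)" for i by (simp add: g_def)
    fix y assume y: "y \<in> ball x0 R"
    let ?p = "\<lambda>t::real. x0 + t *\<^sub>R (y - x0)"
    have p: "?p t \<in> ball x0 R" if "t \<in> {0..1}" for t
      using that y mult_left_le_one_le[of "norm (y - x0)" t] by (simp add: dist_norm norm_minus_commute)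
    have deriv: "((\<lambda>t. f (?p t)) has_vector_derivative ?f' (?p t) (y - x0)) (at t within {0..1})"
      if t: "t \<in> {0..1}" for t
    proof -
      have "(?p has_derivative (\<lambda>s. s *\<^sub>R (y - x0))) (at t within {0..1})"
        by (auto intro!: derivative_eq_intros)
      from has_derivative_compose[OF this f'[OF p[OF t]]]
      have "((\<lambda>t. f (?p t)) has_derivative (\<lambda>s. ?f' (?p t) (s *\<^sub>R (y - x0)))) (at t within {0..1})"
        by simp
      then show ?thesis
        using linear_scale[OF has_derivative_linear[OF f'[OF p[OF t]]]]
        by (simp add: has_vector_derivative_def)
    qed
    have "((\<lambda>t. ?f' (?p t) (y - x0)) has_integral f (?p 1) - f (?p 0)) {0..1}"
      by (rule fundamental_theorem_of_calculus) (use deriv in auto)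
    then have "f y - f x0 = integral {0..1} (\<lambda>t. ?f' (?p t) (y - x0))"
      by (simp add: integral_unique)
    also have "\<dots> = integral {0..1} (\<lambda>t. \<Sum>i<n. ((y - x0) \<bullet> e i) * ?f' (?p t) (e i))"
    proof (rule integral_cong)
      fix t :: real assume "t \<in> {0..1}"
      from linear_orthonormal_expand[OF ob has_derivative_linear[OF f'[OF p[OF this]]], of "y - x0"]
      show "?f' (?p t) (y - x0) = (\<Sum>i<n. ((y - x0) \<bullet> e i) * ?f' (?p t) (e i))"
        unfolding real_scaleR_def .
    qed
    also have "\<dots> = (\<Sum>i<n. integral {0..1} (\<lambda>t. ((y - x0) \<bullet> e i) * ?f' (?p t) (e i)))"
    proof (rule integral_sum)
      fix i
      have "continuous_on {0..1} (\<lambda>t. ?f' (?p t) (e i))"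
        by (rule continuous_on_compose2[OF cont]) (use p in \<open>auto intro!: continuous_intros\<close>)
      then show "(\<lambda>t. ((y - x0) \<bullet> e i) * ?f' (?p t) (e i)) integrable_on {0..1}"
        by (intro integrable_on_mult_right integrable_continuous_real)
    qed simp
    finally show "f y = f x0 + (\<Sum>i<n. ((y - x0) \<bullet> e i) * g i y)"
      by (simp add: g_def)
  qed
qed

section \<open>Smooth functions on a manifold\<close>

locale manifold =
  fixes A :: "('a::{t2_space, second_countable_topology}, 'b::{real_inner, heine_borel}) atlas"
  assumes smooth_manifold: "smooth_manifold A"
begin

lemma chart:
  assumes "(U, \<phi>) \<in> A"
  shows chart_open: "open U" and chart_image_open: "open (\<phi> ` U)"
    and chart_cont: "continuous_on U \<phi>" and chart_inv_cont: "continuous_on (\<phi> ` U) (inv_into U \<phi>)"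
    and chart_left_inv: "\<And>x. x \<in> U \<Longrightarrow> inv_into U \<phi> (\<phi> x) = x"
proof -
  have "\<forall>(U, \<phi>)\<in>A. open U \<and> open (\<phi> ` U) \<and> homeomorphism U (\<phi> ` U) \<phi> (inv_into U \<phi>)"
    using smooth_manifold[unfolded smooth_manifold_def] by (elim conjE)
  from bspec[OF this assms] have *: "open U" "open (\<phi> ` U)" "homeomorphism U (\<phi> ` U) \<phi> (inv_into U \<phi>)"
    by auto
  then show "open U" "open (\<phi> ` U)" by auto
  show "continuous_on U \<phi>" "continuous_on (\<phi> ` U) (inv_into U \<phi>)"
    "\<And>x. x \<in> U \<Longrightarrow> inv_into U \<phi> (\<phi> x) = x"
    using *(3) unfolding homeomorphism_def by auto
qed

lemma chart_at: obtains U \<phi> where "(U, \<phi>) \<in> A" "x \<in> U"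
proof -
  have "(\<Union>(U, \<phi>)\<in>A. U) = UNIV" using smooth_manifold[unfolded smooth_manifold_def] by (elim conjE)
  then have "x \<in> (\<Union>(U, \<phi>)\<in>A. U)" by simp
  then show ?thesis by (auto intro: that)
qed

lemma chart_transition:
  assumes "(U, \<phi>) \<in> A" "(V, \<psi>) \<in> A"
  shows "smooth_on (\<phi> ` (U \<inter> V)) (\<psi> \<circ> inv_into U \<phi>)"
proof -
  have "\<forall>(U, \<phi>)\<in>A. \<forall>(V, \<psi>)\<in>A. smooth_on (\<phi> ` (U \<inter> V)) (\<psi> \<circ> inv_into U \<phi>)"
    using smooth_manifold[unfolded smooth_manifold_def] by (elim conjE)
  from bspec[OF this assms(1)] assms(2) show ?thesis by auto
qed

lemma chart_image_subset_open:
  assumes "(U, \<phi>) \<in> A" "open W"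
  shows "open (\<phi> ` (U \<inter> W))"
proof -
  have "\<phi> ` (U \<inter> W) = \<phi> ` U \<inter> inv_into U \<phi> -` W"
    using chart_left_inv[OF assms(1)] by auto
  then show ?thesis
    using continuous_on_open_vimage[OF chart_image_open[OF assms(1)], of "inv_into U \<phi>"]
      chart_inv_cont[OF assms(1)] assms(2) by (auto simp: Int_commute)
qed

lemma model_basis: obtains n and e :: "nat \<Rightarrow> 'b" where "orthonormal_basis n e"
proof -
  have "\<exists>B::'b set. finite B \<and> span B = UNIV"
    using smooth_manifold[unfolded smooth_manifold_def] by (elim conjE)
  then obtain B :: "'b set" where "finite B" "span B = UNIV" by blast
  then show ?thesis by (rule orthonormal_basis_exists) (rule that)
qed

text \<open>Any other chart is reached by composing with a transition map, so smoothness needs to be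
  checked in a single chart whose domain contains \<open>W\<close>.\<close>

lemma smooth_fun_on_chartI:
  assumes "(U, \<phi>) \<in> A" "open W" "W \<subseteq> U" "smooth_on (\<phi> ` W) (f \<circ> inv_into U \<phi>)"
  shows "smooth_fun_on A W f"
  unfolding smooth_fun_on_def smooth_on_def
proof (clarify)
  fix V \<psi> k assume V: "(V, \<psi>) \<in> A"
  obtain n and e :: "nat \<Rightarrow> 'b" where ob: "orthonormal_basis n e" by (rule model_basis)
  have UW: "U \<inter> W = W" using assms(3) by auto
  have "open (\<phi> ` (U \<inter> W))" "open (\<psi> ` (V \<inter> W))" using chart_image_subset_open V assms by auto
  note op = this[unfolded UW]
  have sub: "\<psi> ` (V \<inter> W) \<subseteq> \<psi> ` (V \<inter> U)" using assms(3) by auto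
  have "Ck k (\<psi> ` (V \<inter> W)) (\<phi> \<circ> inv_into V \<psi>)"
    using chart_transition[OF V assms(1)] sub Ck_subset unfolding smooth_on_def by blast
  moreover have "(\<phi> \<circ> inv_into V \<psi>) ` \<psi> ` (V \<inter> W) \<subseteq> \<phi> ` W"
    using chart_left_inv[OF V] by auto
  moreover have "Ck k (\<phi> ` W) (f \<circ> inv_into U \<phi>)" using assms(4) by (simp add: smooth_on_def)
  ultimately have "Ck k (\<psi> ` (V \<inter> W)) (\<lambda>z. (f \<circ> inv_into U \<phi>) ((\<phi> \<circ> inv_into V \<psi>) z))"
    using Ck_compose[OF ob op(2) op(1)] by blast
  then show "Ck k (\<psi> ` (V \<inter> W)) (f \<circ> inv_into V \<psi>)"
  proof (rule Ck_cong[OF op(2), rotated])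
    fix y assume "y \<in> \<psi> ` (V \<inter> W)"
    then show "(f \<circ> inv_into U \<phi>) ((\<phi> \<circ> inv_into V \<psi>) y) = (f \<circ> inv_into V \<psi>) y"
      using chart_left_inv[OF V] chart_left_inv[OF assms(1)] assms(3) by auto
  qed
qed

lemma smooth_fun_on_subset:
  assumes "smooth_fun_on A W f" "W' \<subseteq> W"
  shows "smooth_fun_on A W' f"
  unfolding smooth_fun_on_def smooth_on_def
proof clarify
  fix U \<phi> k assume "(U, \<phi>) \<in> A"
  with assms(1) have "Ck k (\<phi> ` (U \<inter> W)) (f \<circ> inv_into U \<phi>)"
    unfolding smooth_fun_on_def smooth_on_def by blast
  then show "Ck k (\<phi> ` (U \<inter> W')) (f \<circ> inv_into U \<phi>)"
    by (rule Ck_subset) (use assms(2) in blast)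
qed

text \<open>Working with germs at a point removes the bookkeeping about domains; by
  \<open>smooth_funs_iff\<close> the global smooth functions are those that are smooth at each
  point.\<close>

definition smooth_at :: "'a \<Rightarrow> ('a \<Rightarrow> real) \<Rightarrow> bool" where
  "smooth_at x f \<longleftrightarrow> (\<exists>W. open W \<and> x \<in> W \<and> smooth_fun_on A W f)"

lemma smooth_fun_on_local:
  assumes "\<And>x. x \<in> W \<Longrightarrow> smooth_at x f"
  shows "smooth_fun_on A W f"
  unfolding smooth_fun_on_def smooth_on_def
proof (clarify)
  fix U \<phi> k assume U: "(U, \<phi>) \<in> A"
  show "Ck k (\<phi> ` (U \<inter> W)) (f \<circ> inv_into U \<phi>)"
  proof (rule Ck_local)
    fix z assume "z \<in> \<phi> ` (U \<inter> W)"
    then obtain x where x: "x \<in> U" "x \<in> W" "z = \<phi> x" by auto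
    from assms[OF x(2)] obtain W' where W': "open W'" "x \<in> W'" "smooth_fun_on A W' f"
      unfolding smooth_at_def by blast
    then have "Ck k (\<phi> ` (U \<inter> W')) (f \<circ> inv_into U \<phi>)"
      using U unfolding smooth_fun_on_def smooth_on_def by blast
    then show "\<exists>T. open T \<and> z \<in> T \<and> Ck k T (f \<circ> inv_into U \<phi>)"
      using chart_image_subset_open[OF U W'(1)] x W' by blast
  qed
qed

lemma smooth_fun_on_iff: "open W \<Longrightarrow> smooth_fun_on A W f \<longleftrightarrow> (\<forall>x\<in>W. smooth_at x f)"
  using smooth_fun_on_local unfolding smooth_at_def by blast

lemma smooth_funs_iff: "f \<in> smooth_funs A \<longleftrightarrow> (\<forall>x. smooth_at x f)"
  using smooth_fun_on_iff[OF open_UNIV] by (simp add: smooth_funs_def)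

lemma smooth_funsD: "f \<in> smooth_funs A \<Longrightarrow> smooth_at x f"
  by (simp add: smooth_funs_iff)

lemma smooth_at_cong:
  assumes "smooth_at x f" "\<forall>\<^sub>F y in nhds x. f y = g y"
  shows "smooth_at x g"
proof -
  from assms obtain W V where W: "open W" "x \<in> W" "smooth_fun_on A W f" and
    V: "open V" "x \<in> V" "\<And>y. y \<in> V \<Longrightarrow> f y = g y"
    unfolding smooth_at_def eventually_nhds by blast
  have "smooth_fun_on A (W \<inter> V) g"
    unfolding smooth_fun_on_def smooth_on_def
  proof clarify
    fix U \<phi> k assume U: "(U, \<phi>) \<in> A"
    have "Ck k (\<phi> ` (U \<inter> (W \<inter> V))) (f \<circ> inv_into U \<phi>)"
      using smooth_fun_on_subset[OF W(3), of "W \<inter> V"] U unfolding smooth_fun_on_def smooth_on_def by blast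
    then show "Ck k (\<phi> ` (U \<inter> (W \<inter> V))) (g \<circ> inv_into U \<phi>)"
      by (rule Ck_cong[rotated 2])
        (use V chart_left_inv[OF U] chart_image_subset_open[OF U open_Int[OF W(1) V(1)]] in auto)
  qed
  with W V show ?thesis unfolding smooth_at_def by (intro exI[of _ "W \<inter> V"]) (simp add: open_Int)
qed

lemma smooth_at_binop:
  assumes "\<And>k S f g. open S \<Longrightarrow> Ck k S f \<Longrightarrow> Ck k S g \<Longrightarrow> Ck k S (\<lambda>z::'b. h (f z) (g z))"
    and "smooth_at x f" "smooth_at x g"
  shows "smooth_at x (\<lambda>y. h (f y) (g y))"
proof -
  from assms(2,3) obtain W V where W: "open W" "x \<in> W" "smooth_fun_on A W f" and
    V: "open V" "x \<in> V" "smooth_fun_on A V g"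
    unfolding smooth_at_def by blast
  have "smooth_fun_on A (W \<inter> V) (\<lambda>y. h (f y) (g y))"
    unfolding smooth_fun_on_def smooth_on_def
  proof clarify
    fix U \<phi> k assume U: "(U, \<phi>) \<in> A"
    have "Ck k (\<phi> ` (U \<inter> (W \<inter> V))) (f \<circ> inv_into U \<phi>)" "Ck k (\<phi> ` (U \<inter> (W \<inter> V))) (g \<circ> inv_into U \<phi>)"
      using smooth_fun_on_subset[OF W(3), of "W \<inter> V"] smooth_fun_on_subset[OF V(3), of "W \<inter> V"]
        U unfolding smooth_fun_on_def smooth_on_def by blast+
    then show "Ck k (\<phi> ` (U \<inter> (W \<inter> V))) ((\<lambda>y. h (f y) (g y)) \<circ> inv_into U \<phi>)"
      using assms(1) chart_image_subset_open[OF U open_Int[OF W(1) V(1)]] by (auto simp: o_def)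
  qed
  with W V show ?thesis unfolding smooth_at_def by (intro exI[of _ "W \<inter> V"]) (simp add: open_Int)
qed

lemma smooth_at_add: "smooth_at x f \<Longrightarrow> smooth_at x g \<Longrightarrow> smooth_at x (\<lambda>y. f y + g y)"
  by (rule smooth_at_binop[OF Ck_add])

lemma smooth_at_mult: "smooth_at x f \<Longrightarrow> smooth_at x g \<Longrightarrow> smooth_at x (\<lambda>y. f y * g y)"
  by (rule smooth_at_binop[OF Ck_mult])

lemma smooth_at_const [simp]: "smooth_at x (\<lambda>y. c)"
  unfolding smooth_at_def smooth_fun_on_def smooth_on_def by (auto simp: o_def intro!: exI[of _ UNIV])

lemma smooth_at_uminus: "smooth_at x f \<Longrightarrow> smooth_at x (\<lambda>y. - f y)"
  using smooth_at_mult[OF smooth_at_const[of x "-1"]] by simp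

lemma smooth_at_diff: "smooth_at x f \<Longrightarrow> smooth_at x g \<Longrightarrow> smooth_at x (\<lambda>y. f y - g y)"
  using smooth_at_add[OF _ smooth_at_uminus] by simp

lemma smooth_at_sum:
  "(\<And>i. i \<in> I \<Longrightarrow> smooth_at x (f i)) \<Longrightarrow> smooth_at x (\<lambda>y. \<Sum>i\<in>I. f i y)"
  by (induction I rule: infinite_finite_induct) (auto intro: smooth_at_add)

lemma smooth_at_prod:
  "(\<And>i. i \<in> I \<Longrightarrow> smooth_at x (f i)) \<Longrightarrow> smooth_at x (\<lambda>y. \<Prod>i\<in>I. f i y)"
  by (induction I rule: infinite_finite_induct) (auto intro: smooth_at_mult)

lemma smooth_at_continuous:
  assumes "smooth_at x f"
  shows "isCont f x"
proof -
  from assms obtain W where W: "open W" "x \<in> W" "smooth_fun_on A W f" unfolding smooth_at_def by blast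
  obtain U \<phi> where U: "(U, \<phi>) \<in> A" "x \<in> U" by (rule chart_at)
  have "Ck 0 (\<phi> ` (U \<inter> W)) (f \<circ> inv_into U \<phi>)"
    using W U unfolding smooth_fun_on_def smooth_on_def by blast
  then have "continuous_on (\<phi> ` (U \<inter> W)) (f \<circ> inv_into U \<phi>)" by simp
  moreover have "continuous_on (U \<inter> W) \<phi>" by (rule continuous_on_subset[OF chart_cont[OF U(1)]]) simp
  ultimately have "continuous_on (U \<inter> W) (\<lambda>y. (f \<circ> inv_into U \<phi>) (\<phi> y))"
    by (rule continuous_on_compose2) simp
  then have "continuous_on (U \<inter> W) f"
    by (rule continuous_on_eq) (use chart_left_inv[OF U(1)] in auto)
  then show ?thesis
    using W U chart_open[OF U(1)] by (simp add: continuous_on_eq_continuous_at open_Int)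
qed

lemma smooth_at_nonzero:
  assumes "smooth_at x f" "f x \<noteq> 0"
  shows "\<forall>\<^sub>F y in nhds x. f y \<noteq> 0"
proof -
  have "(f \<longlongrightarrow> f x) (nhds x)" using smooth_at_continuous[OF assms(1)] by (simp add: continuous_at tendsto_at_iff_tendsto_nhds)
  moreover have "open (- {0::real})" "f x \<in> - {0}" using assms(2) by auto
  ultimately have "\<forall>\<^sub>F y in nhds x. f y \<in> - {0}" by (rule topological_tendstoD)
  then show ?thesis by simp
qed

lemma smooth_at_inverse:
  assumes "smooth_at x f" "f x \<noteq> 0"
  shows "smooth_at x (\<lambda>y. inverse (f y))"
proof -
  from assms(1) smooth_at_nonzero[OF assms] obtain W V where W: "open W" "x \<in> W" "smooth_fun_on A W f" and
    V: "open V" "x \<in> V" "\<And>y. y \<in> V \<Longrightarrow> f y \<noteq> 0"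
    unfolding smooth_at_def eventually_nhds by blast
  have "smooth_fun_on A (W \<inter> V) (\<lambda>y. inverse (f y))"
    unfolding smooth_fun_on_def smooth_on_def
  proof clarify
    fix U \<phi> k assume U: "(U, \<phi>) \<in> A"
    have "Ck k (\<phi> ` (U \<inter> (W \<inter> V))) (f \<circ> inv_into U \<phi>)"
      using smooth_fun_on_subset[OF W(3), of "W \<inter> V"] U unfolding smooth_fun_on_def smooth_on_def by blast
    then have "Ck k (\<phi> ` (U \<inter> (W \<inter> V))) (\<lambda>z. inverse ((f \<circ> inv_into U \<phi>) z))"
      by (rule Ck_inverse[OF chart_image_subset_open[OF U open_Int[OF W(1) V(1)]]])
        (use V(3) chart_left_inv[OF U] in auto)
    then show "Ck k (\<phi> ` (U \<inter> (W \<inter> V))) ((\<lambda>y. inverse (f y)) \<circ> inv_into U \<phi>)" by (simp add: o_def)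
  qed
  with W V show ?thesis unfolding smooth_at_def by (intro exI[of _ "W \<inter> V"]) (simp add: open_Int)
qed

text \<open>A bump function of the model space is pulled back by a chart and extended by 0. The
  preimage \<open>K\<close> of the closed ball is compact by the Heine-Borel property and closed
  because the manifold is Hausdorff; so the extension is 0 on the open set \<open>- K\<close>, which
  together with the chart domain covers the manifold.\<close>

lemma bump:
  assumes "open W" "x \<in> W"
  obtains \<rho> K where "\<rho> \<in> smooth_funs A" "\<forall>\<^sub>F y in nhds x. \<rho> y = 1" "closed K" "K \<subseteq> W"
    "\<forall>y. y \<notin> K \<longrightarrow> \<rho> y = 0"
proof -
  obtain U \<phi> where U: "(U, \<phi>) \<in> A" "x \<in> U" by (rule chart_at)
  let ?i = "inv_into U \<phi>"
  have "open (\<phi> ` (U \<inter> W))" "\<phi> x \<in> \<phi> ` (U \<inter> W)"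
    using chart_image_subset_open[OF U(1) assms(1)] U assms by auto
  then obtain R where R: "R > 0" "cball (\<phi> x) R \<subseteq> \<phi> ` (U \<inter> W)"
    unfolding open_contains_cball by blast
  obtain \<beta> :: "'b \<Rightarrow> real" and r where \<beta>: "smooth_on UNIV \<beta>" "0 < r" "r < R"
    "\<forall>y. dist (\<phi> x) y < r \<longrightarrow> \<beta> y = 1" "\<forall>y. dist (\<phi> x) y \<ge> R \<longrightarrow> \<beta> y = 0" by (rule smooth_bump_exists[OF R(1), of "\<phi> x"])
  define \<rho> where "\<rho> y = (if y \<in> U then \<beta> (\<phi> y) else 0)" for y
  define K where "K = ?i ` cball (\<phi> x) R"
  have "cball (\<phi> x) R \<subseteq> \<phi> ` U" using R by auto
  then have "compact K"
    unfolding K_def by (intro compact_continuous_image continuous_on_subset[OF chart_inv_cont[OF U(1)]]) auto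
  then have closed: "closed K" by (rule compact_imp_closed)
  have KW: "K \<subseteq> U \<inter> W" using R chart_left_inv[OF U(1)] by (force simp: K_def)
  have zero: "\<rho> y = 0" if "y \<notin> K" for y
  proof (cases "y \<in> U")
    case True
    then have "\<phi> y \<notin> cball (\<phi> x) R" using that chart_left_inv[OF U(1) True] by (metis K_def image_eqI)
    with \<beta>(5) show ?thesis by (simp add: \<rho>_def)
  qed (simp add: \<rho>_def)
  have "smooth_on (\<phi> ` U) (\<rho> \<circ> ?i)"
    unfolding smooth_on_def
  proof
    fix k
    have "Ck k (\<phi> ` U) \<beta>" using \<beta>(1) Ck_subset unfolding smooth_on_def by blast
    then show "Ck k (\<phi> ` U) (\<rho> \<circ> ?i)"
      by (rule Ck_cong[OF chart_image_open[OF U(1)], rotated]) (auto simp: \<rho>_def chart_left_inv[OF U(1)])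
  qed
  from smooth_fun_on_chartI[OF U(1) chart_open[OF U(1)] _ this] have "smooth_fun_on A U \<rho>" by simp
  then have sU: "smooth_at y \<rho>" if "y \<in> U" for y
    using that chart_open[OF U(1)] unfolding smooth_at_def by blast
  have sK: "smooth_at y \<rho>" if "y \<notin> K" for y
  proof (rule smooth_at_cong[OF smooth_at_const])
    show "\<forall>\<^sub>F z in nhds y. 0 = \<rho> z"
      unfolding eventually_nhds using that zero closed by (intro exI[of _ "- K"]) auto
  qed
  have "smooth_at y \<rho>" for y using sU[of y] sK[of y] KW by blast
  then have "\<rho> \<in> smooth_funs A" by (simp add: smooth_funs_iff)
  moreover have "\<forall>\<^sub>F y in nhds x. \<rho> y = 1"
  proof -
    have "open (U \<inter> \<phi> -` ball (\<phi> x) r)"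
      using continuous_on_open_vimage[OF chart_open[OF U(1)], of \<phi>] chart_cont[OF U(1)]
      by (simp add: Int_commute)
    then show ?thesis
      unfolding eventually_nhds using \<beta> U(2)
      by (intro exI[of _ "U \<inter> \<phi> -` ball (\<phi> x) r"]) (auto simp: \<rho>_def)
  qed
  ultimately show ?thesis using closed zero KW by (intro that[of \<rho> K]) auto
qed

text \<open>The open sets \<open>W\<close> and \<open>- K\<close> cover the manifold: on the first
  \<open>g\<close> is a product of smooth functions, on the second it is 0. All passages from local
  to global objects go through this argument.\<close>

lemma smooth_extension_bump:
  assumes "open W" "\<rho> \<in> smooth_funs A" "closed K" "K \<subseteq> W" "\<And>y. y \<notin> K \<Longrightarrow> \<rho> y = 0"
    and "\<And>y. y \<in> W \<Longrightarrow> smooth_at y f" "\<And>y. y \<in> W \<Longrightarrow> g y = \<rho> y * f y" "\<And>y. y \<notin> W \<Longrightarrow> g y = 0"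
  shows "g \<in> smooth_funs A"
  unfolding smooth_funs_iff
proof
  fix y
  show "smooth_at y g"
  proof (cases "y \<in> W")
    case True
    show ?thesis
    proof (rule smooth_at_cong[OF smooth_at_mult[OF smooth_funsD[OF assms(2)] assms(6)[OF True]]])
      show "\<forall>\<^sub>F z in nhds y. \<rho> z * f z = g z"
        unfolding eventually_nhds using True assms(1,7) by (intro exI[of _ W]) auto
    qed
  next
    case False
    show ?thesis
    proof (rule smooth_at_cong[OF smooth_at_const])
      show "\<forall>\<^sub>F z in nhds y. 0 = g z"
        unfolding eventually_nhds
        using False assms by (intro exI[of _ "- K"]) (auto, metis mult_zero_left)
    qed
  qed
qed

text \<open>Tangent vectors act on global functions only; this supplies, for each smooth germ, a
  global function to which they can be applied.\<close>

lemma smooth_at_extend: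
  assumes "smooth_at x f"
  obtains g where "g \<in> smooth_funs A" "\<forall>\<^sub>F y in nhds x. g y = f y"
proof -
  from assms obtain W where W: "open W" "x \<in> W" "smooth_fun_on A W f" unfolding smooth_at_def by blast
  obtain \<rho> K where \<rho>: "\<rho> \<in> smooth_funs A" "\<forall>\<^sub>F y in nhds x. \<rho> y = 1" "closed K" "K \<subseteq> W"
    "\<forall>y. y \<notin> K \<longrightarrow> \<rho> y = 0" by (rule bump[OF W(1,2)])
  define g where "g y = (if y \<in> W then \<rho> y * f y else 0)" for y
  have "g \<in> smooth_funs A"
    by (rule smooth_extension_bump[OF W(1) \<rho>(1,3,4) \<rho>(5)[rule_format], of f]) (use W smooth_at_def in \<open>auto simp: g_def\<close>)
  moreover have "\<forall>\<^sub>F y in nhds x. g y = f y"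
    using \<rho>(2) eventually_nhds_in_open[OF W(1,2)] by eventually_elim (simp add: g_def)
  ultimately show ?thesis by (rule that)
qed

lemma smooth_funs_closed:
  shows smooth_funs_const: "(\<lambda>x. c) \<in> smooth_funs A"
    and smooth_funs_add: "f \<in> smooth_funs A \<Longrightarrow> g \<in> smooth_funs A \<Longrightarrow> (\<lambda>x. f x + g x) \<in> smooth_funs A"
    and smooth_funs_mult: "f \<in> smooth_funs A \<Longrightarrow> g \<in> smooth_funs A \<Longrightarrow> (\<lambda>x. f x * g x) \<in> smooth_funs A"
    and smooth_funs_diff: "f \<in> smooth_funs A \<Longrightarrow> g \<in> smooth_funs A \<Longrightarrow> (\<lambda>x. f x - g x) \<in> smooth_funs A"
    and smooth_funs_uminus: "f \<in> smooth_funs A \<Longrightarrow> (\<lambda>x. - f x) \<in> smooth_funs A"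
    and smooth_funs_sum: "(\<And>i. i \<in> I \<Longrightarrow> h i \<in> smooth_funs A) \<Longrightarrow> (\<lambda>x. \<Sum>i\<in>I. h i x) \<in> smooth_funs A"
  by (simp_all add: smooth_funs_iff smooth_at_add smooth_at_mult smooth_at_diff smooth_at_uminus smooth_at_sum)


section \<open>Tangent vectors\<close>

abbreviation "C \<equiv> smooth_funs A"
abbreviation "T \<equiv> tangent_space A"

lemma tangentI:
  assumes "\<And>f g a b. f \<in> C \<Longrightarrow> g \<in> C \<Longrightarrow> v (\<lambda>y. a * f y + b * g y) = a * v f + b * v g"
    and "\<And>f g. f \<in> C \<Longrightarrow> g \<in> C \<Longrightarrow> v (\<lambda>y. f y * g y) = f x * v g + g x * v f"
    and "\<And>f. f \<notin> C \<Longrightarrow> v f = 0"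
  shows "v \<in> T x"
  using assms unfolding tangent_space_def linear_fun_on_def
  by (simp add: scaleR_fun_def plus_fun_def)

lemma tangentD:
  assumes "v \<in> T x"
  shows tangent_lin: "f \<in> C \<Longrightarrow> g \<in> C \<Longrightarrow> v (\<lambda>y. a * f y + b * g y) = a * v f + b * v g"
    and tangent_leibniz: "f \<in> C \<Longrightarrow> g \<in> C \<Longrightarrow> v (\<lambda>y. f y * g y) = f x * v g + g x * v f"
    and tangent_undef: "f \<notin> C \<Longrightarrow> v f = 0"
  using assms unfolding tangent_space_def linear_fun_on_def
  by (auto simp: scaleR_fun_def plus_fun_def)

lemma tangent_add: "v \<in> T x \<Longrightarrow> f \<in> C \<Longrightarrow> g \<in> C \<Longrightarrow> v (\<lambda>y. f y + g y) = v f + v g"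
  using tangent_lin[of v x f g 1 1] by simp

lemma tangent_diff: "v \<in> T x \<Longrightarrow> f \<in> C \<Longrightarrow> g \<in> C \<Longrightarrow> v (\<lambda>y. f y - g y) = v f - v g"
  using tangent_lin[of v x f g 1 "-1"] by simp

lemma tangent_const: "v \<in> T x \<Longrightarrow> v (\<lambda>y. c) = 0"
proof -
  assume v: "v \<in> T x"
  have "v (\<lambda>y. 1 * 1) = 1 * v (\<lambda>y. 1) + 1 * v (\<lambda>y. 1)"
    using tangent_leibniz[OF v smooth_funs_const smooth_funs_const, of 1 1] .
  then have "v (\<lambda>y. 1) = 0" by simp
  then show ?thesis
    using tangent_lin[OF v smooth_funs_const smooth_funs_const, of c 1 0 1] by simp
qed

lemma tangent_sum:
  "v \<in> T x \<Longrightarrow> (\<And>i. i \<in> I \<Longrightarrow> f i \<in> C) \<Longrightarrow> v (\<lambda>y. \<Sum>i\<in>I. f i y) = (\<Sum>i\<in>I. v (f i))"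
proof (induction I rule: infinite_finite_induct)
  case (insert i I)
  then show ?case using tangent_add[of v x "f i" "\<lambda>y. \<Sum>i\<in>I. f i y"] by (simp add: smooth_funs_sum)
qed (simp_all add: tangent_const)

text \<open>Derivations are local: for a bump function \<open>\<rho>\<close> supported where
  \<open>f = g\<close> the product \<open>\<rho> * (f - g)\<close> is 0, and the Leibniz rule at
  \<open>x\<close>, with \<open>\<rho> x = 1\<close> and \<open>f x = g x\<close>, leaves
  \<open>v (f - g) = 0\<close>.\<close>

lemma tangent_cong:
  assumes v: "v \<in> T x" and f: "f \<in> C" "g \<in> C" and eq: "\<forall>\<^sub>F y in nhds x. f y = g y"
  shows "v f = v g"
proof -
  from eq obtain W where W: "open W" "x \<in> W" "\<And>y. y \<in> W \<Longrightarrow> f y = g y"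
    unfolding eventually_nhds by blast
  obtain \<rho> K where \<rho>: "\<rho> \<in> C" "\<forall>\<^sub>F y in nhds x. \<rho> y = 1" "closed K" "K \<subseteq> W"
    "\<forall>y. y \<notin> K \<longrightarrow> \<rho> y = 0" by (rule bump[OF W(1,2)])
  let ?h = "\<lambda>y. f y - g y"
  have h: "?h \<in> C" by (intro smooth_funs_diff f)
  have "(\<lambda>y. \<rho> y * ?h y) = (\<lambda>y. 0)"
  proof
    fix y show "\<rho> y * ?h y = 0" using W(3)[of y] \<rho>(4) \<rho>(5) by (cases "y \<in> K") auto
  qed
  then have "0 = \<rho> x * v ?h + ?h x * v \<rho>"
    using tangent_leibniz[OF v \<rho>(1) h] tangent_const[OF v, of 0] by simp
  moreover have "\<rho> x = 1" using \<rho>(2) eventually_nhds_x_imp_x by fast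
  moreover have "?h x = 0" using W by simp
  ultimately show ?thesis using tangent_diff[OF v f] by simp
qed

lemma tangent_eqI: "v \<in> T x \<Longrightarrow> w \<in> T x \<Longrightarrow> (\<And>f. f \<in> C \<Longrightarrow> v f = w f) \<Longrightarrow> v = w"
  by (rule ext) (metis tangent_undef)

lemma subspace_tangent: "subspace (T x)"
  unfolding subspace_def
  by (auto intro!: tangentI simp: scaleR_fun_def plus_fun_def zero_fun_def tangent_lin tangent_leibniz
      tangent_undef algebra_simps)

lemma sum_fun_apply: "(\<Sum>i\<in>I. f i) x = (\<Sum>i\<in>I. f i x)"
  by (induction I rule: infinite_finite_induct) (simp_all add: plus_fun_def zero_fun_def)

lemma tangent_lincomb: "(\<And>i. i \<in> I \<Longrightarrow> X i \<in> T x) \<Longrightarrow> (\<Sum>i\<in>I. c i *\<^sub>R X i) \<in> T x"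
  by (intro subspace_sum[OF subspace_tangent] subspace_scale[OF subspace_tangent])

end

context manifold
begin

text \<open>The functions \<open>f i\<close> are cut off coordinates, the fields \<open>X i\<close> cut off coordinate fields.\<close>

lemma local_frame:
  obtains n :: nat where "\<forall>x. \<exists>W f X. open W \<and> x \<in> W \<and> (\<forall>i<n. f i \<in> C \<and> X i \<in> vector_fields A) \<and>
    (\<forall>y\<in>W. \<forall>i<n. \<forall>j<n. X i y (f j) = (if i = j then 1 else 0)) \<and>
    (\<forall>y\<in>W. \<forall>v\<in>T y. v = (\<Sum>i<n. v (f i) *\<^sub>R X i y))"
proof -
  obtain n and e :: "nat \<Rightarrow> 'b" where ob: "orthonormal_basis n e" by (rule model_basis)
  have "\<exists>W f X. open W \<and> x \<in> W \<and> (\<forall>i<n. f i \<in> C \<and> X i \<in> vector_fields A) \<and>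
    (\<forall>y\<in>W. \<forall>i<n. \<forall>j<n. X i y (f j) = (if i = j then 1 else 0)) \<and>
    (\<forall>y\<in>W. \<forall>v\<in>T y. v = (\<Sum>i<n. v (f i) *\<^sub>R X i y))" for x
  proof -
    obtain U \<phi> where U: "(U, \<phi>) \<in> A" "x \<in> U" by (rule chart_at)
    note oU = chart_open[OF U(1)] and oS = chart_image_open[OF U(1)] and inv = chart_left_inv[OF U(1)]
    let ?i = "inv_into U \<phi>"
    obtain \<rho> K where \<rho>: "\<rho> \<in> C" "\<forall>\<^sub>F y in nhds x. \<rho> y = 1" "closed K" "K \<subseteq> U"
      "\<forall>y. y \<notin> K \<longrightarrow> \<rho> y = 0" by (rule bump[OF oU U(2)])
    from \<rho>(2) obtain W0 where W0: "open W0" "x \<in> W0" "\<And>y. y \<in> W0 \<Longrightarrow> \<rho> y = 1"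
      unfolding eventually_nhds by blast
    define W where "W = W0 \<inter> U"
    have W: "open W" "x \<in> W" "W \<subseteq> U" "\<And>y. y \<in> W \<Longrightarrow> \<rho> y = 1" using W0 oU U(2) by (auto simp: W_def)
    \<comment> \<open>This is used three times: for the coordinates, for coordinate derivatives of
      smooth functions, and for the coefficients in Hadamard's formula.\<close>
    have smU: "smooth_at y (\<lambda>y. h (\<phi> y))" if "y \<in> U" "open V" "\<phi> y \<in> V" "\<And>k. Ck k V h" for y V and h :: "'b \<Rightarrow> real"
    proof -
      define U' where "U' = U \<inter> \<phi> -` V"
      have U': "open U'" "y \<in> U'" "U' \<subseteq> U"
        unfolding U'_def
        using continuous_on_open_vimage[OF oU, of \<phi>] chart_cont[OF U(1)] that by (auto simp: Int_commute)
      have img: "open (\<phi> ` U')"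
        using chart_image_subset_open[OF U(1) U'(1)] U'(3) by (simp add: Int_absorb1)
      have "smooth_on (\<phi> ` U') ((\<lambda>y. h (\<phi> y)) \<circ> ?i)"
        unfolding smooth_on_def
      proof
        fix k
        have "Ck k (\<phi> ` U') h" by (rule Ck_subset[OF that(4)]) (auto simp: U'_def)
        then show "Ck k (\<phi> ` U') ((\<lambda>y. h (\<phi> y)) \<circ> ?i)"
          by (rule Ck_cong[OF img, rotated]) (use inv U'(3) in auto)
      qed
      from smooth_fun_on_chartI[OF U(1) U'(1,3) this] U' show ?thesis
        unfolding smooth_at_def by blast
    qed
    have CkC: "Ck k (\<phi> ` U) (g \<circ> ?i)" if "g \<in> C" for g k
      using that U(1) unfolding smooth_funs_def smooth_fun_on_def smooth_on_def by fastforce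
    have gd: "(g \<circ> ?i has_derivative frechet_derivative (g \<circ> ?i) (at z)) (at z)"
      if "g \<in> C" "z \<in> \<phi> ` U" for g z
      using CkC[OF that(1), of "Suc 0"] that(2) unfolding Ck.simps frechet_derivative_works by blast
    define f where "f i y = (if y \<in> U then \<rho> y * (\<phi> y \<bullet> e i) else 0)" for i y
    define X where "X i y g = (if g \<in> C \<and> y \<in> U then \<rho> y * frechet_derivative (g \<circ> ?i) (at (\<phi> y)) (e i) else 0)"
      for i y g
    have fC: "f i \<in> C" for i
    proof (rule smooth_extension_bump[OF oU \<rho>(1,3,4) \<rho>(5)[rule_format], of "\<lambda>y. \<phi> y \<bullet> e i"])
      fix y assume y: "y \<in> U"
      have "Ck k UNIV (\<lambda>z. z \<bullet> e i)" for k
        by (rule Ck_bounded_linear[OF bounded_linear_inner_left open_UNIV Ck_id[OF open_UNIV]])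
      with smU[OF y open_UNIV, of "\<lambda>z. z \<bullet> e i"] show "smooth_at y (\<lambda>y. \<phi> y \<bullet> e i)" by simp
    qed (auto simp: f_def)
    have XT: "X i y \<in> T y" for i y
    proof (cases "y \<in> U")
      case True
      then have y: "\<phi> y \<in> \<phi> ` U" by simp
      show ?thesis
      proof (rule tangentI)
        fix g h a b assume g: "g \<in> C" and h: "h \<in> C"
        note D = gd[OF g y] gd[OF h y]
        have "(\<lambda>y. a * g y + b * h y) \<in> C" by (intro smooth_funs_add smooth_funs_mult smooth_funs_const g h)
        moreover have "(((\<lambda>y. a * g y + b * h y) \<circ> ?i) has_derivative
          (\<lambda>v. a * frechet_derivative (g \<circ> ?i) (at (\<phi> y)) v + b * frechet_derivative (h \<circ> ?i) (at (\<phi> y)) v)) (at (\<phi> y))"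
          using has_derivative_add[OF has_derivative_mult_right[OF D(1), of a] has_derivative_mult_right[OF D(2), of b]]
          by (simp add: o_def)
        from frechet_derivative_at[OF this]
        have "frechet_derivative ((\<lambda>y. a * g y + b * h y) \<circ> ?i) (at (\<phi> y)) =
          (\<lambda>v. a * frechet_derivative (g \<circ> ?i) (at (\<phi> y)) v + b * frechet_derivative (h \<circ> ?i) (at (\<phi> y)) v)" ..
        ultimately show "X i y (\<lambda>y. a * g y + b * h y) = a * X i y g + b * X i y h"
          using True g h by (simp add: X_def algebra_simps)
      next
        fix g h assume g: "g \<in> C" and h: "h \<in> C"
        note D = gd[OF g y] gd[OF h y]
        have "(\<lambda>y. g y * h y) \<in> C" by (intro smooth_funs_mult g h)
        moreover have "(((\<lambda>y. g y * h y) \<circ> ?i) has_derivative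
          (\<lambda>v. g y * frechet_derivative (h \<circ> ?i) (at (\<phi> y)) v + frechet_derivative (g \<circ> ?i) (at (\<phi> y)) v * h y)) (at (\<phi> y))"
          using has_derivative_mult[OF D] True inv by (simp add: o_def)
        from frechet_derivative_at[OF this]
        have "frechet_derivative ((\<lambda>y. g y * h y) \<circ> ?i) (at (\<phi> y)) =
          (\<lambda>v. g y * frechet_derivative (h \<circ> ?i) (at (\<phi> y)) v + frechet_derivative (g \<circ> ?i) (at (\<phi> y)) v * h y)" ..
        ultimately show "X i y (\<lambda>y. g y * h y) = g y * X i y h + h y * X i y g"
          using True g h by (simp add: X_def algebra_simps)
      qed (simp add: X_def)
    next
      case False
      then show ?thesis by (intro tangentI) (simp_all add: X_def)
    qed
    have XV: "X i \<in> vector_fields A" for i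
      unfolding vector_fields_def vector_field_on_def
    proof (clarsimp, intro conjI allI ballI XT)
      fix g assume g: "g \<in> C"
      have "(\<lambda>x. X i x g) \<in> C"
      proof (rule smooth_extension_bump[OF oU \<rho>(1,3,4) \<rho>(5)[rule_format], of "\<lambda>y. frechet_derivative (g \<circ> ?i) (at (\<phi> y)) (e i)"])
        fix y assume y: "y \<in> U"
        have "Ck k (\<phi> ` U) (\<lambda>z. frechet_derivative (g \<circ> ?i) (at z) (e i))" for k
          using CkC[OF g, of "Suc k"] by simp
        with smU[OF y oS, of "\<lambda>z. frechet_derivative (g \<circ> ?i) (at z) (e i)"] y
        show "smooth_at y (\<lambda>y. frechet_derivative (g \<circ> ?i) (at (\<phi> y)) (e i))" by simp
      qed (use g in \<open>auto simp: X_def\<close>)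
      then show "smooth_fun_on A UNIV (\<lambda>x. X i x g)" by (simp add: smooth_funs_def)
    qed
    have oW: "open (\<phi> ` W)" using chart_image_subset_open[OF U(1) W(1)] W(3) by (simp add: Int_absorb1)
    have Xf: "X i y (f j) = (if i = j then 1 else 0)" if y: "y \<in> W" and ij: "i < n" "j < n" for y i j
    proof -
      have "((\<lambda>z. z \<bullet> e j) has_derivative (\<lambda>v. v \<bullet> e j)) (at (\<phi> y))"
        by (intro has_derivative_inner_left has_derivative_ident)
      moreover have "frechet_derivative (f j \<circ> ?i) (at (\<phi> y)) = frechet_derivative (\<lambda>z. z \<bullet> e j) (at (\<phi> y))"
        by (rule frechet_derivative_cong_open[OF oW]) (use y W inv in \<open>auto simp: f_def subset_iff\<close>)
      ultimately have "frechet_derivative (f j \<circ> ?i) (at (\<phi> y)) = (\<lambda>v. v \<bullet> e j)"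
        using frechet_derivative_at[of "\<lambda>z. z \<bullet> e j" "\<lambda>v. v \<bullet> e j" "\<phi> y"] by simp
      then show ?thesis
        using fC y W ij ob by (auto simp: X_def orthonormal_basis_def)
    qed
    \<comment> \<open>Hadamard's formula in the chart gives the germ of \<open>g\<close> at
      \<open>y\<close> as \<open>g y + (\<Sum>i<n. (f i - f i y) * k i)\<close>. A derivation turns
      this into the sum of the \<open>v (f i) * k i y\<close>, and \<open>k i y\<close> is the
      \<open>i\<close>-th partial derivative of \<open>g\<close> at \<open>y\<close>.\<close>
    have expand: "v = (\<Sum>i<n. v (f i) *\<^sub>R X i y)" if y: "y \<in> W" and v: "v \<in> T y" for y v
    proof (rule tangent_eqI[OF v tangent_lincomb])
      show "X i y \<in> T y" for i by (rule XT)
      fix g assume g: "g \<in> C"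
      have "\<phi> y \<in> \<phi> ` W" using y by simp
      with oW obtain R where R: "R > 0" "ball (\<phi> y) R \<subseteq> \<phi> ` W" unfolding open_contains_ball by blast
      have gR: "smooth_on (ball (\<phi> y) R) (g \<circ> ?i)"
        unfolding smooth_on_def using R(2) W(3) by (intro allI Ck_subset[OF CkC[OF g]]) blast
      obtain h :: "nat \<Rightarrow> 'b \<Rightarrow> real" where h: "\<forall>i. smooth_on (ball (\<phi> y) R) (h i)"
        "\<forall>z\<in>ball (\<phi> y) R. (g \<circ> ?i) z = (g \<circ> ?i) (\<phi> y) + (\<Sum>i<n. ((z - \<phi> y) \<bullet> e i) * h i z)"
        "\<forall>i. h i (\<phi> y) = frechet_derivative (g \<circ> ?i) (at (\<phi> y)) (e i)" by (rule Hadamard[OF ob gR R(1)])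
      have yU: "y \<in> U" using y W by blast
      have "smooth_at y (\<lambda>z. h i (\<phi> z))" for i
        using smU[OF yU open_ball, of "\<phi> y" R "h i"] h(1) R(1) by (simp add: smooth_on_def)
      \<comment> \<open>The coefficients \<open>h i\<close> live on a ball of the chart only; global
        functions with the same germs at \<open>y\<close> replace them, so that \<open>v\<close>
        applies to the products.\<close>
      then have "\<forall>i. \<exists>k. k \<in> C \<and> (\<forall>\<^sub>F z in nhds y. k z = h i (\<phi> z))"
        using smooth_at_extend by blast
      from choice[OF this] obtain k where k: "\<And>i. k i \<in> C" "\<And>i. \<forall>\<^sub>F z in nhds y. k i z = h i (\<phi> z)"
        by blast
      have ky: "k i y = h i (\<phi> y)" for i using eventually_nhds_x_imp_x[OF k(2)] .
      have ev: "\<forall>\<^sub>F z in nhds y. \<forall>i\<in>{..<n}. k i z = h i (\<phi> z)"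
        by (intro eventually_ball_finite) (use k(2) in auto)
      have "open (U \<inter> \<phi> -` ball (\<phi> y) R)"
        using continuous_on_open_vimage[OF oU, of \<phi>] chart_cont[OF U(1)] by (simp add: Int_commute)
      from eventually_nhds_in_open[OF this, of y] yU R(1)
      have ev2: "\<forall>\<^sub>F z in nhds y. z \<in> U \<and> \<phi> z \<in> ball (\<phi> y) R" by simp
      define G where "G z = g y + (\<Sum>i<n. (f i z - f i y) * k i z)" for z
      have fk: "(\<lambda>z. (f i z - f i y) * k i z) \<in> C" for i
        by (intro smooth_funs_mult smooth_funs_diff smooth_funs_const fC k)
      have "G \<in> C" unfolding G_def by (intro smooth_funs_add smooth_funs_sum smooth_funs_const fk)
      moreover have "\<forall>\<^sub>F z in nhds y. g z = G z"
        using ev ev2 eventually_nhds_in_open[OF W(1) y]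
      proof eventually_elim
        case (elim z)
        have "f i z - f i y = (\<phi> z - \<phi> y) \<bullet> e i" for i
          using elim y W by (simp add: f_def subset_iff inner_diff_left)
        then have "G z = g y + (\<Sum>i<n. ((\<phi> z - \<phi> y) \<bullet> e i) * h i (\<phi> z))"
          using elim by (simp add: G_def)
        moreover have "(g \<circ> ?i) (\<phi> z) = (g \<circ> ?i) (\<phi> y) + (\<Sum>i<n. ((\<phi> z - \<phi> y) \<bullet> e i) * h i (\<phi> z))"
          using h(2) elim(2) by blast
        ultimately show ?case using elim(2) inv yU by simp
      qed
      ultimately have "v g = v G" using tangent_cong[OF v g] by blast
      also have "\<dots> = (\<Sum>i<n. v (\<lambda>z. (f i z - f i y) * k i z))"
        unfolding G_def
        by (simp add: tangent_add[OF v] tangent_const[OF v] tangent_sum[OF v] fk smooth_funs_const smooth_funs_sum)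
      also have "\<dots> = (\<Sum>i<n. v (f i) * k i y)"
        by (intro sum.cong refl)
          (simp add: tangent_leibniz[OF v] tangent_diff[OF v] tangent_const[OF v] smooth_funs_diff smooth_funs_const fC k)
      also have "\<dots> = (\<Sum>i<n. v (f i) *\<^sub>R X i y) g"
        using g yU y W by (simp add: sum_fun_apply scaleR_fun_def X_def ky h(3))
      finally show "v g = (\<Sum>i<n. v (f i) *\<^sub>R X i y) g" .
    qed
    show ?thesis
      by (intro exI[of _ W] exI[of _ f] exI[of _ X] conjI allI ballI impI W fC XV Xf expand)
  qed
  then have "\<forall>x. \<exists>W f X. open W \<and> x \<in> W \<and> (\<forall>i<n. f i \<in> C \<and> X i \<in> vector_fields A) \<and>
    (\<forall>y\<in>W. \<forall>i<n. \<forall>j<n. X i y (f j) = (if i = j then 1 else 0)) \<and>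
    (\<forall>y\<in>W. \<forall>v\<in>T y. v = (\<Sum>i<n. v (f i) *\<^sub>R X i y))" by (rule allI)
  then show ?thesis by (rule that)
qed

end

section \<open>The exterior derivative of alternating functions on vector fields\<close>

text \<open>Forms are handled as functions of lists of vector fields. Peeling off the first argument,
  Cartan's formula \<open>i_X d = L_X - d i_X\<close> becomes a recursive definition of the exterior
  derivative.\<close>

type_synonym 'a vfield = "'a \<Rightarrow> 'a tvec"

text \<open>\<open>F\<close> ranges over all functions of lists of fields, so that the recursion can
  pass to \<open>\<lambda>Zs. F (Y # Zs)\<close>; multilinearity and smoothness of the values are
  hypotheses of the single lemmas.\<close>

primrec lie_der :: "('a::topological_space, 'b::real_normed_vector) atlas \<Rightarrow> 'a vfield \<Rightarrow> 'a vfield list \<Rightarrow>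
    ('a vfield list \<Rightarrow> 'a \<Rightarrow> real) \<Rightarrow> 'a \<Rightarrow> real" where
  "lie_der A X [] F = (\<lambda>x. X x (F []))"
| "lie_der A X (Y # Ys) F = (\<lambda>x. lie_der A X Ys (\<lambda>Zs. F (Y # Zs)) x - F (lie_bracket A X Y # Ys) x)"

text \<open>A function has no interior product, so the value 0 at the empty list is what makes the
  derivative of a function \<open>f\<close> on a single field \<open>X\<close> equal to
  \<open>X f\<close>.\<close>

primrec ext_der :: "('a::topological_space, 'b::real_normed_vector) atlas \<Rightarrow> 'a vfield list \<Rightarrow>
    ('a vfield list \<Rightarrow> 'a \<Rightarrow> real) \<Rightarrow> 'a \<Rightarrow> real" where
  "ext_der A [] F = (\<lambda>x. 0)"
| "ext_der A (X # Xs) F = (\<lambda>x. lie_der A X Xs F x - ext_der A Xs (\<lambda>Zs. F (X # Zs)) x)"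

definition scale_field :: "('a \<Rightarrow> real) \<Rightarrow> 'a vfield \<Rightarrow> 'a vfield" where
  "scale_field f X = (\<lambda>x. f x *\<^sub>R X x)"

context manifold
begin

abbreviation "VF \<equiv> vector_fields A"
abbreviation "br \<equiv> lie_bracket A"

lemma VF_iff: "X \<in> VF \<longleftrightarrow> (\<forall>x. X x \<in> T x) \<and> (\<forall>f\<in>C. (\<lambda>x. X x f) \<in> C)"
  by (auto simp: vector_fields_def vector_field_on_def smooth_funs_def)

lemma VF_T: "X \<in> VF \<Longrightarrow> X x \<in> T x" and VF_C: "X \<in> VF \<Longrightarrow> f \<in> C \<Longrightarrow> (\<lambda>x. X x f) \<in> C"
  by (auto simp: VF_iff)

lemmas VF_lin = tangent_lin[OF VF_T] and VF_add = tangent_add[OF VF_T] and VF_diff = tangent_diff[OF VF_T]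
  and VF_leibniz = tangent_leibniz[OF VF_T] and VF_const = tangent_const[OF VF_T]
  and VF_undef = tangent_undef[OF VF_T]

lemma VF_eqI:
  assumes "X \<in> VF" "Y \<in> VF" "\<And>x f. f \<in> C \<Longrightarrow> X x f = Y x f"
  shows "X = Y"
proof (intro ext)
  fix x f
  show "X x f = Y x f"
    using assms tangent_undef[OF VF_T[OF assms(1)]] tangent_undef[OF VF_T[OF assms(2)]] by (cases "f \<in> C") auto
qed

lemma VF_plus [intro, simp]: "X \<in> VF \<Longrightarrow> Y \<in> VF \<Longrightarrow> X + Y \<in> VF"
  using subspace_add[OF subspace_tangent] by (simp add: VF_iff plus_fun_def smooth_funs_add)

lemma VF_scale_field [intro, simp]: "f \<in> C \<Longrightarrow> X \<in> VF \<Longrightarrow> scale_field f X \<in> VF"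
  using subspace_scale[OF subspace_tangent] by (simp add: VF_iff scale_field_def scaleR_fun_def smooth_funs_mult)

lemma VF_minus [intro, simp]: "X \<in> VF \<Longrightarrow> Y \<in> VF \<Longrightarrow> X - Y \<in> VF"
  using subspace_diff[OF subspace_tangent] by (simp add: VF_iff fun_diff_def smooth_funs_diff)

section \<open>Lie brackets of vector fields\<close>

lemma VF_bracket [intro, simp]:
  assumes X: "X \<in> VF" and Y: "Y \<in> VF"
  shows "br X Y \<in> VF"
  unfolding VF_iff
proof (intro conjI allI ballI)
  fix x
  note cl = smooth_funs_add smooth_funs_mult smooth_funs_const VF_C[OF X] VF_C[OF Y]
  show "br X Y x \<in> T x"
  proof (rule tangentI)
    fix f g a b assume fg: "f \<in> C" "g \<in> C"
    have "(\<lambda>y. a * f y + b * g y) \<in> C" by (intro cl fg)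
    then show "br X Y x (\<lambda>y. a * f y + b * g y) = a * br X Y x f + b * br X Y x g"
      using fg by (simp add: lie_bracket_def VF_lin[OF X] VF_lin[OF Y] VF_C X Y algebra_simps)
  next
    fix f g assume fg: "f \<in> C" "g \<in> C"
    have "(\<lambda>y. f y * g y) \<in> C" by (intro cl fg)
    then show "br X Y x (\<lambda>y. f y * g y) = f x * br X Y x g + g x * br X Y x f"
      using fg by (simp add: lie_bracket_def VF_leibniz[OF X] VF_leibniz[OF Y] X Y VF_C VF_add[OF X] VF_add[OF Y] smooth_funs_mult algebra_simps)
  qed (simp add: lie_bracket_def)
next
  fix f assume "f \<in> C"
  then show "(\<lambda>x. br X Y x f) \<in> C"
    using X Y by (simp add: lie_bracket_def VF_C smooth_funs_diff)
qed

lemma bracket_apply: "f \<in> C \<Longrightarrow> br X Y x f = X x (\<lambda>y. Y y f) - Y x (\<lambda>y. X y f)"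
  by (simp add: lie_bracket_def)

lemma bracket_self [simp]: "br X X = 0"
  by (intro ext) (simp add: lie_bracket_def)

lemma bracket_plus_right:
  assumes "X \<in> VF" "Y \<in> VF" "Z \<in> VF"
  shows "br X (Y + Z) = br X Y + br X Z"
  by (rule VF_eqI) (use assms in \<open>auto simp: bracket_apply VF_C VF_add[OF assms(1)]\<close>)

lemma bracket_plus_left:
  assumes "X \<in> VF" "Y \<in> VF" "Z \<in> VF"
  shows "br (X + Y) Z = br X Z + br Y Z"
  by (rule VF_eqI) (use assms in \<open>auto simp: bracket_apply VF_C VF_add[OF assms(3)]\<close>)

lemma scale_field_apply [simp]: "scale_field f X x g = f x * X x g"
  by (simp add: scale_field_def scaleR_fun_def)

lemma bracket_scale_field_right:
  assumes "f \<in> C" "X \<in> VF" "Y \<in> VF"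
  shows "br X (scale_field f Y) = scale_field f (br X Y) + scale_field (\<lambda>x. X x f) Y"
  by (rule VF_eqI)
    (use assms in \<open>auto simp: bracket_apply VF_C VF_leibniz[OF assms(2)] algebra_simps\<close>)

text \<open>Written as the derivation property of \<open>br X\<close>, the form in which the
  identity enters the commutator of two Lie derivatives.\<close>

lemma Jacobi:
  assumes "X \<in> VF" "Y \<in> VF" "Z \<in> VF"
  shows "br X (br Y Z) = br (br X Y) Z + br Y (br X Z)"
proof (rule VF_eqI)
  fix x f assume f: "f \<in> C"
  note [simp] = VF_diff[OF assms(1)] VF_diff[OF assms(2)] VF_diff[OF assms(3)] VF_C
  show "br X (br Y Z) x f = (br (br X Y) Z + br Y (br X Z)) x f"
    using f assms by (simp add: bracket_apply)
qed (use assms in auto)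

lemma VF_zero [simp]: "0 \<in> VF"
  using subspace_0[OF subspace_tangent] by (simp add: VF_iff zero_fun_def smooth_funs_const)

text \<open>These are the alternating maps on \<open>k\<close> vector fields that are multilinear
  over the smooth functions. The recursion makes contraction with a first argument immediate;
  alternation is demanded for adjacent arguments only, which implies antisymmetry.\<close>

primrec fields_altmul :: "nat \<Rightarrow> ('a vfield list \<Rightarrow> 'a \<Rightarrow> real) \<Rightarrow> bool" where
  "fields_altmul 0 F \<longleftrightarrow> F [] \<in> C"
| "fields_altmul (Suc k) F \<longleftrightarrow> (\<forall>X\<in>VF. fields_altmul k (\<lambda>Zs. F (X # Zs))) \<and>
     (\<forall>X\<in>VF. \<forall>Y\<in>VF. \<forall>Zs\<in>lists VF. length Zs = k \<longrightarrow> F ((X + Y) # Zs) = (\<lambda>x. F (X # Zs) x + F (Y # Zs) x)) \<and>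
     (\<forall>f\<in>C. \<forall>X\<in>VF. \<forall>Zs\<in>lists VF. length Zs = k \<longrightarrow> F (scale_field f X # Zs) = (\<lambda>x. f x * F (X # Zs) x)) \<and>
     (\<forall>X\<in>VF. \<forall>Zs\<in>lists VF. Suc (length Zs) = k \<longrightarrow> F (X # X # Zs) = (\<lambda>x. 0))"

lemma fields_altmul_contract: "fields_altmul (Suc k) F \<Longrightarrow> X \<in> VF \<Longrightarrow> fields_altmul k (\<lambda>Zs. F (X # Zs))"
  by simp

lemma fields_altmul_plus: "fields_altmul (Suc k) F \<Longrightarrow> X \<in> VF \<Longrightarrow> Y \<in> VF \<Longrightarrow> Zs \<in> lists VF \<Longrightarrow> length Zs = k \<Longrightarrow>
    F ((X + Y) # Zs) x = F (X # Zs) x + F (Y # Zs) x"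
  by simp

lemma fields_altmul_scale_field: "fields_altmul (Suc k) F \<Longrightarrow> f \<in> C \<Longrightarrow> X \<in> VF \<Longrightarrow> Zs \<in> lists VF \<Longrightarrow> length Zs = k \<Longrightarrow>
    F (scale_field f X # Zs) x = f x * F (X # Zs) x"
  by simp

lemma fields_altmul_same: "fields_altmul (Suc k) F \<Longrightarrow> X \<in> VF \<Longrightarrow> Zs \<in> lists VF \<Longrightarrow> Suc (length Zs) = k \<Longrightarrow>
    F (X # X # Zs) x = 0"
  by simp

lemma fields_altmul_swap:
  assumes F: "fields_altmul (Suc (Suc k)) F" and X: "X \<in> VF" "Y \<in> VF" and Zs: "Zs \<in> lists VF" "length Zs = k"
  shows "F (X # Y # Zs) x = - F (Y # X # Zs) x"
proof -
  have "0 = F ((X + Y) # (X + Y) # Zs) x"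
    using fields_altmul_same[OF F, of "X + Y"] X Zs by simp
  also have "\<dots> = F (X # (X + Y) # Zs) x + F (Y # (X + Y) # Zs) x"
    using fields_altmul_plus[OF F, of X Y "(X + Y) # Zs"] X Zs by simp
  also have "\<dots> = F (X # X # Zs) x + F (X # Y # Zs) x + (F (Y # X # Zs) x + F (Y # Y # Zs) x)"
    using fields_altmul_plus[OF fields_altmul_contract[OF F X(1)] X Zs] fields_altmul_plus[OF fields_altmul_contract[OF F X(2)] X Zs] by simp
  also have "\<dots> = F (X # Y # Zs) x + F (Y # X # Zs) x"
    using fields_altmul_same[OF F X(1) Zs(1)] fields_altmul_same[OF F X(2) Zs(1)] Zs(2) by simp
  finally show ?thesis by simp
qed

lemma fields_altmul_zero: "fields_altmul (Suc k) F \<Longrightarrow> Zs \<in> lists VF \<Longrightarrow> length Zs = k \<Longrightarrow> F (0 # Zs) x = 0"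
  using fields_altmul_plus[of k F 0 0 Zs x] by simp

lemma fields_altmul_val: "fields_altmul k F \<Longrightarrow> Zs \<in> lists VF \<Longrightarrow> length Zs = k \<Longrightarrow> F Zs \<in> C"
proof (induction Zs arbitrary: k F)
  case (Cons X Zs)
  then show ?case using Cons.IH[of "k - 1" "\<lambda>Zs. F (X # Zs)"] by (cases k) auto
qed auto

lemma fields_altmul_diff: "fields_altmul k F \<Longrightarrow> fields_altmul k G \<Longrightarrow> fields_altmul k (\<lambda>Zs x. F Zs x - G Zs x)"
  by (induction k arbitrary: F G) (auto simp: smooth_funs_diff algebra_simps)

text \<open>Derivations are additive on smooth functions only. This condition is all that linearity
  of \<open>lie_der\<close> and \<open>ext_der\<close> in \<open>F\<close> asks for.\<close>

definition valued :: "nat \<Rightarrow> ('a vfield list \<Rightarrow> 'a \<Rightarrow> real) \<Rightarrow> bool" where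
  "valued k F \<longleftrightarrow> (\<forall>Zs\<in>lists VF. length Zs = k \<longrightarrow> F Zs \<in> C)"

lemma fields_altmul_valued: "fields_altmul k F \<Longrightarrow> valued k F"
  by (simp add: valued_def fields_altmul_val)

lemma valuedD: "valued k F \<Longrightarrow> Zs \<in> lists VF \<Longrightarrow> length Zs = k \<Longrightarrow> F Zs \<in> C"
  by (simp add: valued_def)

lemma valued_contract: "valued (Suc k) F \<Longrightarrow> X \<in> VF \<Longrightarrow> valued k (\<lambda>Zs. F (X # Zs))"
  by (simp add: valued_def)

section \<open>Cartan calculus: Lie derivatives, exterior derivative, and vanishing of its
  square\<close>

lemma lie_der_cong:
  "X \<in> VF \<Longrightarrow> Ys \<in> lists VF \<Longrightarrow> (\<And>Zs. Zs \<in> lists VF \<Longrightarrow> length Zs = length Ys \<Longrightarrow> F Zs = G Zs) \<Longrightarrow>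
    lie_der A X Ys F = lie_der A X Ys G"
proof (induction Ys arbitrary: F G)
  case (Cons Y Ys)
  have "lie_der A X Ys (\<lambda>Zs. F (Y # Zs)) = lie_der A X Ys (\<lambda>Zs. G (Y # Zs))"
    by (rule Cons.IH) (use Cons.prems in auto)
  then show ?case using Cons.prems by simp
qed simp

lemma ext_der_cong:
  "Ys \<in> lists VF \<Longrightarrow> (\<And>Zs. Zs \<in> lists VF \<Longrightarrow> Suc (length Zs) = length Ys \<Longrightarrow> F Zs = G Zs) \<Longrightarrow>
    ext_der A Ys F = ext_der A Ys G"
proof (induction Ys arbitrary: F G)
  case (Cons Y Ys)
  have "ext_der A Ys (\<lambda>Zs. F (Y # Zs)) = ext_der A Ys (\<lambda>Zs. G (Y # Zs))"
    by (rule Cons.IH) (use Cons.prems in auto)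
  moreover have "lie_der A Y Ys F = lie_der A Y Ys G"
    by (rule lie_der_cong) (use Cons.prems in auto)
  ultimately show ?case by simp
qed simp

lemma lie_der_valued:
  "X \<in> VF \<Longrightarrow> Ys \<in> lists VF \<Longrightarrow> valued (length Ys) F \<Longrightarrow> lie_der A X Ys F \<in> C"
proof (induction Ys arbitrary: F)
  case Nil
  then show ?case by (simp add: VF_C valued_def)
next
  case (Cons Y Ys)
  have "lie_der A X Ys (\<lambda>Zs. F (Y # Zs)) \<in> C"
    using Cons by (intro Cons.IH valued_contract) auto
  moreover have "F (br X Y # Ys) \<in> C"
    by (rule valuedD[OF Cons.prems(3)]) (use Cons.prems in auto)
  ultimately show ?case by (simp add: smooth_funs_diff)
qed

lemma lie_der_add:
  "X \<in> VF \<Longrightarrow> Ys \<in> lists VF \<Longrightarrow> valued (length Ys) F \<Longrightarrow> valued (length Ys) G \<Longrightarrow>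
    lie_der A X Ys (\<lambda>Zs x. F Zs x + G Zs x) x = lie_der A X Ys F x + lie_der A X Ys G x"
proof (induction Ys arbitrary: F G)
  case Nil
  then show ?case using VF_add[of X "F []" "G []" x] by (simp add: valued_def)
next
  case (Cons Y Ys)
  then have "lie_der A X Ys (\<lambda>Zs x. F (Y # Zs) x + G (Y # Zs) x) x =
      lie_der A X Ys (\<lambda>Zs. F (Y # Zs)) x + lie_der A X Ys (\<lambda>Zs. G (Y # Zs)) x"
    by (intro Cons.IH valued_contract) auto
  then show ?case by simp
qed

lemma lie_der_scale:
  "X \<in> VF \<Longrightarrow> Ys \<in> lists VF \<Longrightarrow> valued (length Ys) F \<Longrightarrow> f \<in> C \<Longrightarrow>
    lie_der A X Ys (\<lambda>Zs x. f x * F Zs x) x = f x * lie_der A X Ys F x + X x f * F Ys x"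
proof (induction Ys arbitrary: F)
  case Nil
  then show ?case using VF_leibniz[of X f "F []" x] by (simp add: valued_def)
next
  case (Cons Y Ys)
  then have "lie_der A X Ys (\<lambda>Zs x. f x * F (Y # Zs) x) x =
      f x * lie_der A X Ys (\<lambda>Zs. F (Y # Zs)) x + X x f * F (Y # Ys) x"
    by (intro Cons.IH valued_contract) auto
  then show ?case by (simp add: algebra_simps)
qed

lemma lie_der_diff:
  assumes "X \<in> VF" "Ys \<in> lists VF" "valued (length Ys) F" "valued (length Ys) G"
  shows "lie_der A X Ys (\<lambda>Zs x. F Zs x - G Zs x) x = lie_der A X Ys F x - lie_der A X Ys G x"
proof -
  have v: "valued (length Ys) (\<lambda>Zs x. - 1 * G Zs x)"
    using assms(4) by (auto simp: valued_def smooth_funs_uminus)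
  show ?thesis
    using lie_der_add[OF assms(1-3) v] lie_der_scale[OF assms(1,2,4) smooth_funs_const, of "-1"]
    by (simp add: VF_const[OF assms(1)])
qed

lemma ext_der_valued:
  "Ys \<in> lists VF \<Longrightarrow> valued (length Ys - 1) F \<Longrightarrow> ext_der A Ys F \<in> C"
proof (induction Ys arbitrary: F)
  case Nil
  then show ?case by (simp add: smooth_funs_const)
next
  case (Cons Y Ys)
  have "ext_der A Ys (\<lambda>Zs. F (Y # Zs)) \<in> C"
  proof (cases Ys)
    case Nil
    then show ?thesis by (simp add: smooth_funs_const)
  next
    case (Cons Z Zs)
    then show ?thesis using Cons.prems by (intro Cons.IH valued_contract) auto
  qed
  then show ?case using Cons.prems by (auto intro!: smooth_funs_diff lie_der_valued)
qed

lemma ext_der_diff: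
  "Ys \<in> lists VF \<Longrightarrow> valued (length Ys - 1) F \<Longrightarrow> valued (length Ys - 1) G \<Longrightarrow>
    ext_der A Ys (\<lambda>Zs x. F Zs x - G Zs x) x = ext_der A Ys F x - ext_der A Ys G x"
proof (induction Ys arbitrary: F G)
  case Nil
  then show ?case by simp
next
  case (Cons Y Ys)
  have "ext_der A Ys (\<lambda>Zs x. F (Y # Zs) x - G (Y # Zs) x) x =
      ext_der A Ys (\<lambda>Zs. F (Y # Zs)) x - ext_der A Ys (\<lambda>Zs. G (Y # Zs)) x"
  proof (cases Ys)
    case Nil
    then show ?thesis by simp
  next
    case (Cons Z Zs)
    then show ?thesis using Cons.prems by (intro Cons.IH valued_contract) auto
  qed
  then show ?case using Cons.prems by (simp add: lie_der_diff)
qed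

lemma ext_der_zero: "Ys \<in> lists VF \<Longrightarrow> ext_der A Ys (\<lambda>Zs x. 0) x = 0"
  using ext_der_diff[of Ys "\<lambda>Zs x. 0" "\<lambda>Zs x. 0" x] by (simp add: valued_def smooth_funs_const)

lemma ext_der_add:
  assumes "Ys \<in> lists VF" "valued (length Ys - 1) F" "valued (length Ys - 1) G"
  shows "ext_der A Ys (\<lambda>Zs x. F Zs x + G Zs x) x = ext_der A Ys F x + ext_der A Ys G x"
proof -
  have "valued (length Ys - 1) (\<lambda>Zs x. F Zs x + G Zs x)"
    using assms by (auto simp: valued_def smooth_funs_add)
  from ext_der_diff[OF assms(1) this assms(3)] show ?thesis by simp
qed

lemma lie_der_valued': "X \<in> VF \<Longrightarrow> valued k F \<Longrightarrow> valued k (\<lambda>Ys. lie_der A X Ys F)"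
  by (simp add: valued_def[of k "\<lambda>Ys. lie_der A X Ys F"] lie_der_valued)

lemma ext_der_valued': "valued k F \<Longrightarrow> valued (Suc k) (\<lambda>Ys. ext_der A Ys F)"
  by (simp add: valued_def[of "Suc k"] ext_der_valued)

text \<open>Peeling off \<open>Z\<close> leaves the claim for \<open>F (Z # _)\<close>, mixed terms
  that are symmetric in \<open>X\<close> and \<open>Y\<close> and cancel, and values of
  \<open>F\<close> on double brackets, which the Jacobi identity combines.\<close>

lemma lie_der_commutator:
  "X \<in> VF \<Longrightarrow> Y \<in> VF \<Longrightarrow> Zs \<in> lists VF \<Longrightarrow> fields_altmul (length Zs) F \<Longrightarrow>
    lie_der A X Zs (\<lambda>Ws. lie_der A Y Ws F) x - lie_der A Y Zs (\<lambda>Ws. lie_der A X Ws F) x =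
    lie_der A (br X Y) Zs F x"
proof (induction Zs arbitrary: F)
  case Nil
  then show ?case by (simp add: bracket_apply)
next
  case (Cons Z Zs)
  have Z: "Z \<in> VF" "Zs \<in> lists VF" using Cons.prems by auto
  have F: "fields_altmul (Suc (length Zs)) F" using Cons.prems by simp
  have expand: "lie_der A X (Z # Zs) (\<lambda>Ws. lie_der A Y Ws F) x =
      lie_der A X Zs (\<lambda>Ws. lie_der A Y Ws (\<lambda>Ws. F (Z # Ws))) x - lie_der A X Zs (\<lambda>Ws. F (br Y Z # Ws)) x
      - lie_der A Y Zs (\<lambda>Ws. F (br X Z # Ws)) x + F (br Y (br X Z) # Zs) x"
    if "X \<in> VF" "Y \<in> VF" for X Y
    using that Z
    by (simp add: lie_der_diff lie_der_valued' fields_altmul_valued fields_altmul_contract[OF F])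
  have "F (br X (br Y Z) # Zs) x = F (br (br X Y) Z # Zs) x + F (br Y (br X Z) # Zs) x"
    using fields_altmul_plus[OF F, of "br (br X Y) Z" "br Y (br X Z)" Zs x] Z Cons.prems by (simp add: Jacobi[OF Cons.prems(1,2) Z(1)])
  moreover have "lie_der A X Zs (\<lambda>Ws. lie_der A Y Ws (\<lambda>Zs. F (Z # Zs))) x -
      lie_der A Y Zs (\<lambda>Ws. lie_der A X Ws (\<lambda>Zs. F (Z # Zs))) x = lie_der A (br X Y) Zs (\<lambda>Zs. F (Z # Zs)) x"
    by (rule Cons.IH) (use Cons.prems Z F in auto)
  ultimately show ?case
    using expand[OF Cons.prems(1,2)] expand[OF Cons.prems(2,1)] by simp
qed

text \<open>When the first argument is multiplied by \<open>f\<close>, the term with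
  \<open>X f\<close> from the Leibniz rule cancels against the one from
  \<open>[X, f Y] = f [X, Y] + (X f) Y\<close>. For two equal arguments the two bracket terms cancel
  by antisymmetry of \<open>F\<close>.\<close>

lemma lie_der_fields_altmul: "X \<in> VF \<Longrightarrow> fields_altmul k F \<Longrightarrow> fields_altmul k (\<lambda>Zs. lie_der A X Zs F)"
proof (induction k arbitrary: F)
  case 0
  then show ?case by (simp add: VF_C)
next
  case (Suc k)
  note X = Suc.prems(1) and F = Suc.prems(2)
  note v = fields_altmul_valued[OF fields_altmul_contract[OF F]]
  have c: "fields_altmul k (\<lambda>Zs. lie_der A X (Y # Zs) F)" if "Y \<in> VF" for Y
    unfolding lie_der.simps using that X F by (intro fields_altmul_diff Suc.IH fields_altmul_contract[OF F]) auto
  have p: "lie_der A X ((Y + Y') # Zs) F = (\<lambda>x. lie_der A X (Y # Zs) F x + lie_der A X (Y' # Zs) F x)"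
    if Y: "Y \<in> VF" "Y' \<in> VF" and Zs: "Zs \<in> lists VF" "length Zs = k" for Y Y' Zs
  proof
    fix x
    have "lie_der A X Zs (\<lambda>Ws. F ((Y + Y') # Ws)) = lie_der A X Zs (\<lambda>Ws x. F (Y # Ws) x + F (Y' # Ws) x)"
      by (rule lie_der_cong) (use X Y Zs F in auto)
    moreover have "F (br X (Y + Y') # Zs) x = F (br X Y # Zs) x + F (br X Y' # Zs) x"
      using fields_altmul_plus[OF F] X Y Zs by (simp add: bracket_plus_right)
    ultimately show "lie_der A X ((Y + Y') # Zs) F x = lie_der A X (Y # Zs) F x + lie_der A X (Y' # Zs) F x"
      using v Y X Zs by (simp add: lie_der_add)
  qed
  have m: "lie_der A X (scale_field f Y # Zs) F = (\<lambda>x. f x * lie_der A X (Y # Zs) F x)"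
    if f: "f \<in> C" and Y: "Y \<in> VF" and Zs: "Zs \<in> lists VF" "length Zs = k" for f Y Zs
  proof
    fix x
    have "lie_der A X Zs (\<lambda>Ws. F (scale_field f Y # Ws)) = lie_der A X Zs (\<lambda>Ws x. f x * F (Y # Ws) x)"
      by (rule lie_der_cong) (use X Y Zs F f in auto)
    moreover have "F (br X (scale_field f Y) # Zs) x = f x * F (br X Y # Zs) x + X x f * F (Y # Zs) x"
      using fields_altmul_plus[OF F, of "scale_field f (br X Y)" "scale_field (\<lambda>x. X x f) Y" Zs x]
        fields_altmul_scale_field[OF F, of f "br X Y" Zs x] fields_altmul_scale_field[OF F, of "\<lambda>x. X x f" Y Zs x] X Y Zs f
      by (simp only: bracket_scale_field_right) (simp add: VF_C)
    ultimately show "lie_der A X (scale_field f Y # Zs) F x = f x * lie_der A X (Y # Zs) F x"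
      using v Y X Zs f by (simp add: lie_der_scale algebra_simps)
  qed
  have s: "lie_der A X (Y # Y # Zs) F = (\<lambda>x. 0)"
    if Y: "Y \<in> VF" and Zs: "Zs \<in> lists VF" "Suc (length Zs) = k" for Y Zs
  proof
    fix x
    have "lie_der A X Zs (\<lambda>Ws. F (Y # Y # Ws)) = lie_der A X Zs (\<lambda>Ws x. 0 * F Ws x)"
      by (rule lie_der_cong) (use X Y Zs F in auto)
    also have "\<dots> = lie_der A X Zs (\<lambda>Ws x. 0 * (0::real))" by simp
    also have "\<dots> = (\<lambda>x. 0)"
      using lie_der_scale[OF X Zs(1), of "\<lambda>_ _. 0" "\<lambda>_. 0"] by (auto simp: valued_def smooth_funs_const)
    finally have "lie_der A X Zs (\<lambda>Ws. F (Y # Y # Ws)) x = 0" by simp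
    moreover have "F (Y # br X Y # Zs) x = - F (br X Y # Y # Zs) x"
      by (rule fields_altmul_swap[of "length Zs"]) (use F X Y Zs in auto)
    ultimately show "lie_der A X (Y # Y # Zs) F x = 0" by simp
  qed
  show ?case
    unfolding fields_altmul.simps by (intro conjI ballI impI c p m s; assumption)
qed

lemma lie_der_plus:
  "X \<in> VF \<Longrightarrow> Y \<in> VF \<Longrightarrow> Zs \<in> lists VF \<Longrightarrow> fields_altmul (length Zs) F \<Longrightarrow>
    lie_der A (X + Y) Zs F x = lie_der A X Zs F x + lie_der A Y Zs F x"
proof (induction Zs arbitrary: F)
  case Nil
  then show ?case by (simp add: plus_fun_def)
next
  case (Cons Z Zs)
  then have F: "fields_altmul (Suc (length Zs)) F" by simp
  have "F (br (X + Y) Z # Zs) x = F (br X Z # Zs) x + F (br Y Z # Zs) x"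
    using fields_altmul_plus[OF F] Cons.prems by (simp add: bracket_plus_left)
  moreover have "lie_der A (X + Y) Zs (\<lambda>Ws. F (Z # Ws)) x =
      lie_der A X Zs (\<lambda>Ws. F (Z # Ws)) x + lie_der A Y Zs (\<lambda>Ws. F (Z # Ws)) x"
    by (rule Cons.IH) (use Cons.prems F in auto)
  ultimately show ?case unfolding lie_der.simps by linarith
qed

text \<open>Multiplying the first field by a function is not visibly harmless, as
  \<open>lie_der\<close> differentiates along that field. The second slot is covered by the
  induction hypothesis and by the Lie derivative, and antisymmetry \<open>sw\<close>, a consequence
  of additivity and alternation, transports homogeneity to the first slot.\<close>

lemma ext_der_fields_altmul: "fields_altmul k F \<Longrightarrow> fields_altmul (Suc k) (\<lambda>Zs. ext_der A Zs F)"
proof (induction k arbitrary: F)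
  case 0
  then show ?case
    by (auto simp: VF_C smooth_funs_diff smooth_funs_const plus_fun_def scale_field_def scaleR_fun_def)
next
  case (Suc k)
  note F = Suc.prems
  let ?G = "\<lambda>Zs. ext_der A Zs F"
  note contr = fields_altmul_contract[OF F]
  have c: "fields_altmul (Suc k) (\<lambda>Zs. ?G (X # Zs))" if "X \<in> VF" for X
    unfolding ext_der.simps using that by (intro fields_altmul_diff lie_der_fields_altmul F Suc.IH contr)
  have p: "?G ((X + Y) # Zs) x = ?G (X # Zs) x + ?G (Y # Zs) x"
    if X: "X \<in> VF" "Y \<in> VF" and Zs: "Zs \<in> lists VF" "length Zs = Suc k" for X Y Zs x
  proof -
    have "ext_der A Zs (\<lambda>Ws. F ((X + Y) # Ws)) = ext_der A Zs (\<lambda>Ws x. F (X # Ws) x + F (Y # Ws) x)"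
      by (rule ext_der_cong) (use X Zs F in auto)
    then show ?thesis
      using X Zs F fields_altmul_valued[OF contr[OF X(1)]] fields_altmul_valued[OF contr[OF X(2)]]
      by (simp add: lie_der_plus ext_der_add del: fields_altmul.simps)
  qed
  have s: "?G (X # X # Zs) x = 0" if X: "X \<in> VF" and Zs: "Zs \<in> lists VF" "Suc (length Zs) = Suc k" for X Zs x
  proof -
    have "ext_der A Zs (\<lambda>Ws. F (X # X # Ws)) = ext_der A Zs (\<lambda>Ws x. 0)"
      by (rule ext_der_cong) (use X Zs F in auto)
    then have "ext_der A Zs (\<lambda>Ws. F (X # X # Ws)) x = 0" using ext_der_zero Zs by simp
    moreover have "F (0 # Zs) x = 0" using fields_altmul_zero[OF F] Zs by simp
    ultimately show ?thesis by simp
  qed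
  have sw: "?G (X # Y # Zs) x = - ?G (Y # X # Zs) x"
    if X: "X \<in> VF" "Y \<in> VF" and Zs: "Zs \<in> lists VF" "length Zs = k" for X Y Zs x
  proof -
    have "0 = ?G ((X + Y) # (X + Y) # Zs) x" using s[of "X + Y" Zs x] X Zs by (simp del: ext_der.simps)
    also have "\<dots> = ?G (X # (X + Y) # Zs) x + ?G (Y # (X + Y) # Zs) x"
      by (rule p) (use X Zs in auto)
    also have "\<dots> = ?G (X # X # Zs) x + ?G (X # Y # Zs) x + (?G (Y # X # Zs) x + ?G (Y # Y # Zs) x)"
      using fields_altmul_plus[OF c[OF X(1)] X Zs, of x] fields_altmul_plus[OF c[OF X(2)] X Zs, of x] by (simp only:)
    also have "\<dots> = ?G (X # Y # Zs) x + ?G (Y # X # Zs) x"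
      using s[OF X(1) Zs(1)] s[OF X(2) Zs(1)] Zs(2) by (simp del: ext_der.simps)
    finally show ?thesis by linarith
  qed
  have m: "?G (scale_field f X # Zs) x = f x * ?G (X # Zs) x"
    if f: "f \<in> C" and X: "X \<in> VF" and Zs: "Zs \<in> lists VF" "length Zs = Suc k" for f X Zs x
  proof -
    from Zs obtain Y Ws where Y: "Zs = Y # Ws" "Y \<in> VF" "Ws \<in> lists VF" "length Ws = k"
      by (cases Zs) auto
    have "?G (scale_field f X # Y # Ws) x = - ?G (Y # scale_field f X # Ws) x" by (rule sw) (use f X Y in auto)
    also have "\<dots> = - (f x * ?G (Y # X # Ws) x)" using fields_altmul_scale_field[OF c[OF Y(2)] f X Y(3,4), of x] by (simp only:)
    also have "\<dots> = f x * ?G (X # Y # Ws) x" by (simp only: sw[OF X Y(2-4)] mult_minus_right)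
    finally show ?thesis by (simp only: Y(1))
  qed
  show ?case
    unfolding fields_altmul.simps(2)[of "Suc k"]
    by (intro conjI ballI impI c ext p m s; assumption)
qed

text \<open>By Cartan's formula in the first argument \<open>Y\<close> the claim reduces to the
  commutator \<open>[L_X, L_Y] = L_[X, Y]\<close> and to the induction hypothesis for
  \<open>F (Y # _)\<close>.\<close>

lemma lie_der_ext_der:
  "X \<in> VF \<Longrightarrow> Zs \<in> lists VF \<Longrightarrow> fields_altmul k F \<Longrightarrow> length Zs = Suc k \<Longrightarrow>
    lie_der A X Zs (\<lambda>Ws. ext_der A Ws F) x = ext_der A Zs (\<lambda>Ws. lie_der A X Ws F) x"
proof (induction Zs arbitrary: F k)
  case Nil
  then show ?case by simp
next
  case (Cons Y Zs)
  note X = Cons.prems(1) and F = Cons.prems(3)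
  have Y: "Y \<in> VF" "Zs \<in> lists VF" and len: "length Zs = k" using Cons.prems by auto
  show ?case
  proof (cases k)
    case 0
    then have "Zs = []" using len by simp
    then show ?thesis using X Y F 0 by (simp add: bracket_apply VF_const[OF X] VF_diff[OF X] VF_C fun_eq_iff)
  next
    case (Suc j)
    note F' = F[unfolded Suc]
    have c: "fields_altmul j (\<lambda>Ws. F (Z # Ws))" if "Z \<in> VF" for Z using fields_altmul_contract[OF F' that] .
    have len': "length Zs = Suc j" using len Suc by simp
    have v: "valued (length Zs) (\<lambda>Ws. lie_der A Y Ws F)" "valued (length Zs) (\<lambda>Ws. ext_der A Ws (\<lambda>Zs. F (Y # Zs)))"
      using Y F' len' ext_der_valued'[OF fields_altmul_valued[OF c[OF Y(1)]]] lie_der_valued'[OF Y(1) fields_altmul_valued[OF F']] by auto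
    have IH1: "lie_der A X Zs (\<lambda>Ws. ext_der A Ws (\<lambda>Zs. F (Y # Zs))) x =
        ext_der A Zs (\<lambda>Ws. lie_der A X Ws (\<lambda>Zs. F (Y # Zs))) x"
      by (rule Cons.IH[OF X Y(2) c[OF Y(1)] len'])
    have com: "lie_der A X Zs (\<lambda>Ws. lie_der A Y Ws F) x - lie_der A Y Zs (\<lambda>Ws. lie_der A X Ws F) x =
        lie_der A (br X Y) Zs F x"
      by (rule lie_der_commutator[OF X Y]) (use F len in simp)
    have bXY: "br X Y \<in> VF" using X Y by simp
    have "lie_der A X (Y # Zs) (\<lambda>Ws. ext_der A Ws F) x =
        lie_der A X Zs (\<lambda>Ws. lie_der A Y Ws F) x - ext_der A Zs (\<lambda>Ws. lie_der A X Ws (\<lambda>Zs. F (Y # Zs))) x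
        - (lie_der A (br X Y) Zs F x - ext_der A Zs (\<lambda>Zs. F (br X Y # Zs)) x)"
      by (simp add: lie_der_diff[OF X Y(2) v] IH1)
    also have "\<dots> = lie_der A Y Zs (\<lambda>Ws. lie_der A X Ws F) x
        - (ext_der A Zs (\<lambda>Ws. lie_der A X Ws (\<lambda>Zs. F (Y # Zs))) x - ext_der A Zs (\<lambda>Zs. F (br X Y # Zs)) x)"
      using com by simp
    also have "ext_der A Zs (\<lambda>Ws. lie_der A X Ws (\<lambda>Zs. F (Y # Zs))) x - ext_der A Zs (\<lambda>Zs. F (br X Y # Zs)) x
        = ext_der A Zs (\<lambda>Ws x. lie_der A X Ws (\<lambda>Zs. F (Y # Zs)) x - F (br X Y # Ws) x) x"
      by (rule ext_der_diff[symmetric])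
        (use Y X len' c fields_altmul_valued bXY lie_der_valued' in auto)
    finally show ?thesis by simp
  qed
qed

text \<open>With \<open>i_X d = L_X - d i_X\<close> applied twice,
  \<open>i_X d d = L_X d - d L_X + d d i_X\<close>. The first two terms cancel by
  \<open>lie_der_ext_der\<close>, the last vanishes by induction on the degree.\<close>

lemma ext_der_ext_der:
  "Zs \<in> lists VF \<Longrightarrow> fields_altmul k F \<Longrightarrow> length Zs = Suc (Suc k) \<Longrightarrow> ext_der A Zs (\<lambda>Ws. ext_der A Ws F) x = 0"
proof (induction Zs arbitrary: F k)
  case Nil
  then show ?case by simp
next
  case (Cons X Zs)
  have X: "X \<in> VF" "Zs \<in> lists VF" and len: "length Zs = Suc k" and F: "fields_altmul k F" using Cons.prems by auto
  have "ext_der A Zs (\<lambda>Ws. ext_der A (X # Ws) F) x =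
      ext_der A Zs (\<lambda>Ws. lie_der A X Ws F) x - ext_der A Zs (\<lambda>Ws. ext_der A Ws (\<lambda>Zs. F (X # Zs))) x"
    unfolding ext_der.simps
  proof (rule ext_der_diff)
    show "valued (length Zs - 1) (\<lambda>Ws. lie_der A X Ws F)"
      using lie_der_valued'[OF X(1) fields_altmul_valued[OF F]] len by simp
    show "valued (length Zs - 1) (\<lambda>Ws. ext_der A Ws (\<lambda>Zs. F (X # Zs)))"
    proof (cases k)
      case 0
      then show ?thesis using len by (simp add: valued_def smooth_funs_const)
    next
      case (Suc j)
      then show ?thesis using len ext_der_valued'[OF fields_altmul_valued[OF fields_altmul_contract[OF F[unfolded Suc] X(1)]]] by simp
    qed
  qed (use X in simp)
  also have "ext_der A Zs (\<lambda>Ws. ext_der A Ws (\<lambda>Zs. F (X # Zs))) x = 0"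
  proof (cases k)
    case 0
    then obtain Z where "Zs = [Z]" "Z \<in> VF" using len X by (auto simp: length_Suc_conv)
    then show ?thesis by (simp add: VF_const[OF \<open>Z \<in> VF\<close>])
  next
    case (Suc j)
    show ?thesis
      by (rule Cons.IH[OF X(2) fields_altmul_contract[OF F[unfolded Suc] X(1)]]) (use len Suc in simp)
  qed
  also have "ext_der A Zs (\<lambda>Ws. lie_der A X Ws F) x = lie_der A X Zs (\<lambda>Ws. ext_der A Ws F) x"
    by (rule lie_der_ext_der[symmetric, OF X F len])
  finally show ?case by simp
qed

end

section \<open>Alternating multilinear forms\<close>

text \<open>This is the counterpart of \<open>fields_altmul\<close> in a single fibre. By
  \<open>altmul_intro\<close>, \<open>altmul_linear_slot\<close> and \<open>altmul_eq_zero\<close>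
  it agrees with linearity in every slot and vanishing on any repeated argument.\<close>

primrec altmul :: "'v::real_vector set \<Rightarrow> nat \<Rightarrow> ('v list \<Rightarrow> real) \<Rightarrow> bool" where
  "altmul V 0 F \<longleftrightarrow> True"
| "altmul V (Suc k) F \<longleftrightarrow> (\<forall>v\<in>V. altmul V k (\<lambda>w. F (v # w))) \<and>
     (\<forall>w\<in>lists V. length w = k \<longrightarrow> linear_fun_on V (\<lambda>v. F (v # w))) \<and>
     (\<forall>v\<in>V. \<forall>w\<in>lists V. Suc (length w) = k \<longrightarrow> F (v # v # w) = 0)"

lemma linear_fun_onD:
  "linear_fun_on V f \<Longrightarrow> u \<in> V \<Longrightarrow> v \<in> V \<Longrightarrow> f (a *\<^sub>R u + b *\<^sub>R v) = a * f u + b * f v"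
  by (simp add: linear_fun_on_def)

lemma linear_fun_on_add: "linear_fun_on V f \<Longrightarrow> u \<in> V \<Longrightarrow> v \<in> V \<Longrightarrow> f (u + v) = f u + f v"
  using linear_fun_onD[of V f u v 1 1] by simp

lemma linear_fun_on_scale: "linear_fun_on V f \<Longrightarrow> u \<in> V \<Longrightarrow> f (a *\<^sub>R u) = a * f u"
  using linear_fun_onD[of V f u u a 0] by simp

lemma linear_fun_on_diff: "linear_fun_on V f \<Longrightarrow> u \<in> V \<Longrightarrow> v \<in> V \<Longrightarrow> f (u - v) = f u - f v"
  using linear_fun_onD[of V f u v 1 "-1"] by simp

lemma linear_fun_on_zero: "linear_fun_on V f \<Longrightarrow> v \<in> V \<Longrightarrow> f 0 = 0"
  using linear_fun_onD[of V f v v 0 0] by simp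

lemma linear_fun_on_sum:
  assumes "linear_fun_on V f" "subspace V" "\<And>i. i \<in> I \<Longrightarrow> v i \<in> V"
  shows "f (\<Sum>i\<in>I. c i *\<^sub>R v i) = (\<Sum>i\<in>I. c i * f (v i))"
  using assms(3)
proof (induction I rule: infinite_finite_induct)
  case (insert i I)
  then show ?case
    using linear_fun_onD[OF assms(1), of "v i" "\<Sum>i\<in>I. c i *\<^sub>R v i" "c i" 1]
    by (simp add: subspace_sum subspace_scale assms(2))
qed (use linear_fun_on_zero[OF assms(1)] subspace_0[OF assms(2)] in auto)

context
  fixes V :: "'v::real_vector set"
  assumes V: "subspace V"
begin

lemma altmul_contract: "altmul V (Suc k) F \<Longrightarrow> v \<in> V \<Longrightarrow> altmul V k (\<lambda>w. F (v # w))"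
  by simp

lemma altmul_linear: "altmul V (Suc k) F \<Longrightarrow> w \<in> lists V \<Longrightarrow> length w = k \<Longrightarrow> linear_fun_on V (\<lambda>v. F (v # w))"
  by simp

lemma altmul_same: "altmul V (Suc (Suc k)) F \<Longrightarrow> v \<in> V \<Longrightarrow> w \<in> lists V \<Longrightarrow> length w = k \<Longrightarrow> F (v # v # w) = 0"
  by simp

lemma altmul_swap:
  assumes F: "altmul V (Suc (Suc k)) F" and v: "u \<in> V" "v \<in> V" and w: "w \<in> lists V" "length w = k"
  shows "F (u # v # w) = - F (v # u # w)"
proof -
  have uv: "u + v \<in> V" using v V by (simp add: subspace_add)
  have lin: "linear_fun_on V (\<lambda>a. F (a # b # w))" if "b \<in> V" for b
    by (rule altmul_linear[OF F]) (use that w in auto)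
  have lin': "linear_fun_on V (\<lambda>b. F (a # b # w))" if "a \<in> V" for a
    by (rule altmul_linear[OF altmul_contract[OF F that]]) (use w in auto)
  have "0 = F ((u + v) # (u + v) # w)" using altmul_same[OF F uv w] by simp
  also have "\<dots> = F (u # u # w) + F (u # v # w) + (F (v # u # w) + F (v # v # w))"
    using linear_fun_on_add[OF lin[OF uv] v] linear_fun_on_add[OF lin'[OF v(1)] v]
      linear_fun_on_add[OF lin'[OF v(2)] v] by simp
  finally show ?thesis using altmul_same[OF F _ w] v by simp
qed

lemma altmul_linear_slot:
  "altmul V k F \<Longrightarrow> vs \<in> lists V \<Longrightarrow> length vs = k \<Longrightarrow> i < k \<Longrightarrow> linear_fun_on V (\<lambda>v. F (vs[i := v]))"
proof (induction k arbitrary: F vs i)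
  case (Suc k)
  from Suc.prems obtain u us where vs: "vs = u # us" "u \<in> V" "us \<in> lists V" "length us = k"
    by (cases vs) auto
  show ?case
  proof (cases i)
    case 0
    then show ?thesis using altmul_linear[OF Suc.prems(1) vs(3,4)] by (simp add: vs(1))
  next
    case (Suc j)
    then show ?thesis
      using Suc.IH[OF altmul_contract[OF Suc.prems(1) vs(2)] vs(3,4), of j] Suc.prems(4) by (simp add: vs(1))
  qed
qed simp

text \<open>Adjacent swaps move the first \<open>v\<close> through \<open>m\<close> until the equal
  arguments are neighbours.\<close>

lemma altmul_same_far:
  "altmul V (Suc (Suc (length m + length w))) F \<Longrightarrow> v \<in> V \<Longrightarrow> m \<in> lists V \<Longrightarrow> w \<in> lists V \<Longrightarrow> F (v # m @ v # w) = 0"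
proof (induction m arbitrary: F)
  case Nil
  then show ?case using altmul_same[of "length w"] by simp
next
  case (Cons u m)
  have "F (v # u # m @ v # w) = - F (u # v # m @ v # w)"
    by (rule altmul_swap[of "Suc (length m + length w)"]) (use Cons.prems in auto)
  also have "F (u # v # m @ v # w) = 0"
    by (rule Cons.IH[OF altmul_contract]) (use Cons.prems in auto)
  finally show ?case by simp
qed

lemma altmul_eq_zero:
  "altmul V k F \<Longrightarrow> vs \<in> lists V \<Longrightarrow> length vs = k \<Longrightarrow> i < j \<Longrightarrow> j < k \<Longrightarrow> vs ! i = vs ! j \<Longrightarrow> F vs = 0"
proof (induction k arbitrary: F vs i j)
  case (Suc k)
  from Suc.prems obtain u us where vs: "vs = u # us" "u \<in> V" "us \<in> lists V" "length us = k"
    by (cases vs) auto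
  obtain l where j: "j = Suc l" using Suc.prems by (cases j) auto
  then have l: "l < length us" using Suc.prems vs by simp
  show ?case
  proof (cases i)
    case 0
    then have "u = us ! l" using Suc.prems vs j by simp
    then have eq: "us = take l us @ u # drop (Suc l) us" using l by (simp add: id_take_nth_drop)
    have "F (u # take l us @ u # drop (Suc l) us) = 0"
    proof (rule altmul_same_far)
      show "altmul V (Suc (Suc (length (take l us) + length (drop (Suc l) us)))) F"
        using Suc.prems(1) l vs(4) by (cases k) (simp_all del: altmul.simps)
      show "take l us \<in> lists V" "drop (Suc l) us \<in> lists V"
        using vs(3) set_take_subset set_drop_subset by (fastforce simp: in_lists_conv_set)+
    qed (rule vs)
    then show ?thesis using eq vs(1) by simp
  next
    case (Suc i')
    then show ?thesis
      using Suc.IH[OF altmul_contract[OF Suc.prems(1) vs(2)] vs(3,4), of i' l] Suc.prems j vs(1) by simp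
  qed
qed simp

lemma altmul_intro:
  "(\<And>vs i. vs \<in> lists V \<Longrightarrow> length vs = k \<Longrightarrow> i < k \<Longrightarrow> linear_fun_on V (\<lambda>v. F (vs[i := v]))) \<Longrightarrow>
   (\<And>vs i j. vs \<in> lists V \<Longrightarrow> length vs = k \<Longrightarrow> i < j \<Longrightarrow> j < k \<Longrightarrow> vs ! i = vs ! j \<Longrightarrow> F vs = 0) \<Longrightarrow> altmul V k F"
proof (induction k arbitrary: F)
  case (Suc k)
  have "altmul V k (\<lambda>w. F (v # w))" if v: "v \<in> V" for v
  proof (rule Suc.IH)
    fix vs i assume "vs \<in> lists V" "length vs = k" "i < k"
    then show "linear_fun_on V (\<lambda>u. F (v # vs[i := u]))"
      using Suc.prems(1)[of "v # vs" "Suc i"] v by simp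
  next
    fix vs i j assume "vs \<in> lists V" "length vs = k" "i < j" "j < k" "vs ! i = vs ! j"
    then show "F (v # vs) = 0"
      using Suc.prems(2)[of "v # vs" "Suc i" "Suc j"] v by simp
  qed
  moreover have "linear_fun_on V (\<lambda>v. F (v # w))" if "w \<in> lists V" "length w = k" for w
    using Suc.prems(1)[of "0 # w" 0] that subspace_0[OF V] by simp
  moreover have "F (v # v # w) = 0" if "v \<in> V" "w \<in> lists V" "Suc (length w) = k" for v w
    using Suc.prems(2)[of "v # v # w" 0 1] that by simp
  ultimately show ?case by simp
qed simp

lemma altmul_cong:
  "altmul V k F \<Longrightarrow> (\<And>w. w \<in> lists V \<Longrightarrow> length w = k \<Longrightarrow> F w = G w) \<Longrightarrow> altmul V k G"
proof (induction k arbitrary: F G)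
  case (Suc k)
  have eq: "F (v # w) = G (v # w)" if "v \<in> V" "w \<in> lists V" "length w = k" for v w
    using that Suc.prems(2) by auto
  have "altmul V k (\<lambda>w. G (v # w))" if "v \<in> V" for v
    by (rule Suc.IH[OF altmul_contract[OF Suc.prems(1) that]]) (use that eq in auto)
  moreover have "linear_fun_on V (\<lambda>v. G (v # w))" if w: "w \<in> lists V" "length w = k" for w
    using altmul_linear[OF Suc.prems(1) w] eq w V
    by (simp add: linear_fun_on_def subspace_add subspace_scale)
  moreover have "G (v # v # w) = 0" if "v \<in> V" "w \<in> lists V" "Suc (length w) = k" for v w
    using Suc.prems(1) eq[of v "v # w"] that by auto
  ultimately show ?case by simp
qed auto

lemma altmul_add: "altmul V k F \<Longrightarrow> altmul V k G \<Longrightarrow> altmul V k (\<lambda>w. F w + G w)"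
  by (induction k arbitrary: F G) (auto simp: linear_fun_on_def algebra_simps)

lemma altmul_zero: "altmul V k (\<lambda>w. 0)"
  by (induction k) (auto simp: linear_fun_on_def)

end

section \<open>Differential forms\<close>

definition on_fields :: "'a form \<Rightarrow> 'a vfield list \<Rightarrow> 'a \<Rightarrow> real" where
  "on_fields \<omega> Zs = (\<lambda>x. \<omega> x (map (\<lambda>X. X x) Zs))"

lemma on_fields_Cons: "on_fields \<omega> (X # Zs) = on_fields (\<lambda>x vs. \<omega> x (X x # vs)) Zs"
  by (simp add: on_fields_def)

lemma omit_0 [simp]: "omit 0 (x # xs) = xs"
  and omit_Suc [simp]: "omit (Suc i) (x # xs) = x # omit i xs"
  by (simp_all add: omit_def)

lemma length_omit: "i < length xs \<Longrightarrow> length (omit i xs) = length xs - 1"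
  by (simp add: omit_def)

lemma omit_lists: "xs \<in> lists S \<Longrightarrow> omit i xs \<in> lists S"
  using set_take_subset set_drop_subset by (fastforce simp: omit_def in_lists_conv_set)

context manifold
begin

lemma tangent_lists_iff: "vs \<in> tangent_lists A k x \<longleftrightarrow> vs \<in> lists (T x) \<and> length vs = k"
  by (auto simp: tangent_lists_def)

lemma alternating_forms_iff:
  "\<eta> \<in> alternating_forms A k x \<longleftrightarrow> altmul (T x) k \<eta> \<and> (\<forall>vs. vs \<notin> tangent_lists A k x \<longrightarrow> \<eta> vs = 0)"
proof
  assume \<eta>: "\<eta> \<in> alternating_forms A k x"
  have "altmul (T x) k \<eta>"
    by (rule altmul_intro[OF subspace_tangent])
      (use \<eta> in \<open>auto simp: alternating_forms_def tangent_lists_iff\<close>)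
  with \<eta> show "altmul (T x) k \<eta> \<and> (\<forall>vs. vs \<notin> tangent_lists A k x \<longrightarrow> \<eta> vs = 0)"
    by (auto simp: alternating_forms_def)
next
  assume "altmul (T x) k \<eta> \<and> (\<forall>vs. vs \<notin> tangent_lists A k x \<longrightarrow> \<eta> vs = 0)"
  then show "\<eta> \<in> alternating_forms A k x"
    using altmul_linear_slot[OF subspace_tangent] altmul_eq_zero[OF subspace_tangent]
    by (auto simp: alternating_forms_def tangent_lists_iff)
qed

lemma forms_iff:
  "\<omega> \<in> forms A k \<longleftrightarrow> (\<forall>x. altmul (T x) k (\<omega> x)) \<and> (\<forall>x vs. vs \<notin> tangent_lists A k x \<longrightarrow> \<omega> x vs = 0) \<and>
     (\<forall>Zs\<in>lists VF. length Zs = k \<longrightarrow> on_fields \<omega> Zs \<in> C)"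
  by (auto simp: forms_def alternating_forms_iff on_fields_def)

lemma forms_altmul: "\<omega> \<in> forms A k \<Longrightarrow> altmul (T x) k (\<omega> x)"
  and forms_undef: "\<omega> \<in> forms A k \<Longrightarrow> vs \<notin> tangent_lists A k x \<Longrightarrow> \<omega> x vs = 0"
  and forms_smooth: "\<omega> \<in> forms A k \<Longrightarrow> Zs \<in> lists VF \<Longrightarrow> length Zs = k \<Longrightarrow> on_fields \<omega> Zs \<in> C"
  by (auto simp: forms_iff)

lemma forms_contract:
  assumes "\<omega> \<in> forms A (Suc k)" "X \<in> VF"
  shows "(\<lambda>x vs. \<omega> x (X x # vs)) \<in> forms A k"
  unfolding forms_iff
proof (intro conjI allI ballI impI)
  show "altmul (T x) k (\<lambda>vs. \<omega> x (X x # vs))" for x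
    using altmul_contract[OF subspace_tangent forms_altmul[OF assms(1)]] VF_T[OF assms(2)] .
  show "\<omega> x (X x # vs) = 0" if "vs \<notin> tangent_lists A k x" for x vs
    using forms_undef[OF assms(1), of "X x # vs"] that by (auto simp: tangent_lists_iff)
  show "on_fields (\<lambda>x vs. \<omega> x (X x # vs)) Zs \<in> C" if "Zs \<in> lists VF" "length Zs = k" for Zs
    using forms_smooth[OF assms(1), of "X # Zs"] that assms(2) by (simp add: on_fields_Cons)
qed

lemma map_VF_lists: "Zs \<in> lists VF \<Longrightarrow> map (\<lambda>X. X x) Zs \<in> lists (T x)"
  using VF_T by (auto simp: in_lists_conv_set)

lemma forms_fields_altmul: "\<omega> \<in> forms A k \<Longrightarrow> fields_altmul k (on_fields \<omega>)"
proof (induction k arbitrary: \<omega>)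
  case 0
  then show ?case using forms_smooth[of \<omega> 0 "[]"] by simp
next
  case (Suc k)
  note altmul = forms_altmul[OF Suc.prems]
  have c: "fields_altmul k (\<lambda>Zs. on_fields \<omega> (X # Zs))" if "X \<in> VF" for X
    unfolding on_fields_Cons by (rule Suc.IH[OF forms_contract[OF Suc.prems that]])
  have p: "on_fields \<omega> ((X + Y) # Zs) = (\<lambda>x. on_fields \<omega> (X # Zs) x + on_fields \<omega> (Y # Zs) x)"
    if "X \<in> VF" "Y \<in> VF" "Zs \<in> lists VF" "length Zs = k" for X Y Zs
  proof
    fix x
    have "linear_fun_on (T x) (\<lambda>v. \<omega> x (v # map (\<lambda>X. X x) Zs))"
      by (rule altmul_linear[OF subspace_tangent altmul]) (use that map_VF_lists in auto)
    from linear_fun_on_add[OF this VF_T[OF that(1)] VF_T[OF that(2)]]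
    show "on_fields \<omega> ((X + Y) # Zs) x = on_fields \<omega> (X # Zs) x + on_fields \<omega> (Y # Zs) x"
      by (simp add: on_fields_def plus_fun_def)
  qed
  have m: "on_fields \<omega> (scale_field f X # Zs) = (\<lambda>x. f x * on_fields \<omega> (X # Zs) x)"
    if "X \<in> VF" "Zs \<in> lists VF" "length Zs = k" for f X Zs
  proof
    fix x
    have "linear_fun_on (T x) (\<lambda>v. \<omega> x (v # map (\<lambda>X. X x) Zs))"
      by (rule altmul_linear[OF subspace_tangent altmul]) (use that map_VF_lists in auto)
    from linear_fun_on_scale[OF this VF_T[OF that(1)]]
    show "on_fields \<omega> (scale_field f X # Zs) x = f x * on_fields \<omega> (X # Zs) x"
      by (simp add: on_fields_def scale_field_def)
  qed
  have s: "on_fields \<omega> (X # X # Zs) = (\<lambda>x. 0)"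
    if "X \<in> VF" "Zs \<in> lists VF" "Suc (length Zs) = k" for X Zs
  proof
    fix x
    have "altmul (T x) (Suc (Suc (length Zs))) (\<omega> x)" using altmul[of x] that by (simp del: altmul.simps)
    from altmul_same[OF subspace_tangent this VF_T[OF that(1)] map_VF_lists[OF that(2)]]
    show "on_fields \<omega> (X # X # Zs) x = 0" by (simp add: on_fields_def)
  qed
  show ?case unfolding fields_altmul.simps by (intro conjI ballI impI c p m s; assumption)
qed

lemma VF_sum: "(\<And>i. i \<in> I \<Longrightarrow> X i \<in> VF) \<Longrightarrow> (\<Sum>i\<in>I. X i) \<in> VF"
  by (induction I rule: infinite_finite_induct) auto

section \<open>Local frames and tensoriality\<close>

definition is_frame :: "nat \<Rightarrow> 'a set \<Rightarrow> (nat \<Rightarrow> 'a \<Rightarrow> real) \<Rightarrow> (nat \<Rightarrow> 'a vfield) \<Rightarrow> bool" where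
  "is_frame n W f E \<longleftrightarrow> open W \<and> (\<forall>i<n. f i \<in> C \<and> E i \<in> VF) \<and>
    (\<forall>y\<in>W. \<forall>i<n. \<forall>j<n. E i y (f j) = (if i = j then 1 else 0)) \<and>
    (\<forall>y\<in>W. \<forall>v\<in>T y. v = (\<Sum>i<n. v (f i) *\<^sub>R E i y))"

text \<open>Frames of one common length exist at all points, so one number can be chosen globally;
  \<open>frame_basis_family\<close> shows that it is the dimension of every tangent space.\<close>

definition manifold_dim :: nat where
  "manifold_dim = (SOME n. \<forall>x. \<exists>W f E. x \<in> W \<and> is_frame n W f E)"

lemma frame_at:
  obtains W f E where "x \<in> W" "is_frame manifold_dim W f E"
proof -
  obtain n :: nat where n: "\<forall>x. \<exists>W f X. open W \<and> x \<in> W \<and> (\<forall>i<n. f i \<in> C \<and> X i \<in> VF) \<and>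
    (\<forall>y\<in>W. \<forall>i<n. \<forall>j<n. X i y (f j) = (if i = j then 1 else 0)) \<and>
    (\<forall>y\<in>W. \<forall>v\<in>T y. v = (\<Sum>i<n. v (f i) *\<^sub>R X i y))" by (rule local_frame)
  have "\<forall>x. \<exists>W f E. x \<in> W \<and> is_frame n W f E"
  proof
    fix x
    from spec[OF n, of x] show "\<exists>W f E. x \<in> W \<and> is_frame n W f E"
      unfolding is_frame_def by (elim exE conjE, intro exI conjI)
  qed
  then have "\<forall>x. \<exists>W f E. x \<in> W \<and> is_frame manifold_dim W f E"
    unfolding manifold_dim_def by (rule someI)
  from spec[OF this, of x] show ?thesis by (elim exE conjE) (rule that)
qed

lemma is_frameD:
  assumes "is_frame n W f E"
  shows frame_open: "open W" and frame_fun: "i < n \<Longrightarrow> f i \<in> C" and frame_VF: "i < n \<Longrightarrow> E i \<in> VF"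
    and frame_dual: "y \<in> W \<Longrightarrow> i < n \<Longrightarrow> j < n \<Longrightarrow> E i y (f j) = (if i = j then 1 else 0)"
    and frame_expand: "y \<in> W \<Longrightarrow> v \<in> T y \<Longrightarrow> v = (\<Sum>i<n. v (f i) *\<^sub>R E i y)"
  using assms unfolding is_frame_def by (elim conjE; simp; fail)+

lemma vector_extension:
  assumes v: "v \<in> T x"
  shows "\<exists>X\<in>VF. X x = v"
proof -
  obtain W f E where W: "x \<in> W" "is_frame manifold_dim W f E" by (rule frame_at)
  have "(\<Sum>i<manifold_dim. scale_field (\<lambda>y. v (f i)) (E i)) \<in> VF"
    by (intro VF_sum VF_scale_field smooth_funs_const frame_VF[OF W(2)]) simp
  moreover have "(\<Sum>i<manifold_dim. scale_field (\<lambda>y. v (f i)) (E i)) x = v"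
    using frame_expand[OF W(2,1) v] by (simp add: sum_fun_apply scale_field_def)
  ultimately show ?thesis by blast
qed

definition extension_field :: "'a \<Rightarrow> 'a tvec \<Rightarrow> 'a vfield" where
  "extension_field x v = (SOME X. X \<in> VF \<and> X x = v)"

lemma extension_field: assumes "v \<in> T x" shows extension_field_VF: "extension_field x v \<in> VF" and extension_field_at: "extension_field x v x = v"
proof -
  have "\<exists>X. X \<in> VF \<and> X x = v" using vector_extension[OF assms] by blast
  from someI_ex[OF this] show "extension_field x v \<in> VF" "extension_field x v x = v" by (auto simp: extension_field_def)
qed

lemma extension_field_lists: "vs \<in> lists (T x) \<Longrightarrow> map (extension_field x) vs \<in> lists VF"
  and extension_field_map: "vs \<in> lists (T x) \<Longrightarrow> map (\<lambda>X. X x) (map (extension_field x) vs) = vs"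
  by (induction vs) (auto simp: extension_field)

lemma forms_eqI:
  assumes "\<omega> \<in> forms A k" "\<eta> \<in> forms A k"
    and "\<And>Zs x. Zs \<in> lists VF \<Longrightarrow> length Zs = k \<Longrightarrow> on_fields \<omega> Zs x = on_fields \<eta> Zs x"
  shows "\<omega> = \<eta>"
proof (intro ext)
  fix x vs
  show "\<omega> x vs = \<eta> x vs"
  proof (cases "vs \<in> tangent_lists A k x")
    case True
    then have vs: "vs \<in> lists (T x)" "length vs = k" by (auto simp: tangent_lists_iff)
    show ?thesis
      using assms(3)[OF extension_field_lists[OF vs(1)], of x] extension_field_map[OF vs(1)] vs(2) by (simp add: on_fields_def)
  next
    case False
    then show ?thesis using forms_undef assms by metis
  qed
qed

lemma fields_altmul_sum:
  assumes "fields_altmul (Suc k) F" "finite I" "\<And>i. i \<in> I \<Longrightarrow> X i \<in> VF" "Zs \<in> lists VF" "length Zs = k"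
  shows "F ((\<Sum>i\<in>I. X i) # Zs) x = (\<Sum>i\<in>I. F (X i # Zs) x)"
  using assms(2,3)
proof (induction I)
  case empty
  then show ?case using fields_altmul_zero[OF assms(1,4,5)] by (simp add: zero_fun_def)
next
  case (insert i I)
  have "F ((X i + (\<Sum>i\<in>I. X i)) # Zs) x = F (X i # Zs) x + F ((\<Sum>i\<in>I. X i) # Zs) x"
    by (rule fields_altmul_plus[OF assms(1)]) (use insert.prems assms(4,5) VF_sum[of I X] in auto)
  also have "F ((\<Sum>i\<in>I. X i) # Zs) x = (\<Sum>i\<in>I. F (X i # Zs) x)"
    using insert by blast
  finally show ?case by (simp only: sum.insert[OF insert.hyps])
qed

text \<open>The frame expansion of \<open>X\<close>, multiplied by a bump function, holds on the
  whole manifold and has the global coefficients \<open>X y (f i)\<close>. Linearity over smooth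
  functions pulls them out, and they vanish at \<open>x\<close>.\<close>

lemma fields_altmul_tensorial:
  assumes F: "fields_altmul (Suc k) F" and X: "X \<in> VF" "X x = 0" and Zs: "Zs \<in> lists VF" "length Zs = k"
  shows "F (X # Zs) x = 0"
proof -
  obtain W f E where Wx: "x \<in> W" and fr: "is_frame manifold_dim W f E" by (rule frame_at)
  note frd = frame_fun[OF fr] frame_VF[OF fr]
  obtain \<rho> K where \<rho>: "\<rho> \<in> C" "\<forall>\<^sub>F y in nhds x. \<rho> y = 1" "closed K" "K \<subseteq> W"
    "\<forall>y. y \<notin> K \<longrightarrow> \<rho> y = 0" by (rule bump[OF frame_open[OF fr] Wx])
  have \<rho>x: "\<rho> x = 1" using eventually_nhds_x_imp_x[OF \<rho>(2)] .
  let ?Y = "\<lambda>i. scale_field (\<lambda>y. X y (f i)) (scale_field \<rho> (E i))"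
  have Y: "?Y i \<in> VF" "scale_field \<rho> (E i) \<in> VF" "(\<lambda>y. X y (f i)) \<in> C" if "i < manifold_dim" for i
    using that frd \<rho> X by (auto simp: VF_C)
  have "scale_field \<rho> X = (\<Sum>i<manifold_dim. ?Y i)"
  proof
    fix y
    show "scale_field \<rho> X y = (\<Sum>i<manifold_dim. ?Y i) y"
    proof (cases "y \<in> K")
      case True
      then have "y \<in> W" using \<rho>(4) by blast
      from arg_cong[OF frame_expand[OF fr this VF_T[OF X(1)]], of "\<lambda>v. \<rho> y *\<^sub>R v"]
      show ?thesis by (simp add: sum_fun_apply scale_field_def scaleR_sum_right mult.commute)
    next
      case False
      then show ?thesis using \<rho>(5) by (simp add: sum_fun_apply scale_field_def)
    qed
  qed
  then have "F (scale_field \<rho> X # Zs) x = (\<Sum>i<manifold_dim. F (?Y i # Zs) x)"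
    using fields_altmul_sum[OF F, of "{..<manifold_dim}" ?Y Zs x] Y Zs by simp
  also have "\<dots> = (\<Sum>i<manifold_dim. X x (f i) * F (scale_field \<rho> (E i) # Zs) x)"
    by (intro sum.cong refl fields_altmul_scale_field[OF F]) (use Y Zs in auto)
  also have "\<dots> = 0" using X(2) by (simp add: zero_fun_def)
  finally show ?thesis using fields_altmul_scale_field[OF F \<rho>(1) X(1) Zs] \<rho>x by simp
qed

text \<open>The arguments are exchanged one at a time; the difference of old and new field vanishes
  at \<open>x\<close>.\<close>

lemma fields_altmul_values:
  "fields_altmul k F \<Longrightarrow> Xs \<in> lists VF \<Longrightarrow> Ys \<in> lists VF \<Longrightarrow> length Xs = k \<Longrightarrow>
    map (\<lambda>X. X x) Xs = map (\<lambda>X. X x) Ys \<Longrightarrow> F Xs x = F Ys x"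
proof (induction k arbitrary: F Xs Ys)
  case 0
  then show ?case by simp
next
  case (Suc k)
  from Suc.prems obtain X Xs' Y Ys' where eq: "Xs = X # Xs'" "Ys = Y # Ys'" "X x = Y x"
    "X \<in> VF" "Y \<in> VF" "Xs' \<in> lists VF" "Ys' \<in> lists VF" "length Xs' = k" "map (\<lambda>X. X x) Xs' = map (\<lambda>X. X x) Ys'"
    by (cases Xs; cases Ys) auto
  have "(X - Y) x = 0" using eq(3) by simp
  then have "F ((X - Y) # Xs') x = 0"
    using fields_altmul_tensorial[OF Suc.prems(1), of "X - Y"] eq by simp
  then have "F (X # Xs') x = F (Y # Xs') x"
    using fields_altmul_plus[OF Suc.prems(1), of "X - Y" Y Xs' x] eq by simp
  also have "\<dots> = F (Y # Ys') x"
    by (rule Suc.IH[OF fields_altmul_contract[OF Suc.prems(1)]]) (use eq in auto)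
  finally show ?case by (simp add: eq)
qed

lemma fields_altmul_pointwise: "fields_altmul k F \<Longrightarrow> altmul (T x) k (\<lambda>vs. F (map (extension_field x) vs) x)"
proof (induction k arbitrary: F)
  case (Suc k)
  note F = Suc.prems
  have "altmul (T x) k (\<lambda>w. F (extension_field x v # map (extension_field x) w) x)" if "v \<in> T x" for v
    by (rule Suc.IH[OF fields_altmul_contract[OF F extension_field_VF[OF that]]])
  moreover have "linear_fun_on (T x) (\<lambda>v. F (extension_field x v # map (extension_field x) w) x)"
    if w: "w \<in> lists (T x)" "length w = k" for w
    unfolding linear_fun_on_def
  proof (intro ballI allI)
    fix u v a b assume uv: "u \<in> T x" "v \<in> T x"
    let ?a = "scale_field (\<lambda>_. a) (extension_field x u)" and ?b = "scale_field (\<lambda>_. b) (extension_field x v)" and ?w = "map (extension_field x) w"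
    have ab: "?a \<in> VF" "?b \<in> VF" using uv by (auto simp: extension_field smooth_funs_const)
    have T: "a *\<^sub>R u + b *\<^sub>R v \<in> T x"
      using uv by (intro subspace_add subspace_scale subspace_tangent)
    have "F (extension_field x (a *\<^sub>R u + b *\<^sub>R v) # ?w) x = F ((?a + ?b) # ?w) x"
      by (rule fields_altmul_values[OF F])
        (use w uv T ab extension_field_lists[OF w(1)] in \<open>auto simp: extension_field scale_field_def\<close>)
    also have "\<dots> = F (?a # ?w) x + F (?b # ?w) x"
      by (rule fields_altmul_plus[OF F ab extension_field_lists[OF w(1)]]) (simp add: w)
    also have "\<dots> = a * F (extension_field x u # ?w) x + b * F (extension_field x v # ?w) x"
      using fields_altmul_scale_field[OF F smooth_funs_const extension_field_VF extension_field_lists[OF w(1)]] uv w(2) by simp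
    finally show "F (extension_field x (a *\<^sub>R u + b *\<^sub>R v) # ?w) x = a * F (extension_field x u # ?w) x + b * F (extension_field x v # ?w) x" .
  qed
  moreover have "F (extension_field x v # extension_field x v # map (extension_field x) w) x = 0"
    if "v \<in> T x" "w \<in> lists (T x)" "Suc (length w) = k" for v w
    using fields_altmul_same[OF F extension_field_VF[OF that(1)] extension_field_lists[OF that(2)]] that(3) by simp
  ultimately show ?case by simp
qed simp

text \<open>By tensoriality the value at \<open>x\<close> does not depend on how tangent vectors are
  extended to fields. This provides the existence half behind the definite description in
  \<open>de_rham\<close>.\<close>

lemma fields_altmul_form:
  assumes F: "fields_altmul k F"
  shows "\<exists>\<eta>\<in>forms A k. \<forall>Zs\<in>lists VF. length Zs = k \<longrightarrow> on_fields \<eta> Zs = F Zs"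
proof -
  define \<eta> where "\<eta> x vs = (if vs \<in> tangent_lists A k x then F (map (extension_field x) vs) x else 0)" for x vs
  have on_fields: "on_fields \<eta> Zs = F Zs" if Zs: "Zs \<in> lists VF" "length Zs = k" for Zs
  proof
    fix x
    have "F (map (extension_field x) (map (\<lambda>X. X x) Zs)) x = F Zs x"
      by (rule fields_altmul_values[OF F extension_field_lists[OF map_VF_lists[OF Zs(1)]] Zs(1)])
        (use Zs extension_field_map[OF map_VF_lists[OF Zs(1)]] in auto)
    then show "on_fields \<eta> Zs x = F Zs x"
      using map_VF_lists[OF Zs(1)] Zs(2) by (simp add: on_fields_def \<eta>_def tangent_lists_iff)
  qed
  have "altmul (T x) k (\<eta> x)" for x
    by (rule altmul_cong[OF subspace_tangent fields_altmul_pointwise[OF F]]) (simp add: \<eta>_def tangent_lists_iff)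
  then have "\<eta> \<in> forms A k"
    using on_fields fields_altmul_val[OF F] by (auto simp: forms_iff \<eta>_def)
  with on_fields show ?thesis by blast
qed

text \<open>The recursion leaves each bracket in the place of the field it acts on; moving it to the
  front past \<open>j\<close> fields gives the sign \<open>(- 1) ^ j\<close>, one swap in each
  induction step.\<close>

lemma lie_der_expand:
  "X \<in> VF \<Longrightarrow> Zs \<in> lists VF \<Longrightarrow> fields_altmul (length Zs) F \<Longrightarrow>
    lie_der A X Zs F x = X x (F Zs) - (\<Sum>j<length Zs. (- 1) ^ j * F (br X (Zs ! j) # omit j Zs) x)"
proof (induction Zs arbitrary: F)
  case Nil
  then show ?case by simp
next
  case (Cons Z Zs)
  have Z: "Z \<in> VF" "Zs \<in> lists VF" and F: "fields_altmul (Suc (length Zs)) F" using Cons.prems by auto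
  have sw: "F (Z # br X (Zs ! j) # omit j Zs) x = - F (br X (Zs ! j) # Z # omit j Zs) x" if j: "j < length Zs" for j
  proof -
    from j obtain m where m: "length Zs = Suc m" by (cases "length Zs") auto
    show ?thesis
      by (rule fields_altmul_swap[OF F[unfolded m]])
        (use Z j Cons.prems(1) m omit_lists[OF Z(2)] in \<open>auto simp: length_omit in_lists_conv_set\<close>)
  qed
  have "lie_der A X Zs (\<lambda>Ws. F (Z # Ws)) x =
      X x (F (Z # Zs)) - (\<Sum>j<length Zs. (- 1) ^ j * F (Z # br X (Zs ! j) # omit j Zs) x)"
    using Cons.IH[OF Cons.prems(1) Z(2) fields_altmul_contract[OF F Z(1)]] .
  also have "(\<Sum>j<length Zs. (- 1) ^ j * F (Z # br X (Zs ! j) # omit j Zs) x) =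
      (\<Sum>j<length Zs. (- 1) ^ j * - F (br X (Zs ! j) # Z # omit j Zs) x)"
    by (intro sum.cong refl) (simp add: sw)
  finally show ?case by (simp add: sum.lessThan_Suc_shift sum_negf del: sum.lessThan_Suc)
qed

text \<open>The terms of both Koszul sums that involve the field with index 0 as derivation or in
  the bracket form the Lie derivative along it; the remaining ones form, with opposite sign, the
  Koszul expression of the contracted form. This is Cartan's recursion.\<close>

lemma koszul_ext_der:
  "\<omega> \<in> forms A k \<Longrightarrow> Xs \<in> lists VF \<Longrightarrow> length Xs = Suc k \<Longrightarrow> koszul A k \<omega> Xs x = ext_der A Xs (on_fields \<omega>) x"
proof (induction k arbitrary: \<omega> Xs)
  case 0
  then obtain X where "Xs = [X]" by (auto simp: length_Suc_conv)
  then show ?case by (simp add: koszul_def on_fields_def)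
next
  case (Suc k)
  from Suc.prems obtain X Ys where Xs: "Xs = X # Ys" "X \<in> VF" "Ys \<in> lists VF" "length Ys = Suc k"
    by (cases Xs) auto
  let ?\<eta> = "\<lambda>x vs. \<omega> x (X x # vs)"
  have \<eta>: "?\<eta> \<in> forms A k" by (rule forms_contract[OF Suc.prems(1) Xs(2)])
  have fields_altmul: "fields_altmul (Suc k) (on_fields \<omega>)" by (rule forms_fields_altmul[OF Suc.prems(1)])
  define g where "g Xs i j = (- 1) ^ (i + j) * on_fields \<omega> (br (Xs ! i) (Xs ! j) # omit i (omit j Xs)) x" for Xs i j
  have g0: "g (X # Ys) 0 (Suc j) = - ((- 1) ^ j * on_fields \<omega> (br X (Ys ! j) # omit j Ys) x)" for j
    by (simp add: g_def)
  \<comment> \<open>Passing from \<open>i, j\<close> to their successors does not change the parity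
    of the exponent; the minus sign comes from exchanging the bracket with \<open>X\<close>.\<close>
  have gS: "g (X # Ys) (Suc i) (Suc j) =
      - ((- 1) ^ (i + j) * on_fields ?\<eta> (br (Ys ! i) (Ys ! j) # omit i (omit j Ys)) x)" if ij: "i < j" "j \<le> k" for i j
  proof -
    have k: "k = Suc (k - 1)" using ij by simp
    have len: "length (omit i (omit j Ys)) = k - 1" using ij Xs(4) by (simp add: length_omit)
    have "on_fields \<omega> (br (Ys ! i) (Ys ! j) # X # omit i (omit j Ys)) x = - on_fields \<omega> (X # br (Ys ! i) (Ys ! j) # omit i (omit j Ys)) x"
      by (rule fields_altmul_swap[of "k - 1"])
        (use fields_altmul k Xs ij len omit_lists[OF omit_lists[OF Xs(3)]] in \<open>auto simp: in_lists_conv_set simp del: fields_altmul.simps\<close>)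
    then show ?thesis by (simp add: g_def on_fields_Cons)
  qed
  have "koszul A (Suc k) \<omega> Xs x =
      (\<Sum>i\<le>Suc k. (-1) ^ i * (Xs ! i) x (on_fields \<omega> (omit i Xs))) + (\<Sum>j\<le>Suc k. \<Sum>i<j. g Xs i j)"
    by (simp add: koszul_def on_fields_def g_def)
  also have "(\<Sum>i\<le>Suc k. (-1) ^ i * (Xs ! i) x (on_fields \<omega> (omit i Xs))) =
      X x (on_fields \<omega> Ys) - (\<Sum>i\<le>k. (-1) ^ i * (Ys ! i) x (on_fields ?\<eta> (omit i Ys)))"
    unfolding Xs(1) by (subst sum.atMost_Suc_shift) (simp add: on_fields_Cons sum_negf)
  also have "(\<Sum>j\<le>Suc k. \<Sum>i<j. g Xs i j) = (\<Sum>j\<le>k. g Xs 0 (Suc j) + (\<Sum>i<j. g Xs (Suc i) (Suc j)))"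
    by (subst sum.atMost_Suc_shift) (simp add: sum.lessThan_Suc_shift del: sum.lessThan_Suc)
  also have "\<dots> = (\<Sum>j\<le>k. - ((- 1) ^ j * on_fields \<omega> (br X (Ys ! j) # omit j Ys) x) +
      (\<Sum>i<j. - ((- 1) ^ (i + j) * on_fields ?\<eta> (br (Ys ! i) (Ys ! j) # omit i (omit j Ys)) x)))"
    unfolding Xs(1) by (intro sum.cong refl arg_cong2[where f = "(+)"]) (auto simp: g0 gS)
  also have "\<dots> = - (\<Sum>j\<le>k. (- 1) ^ j * on_fields \<omega> (br X (Ys ! j) # omit j Ys) x) -
      (\<Sum>j\<le>k. \<Sum>i<j. (- 1) ^ (i + j) * on_fields ?\<eta> (br (Ys ! i) (Ys ! j) # omit i (omit j Ys)) x)"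
    by (simp only: sum.distrib sum_negf)
  finally have "koszul A (Suc k) \<omega> Xs x =
      (X x (on_fields \<omega> Ys) - (\<Sum>j\<le>k. (- 1) ^ j * on_fields \<omega> (br X (Ys ! j) # omit j Ys) x)) - koszul A k ?\<eta> Ys x"
    by (simp add: koszul_def on_fields_def)
  also have "koszul A k ?\<eta> Ys x = ext_der A Ys (on_fields ?\<eta>) x" by (rule Suc.IH[OF \<eta> Xs(3,4)])
  also have "X x (on_fields \<omega> Ys) - (\<Sum>j\<le>k. (- 1) ^ j * on_fields \<omega> (br X (Ys ! j) # omit j Ys) x) = lie_der A X Ys (on_fields \<omega>) x"
    using lie_der_expand[OF Xs(2,3), of "on_fields \<omega>" x] fields_altmul Xs(4)
    by (simp add: lessThan_Suc_atMost del: fields_altmul.simps)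
  finally show ?case by (simp add: Xs(1) on_fields_Cons)
qed

text \<open>Existence comes from the tensoriality of \<open>ext_der\<close>. Uniqueness holds
  because every list of tangent vectors is the value of a list of global fields, so the values on
  fields determine a form.\<close>

lemma de_rham:
  assumes \<omega>: "\<omega> \<in> forms A k"
  shows de_rham_forms: "de_rham A k \<omega> \<in> forms A (Suc k)"
    and de_rham_on_fields: "\<And>Zs. Zs \<in> lists VF \<Longrightarrow> length Zs = Suc k \<Longrightarrow> on_fields (de_rham A k \<omega>) Zs = ext_der A Zs (on_fields \<omega>)"
proof -
  let ?P = "\<lambda>\<eta>. \<eta> \<in> forms A (Suc k) \<and> (\<forall>Xs. length Xs = Suc k \<and> set Xs \<subseteq> VF \<longrightarrow>
        (\<forall>x. \<eta> x (map (\<lambda>X. X x) Xs) = koszul A k \<omega> Xs x))"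
  have P: "?P \<eta> \<longleftrightarrow> \<eta> \<in> forms A (Suc k) \<and> (\<forall>Zs\<in>lists VF. length Zs = Suc k \<longrightarrow> on_fields \<eta> Zs = ext_der A Zs (on_fields \<omega>))" for \<eta>
  proof -
    have "(\<forall>x. \<eta> x (map (\<lambda>X. X x) Zs) = koszul A k \<omega> Zs x) \<longleftrightarrow> on_fields \<eta> Zs = ext_der A Zs (on_fields \<omega>)"
      if "length Zs = Suc k" "set Zs \<subseteq> VF" for Zs
      using koszul_ext_der[OF \<omega>, of Zs] that by (auto simp: on_fields_def fun_eq_iff in_lists_conv_set subset_iff)
    then show ?thesis by (auto simp: in_lists_conv_set subset_iff)
  qed
  obtain \<eta> where \<eta>: "\<eta> \<in> forms A (Suc k)" "\<forall>Zs\<in>lists VF. length Zs = Suc k \<longrightarrow> on_fields \<eta> Zs = ext_der A Zs (on_fields \<omega>)"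
    using fields_altmul_form[OF ext_der_fields_altmul[OF forms_fields_altmul[OF \<omega>]]] by blast
  have "?P (de_rham A k \<omega>)"
    unfolding de_rham_def
  proof (rule theI[of ?P \<eta>])
    show "?P \<eta>" using \<eta> P by blast
    fix \<theta> assume "?P \<theta>"
    then have "\<theta> \<in> forms A (Suc k)" "\<forall>Zs\<in>lists VF. length Zs = Suc k \<longrightarrow> on_fields \<theta> Zs = ext_der A Zs (on_fields \<omega>)"
      using P by blast+
    then show "\<theta> = \<eta>" using \<eta> by (intro forms_eqI[of \<theta> "Suc k" \<eta>]) auto
  qed
  then have "de_rham A k \<omega> \<in> forms A (Suc k) \<and>
      (\<forall>Zs\<in>lists VF. length Zs = Suc k \<longrightarrow> on_fields (de_rham A k \<omega>) Zs = ext_der A Zs (on_fields \<omega>))"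
    using P by blast
  then show "de_rham A k \<omega> \<in> forms A (Suc k)"
    "\<And>Zs. Zs \<in> lists VF \<Longrightarrow> length Zs = Suc k \<Longrightarrow> on_fields (de_rham A k \<omega>) Zs = ext_der A Zs (on_fields \<omega>)"
    by blast+
qed

end

section \<open>Bases indexed by numbers and inverse matrices\<close>

text \<open>Matrices are given by their entries as functions of two indices, so that the entries may
  in turn depend on a point of the manifold.\<close>

definition mdet :: "nat \<Rightarrow> (nat \<Rightarrow> nat \<Rightarrow> real) \<Rightarrow> real" where
  "mdet m a = Determinant.det (Matrix.mat m m (\<lambda>(i, j). a i j))"

definition madj :: "nat \<Rightarrow> (nat \<Rightarrow> nat \<Rightarrow> real) \<Rightarrow> nat \<Rightarrow> nat \<Rightarrow> real" where
  "madj m a i j = adj_mat (Matrix.mat m m (\<lambda>(i, j). a i j)) $$ (i, j)"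

lemma mdet_expand: "mdet m a = (\<Sum>p | p permutes {0..<m}. of_int (sign p) * (\<Prod>i<m. a i (p i)))"
proof -
  have "(\<Prod>i = 0..<m. Matrix.mat m m (\<lambda>(i, j). a i j) $$ (i, p i)) = (\<Prod>i<m. a i (p i))"
    if "p permutes {0..<m}" for p
    using that permutes_in_image[OF that] by (auto simp: atLeast0LessThan intro!: prod.cong)
  then show ?thesis by (simp add: mdet_def Determinant.det_def)
qed

text \<open>Combined with \<open>mdet_expand\<close> this exhibits the entries of the adjugate as
  polynomials in the entries of \<open>a\<close>, whence their smoothness.\<close>

lemma madj_expand:
  assumes "i < m" "j < m"
  shows "madj m a i j = (- 1) ^ (j + i) *
    mdet (m - 1) (\<lambda>i' j'. a (if i' < j then i' else Suc i') (if j' < i then j' else Suc j'))"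
proof -
  have "mat_delete (Matrix.mat m m (\<lambda>(i, j). a i j)) j i =
    Matrix.mat (m - 1) (m - 1) (\<lambda>(i', j'). a (if i' < j then i' else Suc i') (if j' < i then j' else Suc j'))"
    by (rule eq_matI) (auto simp: mat_delete_def)
  then show ?thesis using assms by (simp add: madj_def adj_mat_def cofactor_def mdet_def)
qed

lemma madj_mult:
  assumes "i < m" "j < m"
  shows "(\<Sum>k<m. a i k * madj m a k j) = (if i = j then mdet m a else 0)"
    and "(\<Sum>k<m. madj m a i k * a k j) = (if i = j then mdet m a else 0)"
proof -
  let ?A = "Matrix.mat m m (\<lambda>(i, j). a i j)"
  have A: "?A \<in> carrier_mat m m" by simp
  note adj = adj_mat[OF A]
  have "(\<Sum>k<m. a i k * madj m a k j) = (?A * adj_mat ?A) $$ (i, j)"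
    using assms adj(1) by (simp add: scalar_prod_def madj_def atLeast0LessThan)
  then show "(\<Sum>k<m. a i k * madj m a k j) = (if i = j then mdet m a else 0)"
    using assms by (simp add: adj(2) mdet_def)
  have "(\<Sum>k<m. madj m a i k * a k j) = (adj_mat ?A * ?A) $$ (i, j)"
    using assms adj(1) by (simp add: scalar_prod_def madj_def atLeast0LessThan)
  then show "(\<Sum>k<m. madj m a i k * a k j) = (if i = j then mdet m a else 0)"
    using assms by (simp add: adj(3) mdet_def)
qed

text \<open>The hypothesis says that the rows are linearly independent, that is, that the transposed
  matrix has trivial kernel.\<close>

lemma mdet_nonzero:
  assumes "\<And>c i. (\<And>j. j < m \<Longrightarrow> (\<Sum>i<m. c i * a i j) = 0) \<Longrightarrow> i < m \<Longrightarrow> c i = (0::real)"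
  shows "mdet m a \<noteq> 0"
proof
  let ?A = "Matrix.mat m m (\<lambda>(i, j). a i j)"
  assume "mdet m a = 0"
  then have "Determinant.det (Matrix.transpose_mat ?A) = 0" by (simp add: mdet_def Determinant.det_transpose[of _ m])
  then obtain v where v: "v \<in> carrier_vec m" "v \<noteq> 0\<^sub>v m" "Matrix.transpose_mat ?A *\<^sub>v v = 0\<^sub>v m"
    using det_0_iff_vec_prod_zero[of "Matrix.transpose_mat ?A" m] by auto
  have "(\<Sum>i<m. vec_index v i * a i j) = 0" if "j < m" for j
  proof -
    have "vec_index (Matrix.transpose_mat ?A *\<^sub>v v) j = 0" using v(3) that by simp
    then show ?thesis using that v(1) by (simp add: scalar_prod_def atLeast0LessThan mult.commute)
  qed
  then have "vec_index v i = 0" if "i < m" for i using assms[of "\<lambda>i. vec_index v i"] that by blast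
  then have "v = 0\<^sub>v m" using v(1) by (intro eq_vecI) auto
  with v(2) show False by simp
qed

context manifold
begin

lemma smooth_at_mdet:
  assumes "\<And>i j. i < m \<Longrightarrow> j < m \<Longrightarrow> smooth_at x (\<lambda>y. a y i j)"
  shows "smooth_at x (\<lambda>y. mdet m (a y))"
  unfolding mdet_expand
proof (intro smooth_at_sum smooth_at_mult smooth_at_const smooth_at_prod)
  fix p i assume "p \<in> {p. p permutes {0..<m}}" "i \<in> {..<m}"
  then show "smooth_at x (\<lambda>y. a y i (p i))"
    using permutes_in_image[of p "{0..<m}" i] by (intro assms) auto
qed

lemma smooth_at_madj:
  assumes "\<And>i j. i < m \<Longrightarrow> j < m \<Longrightarrow> smooth_at x (\<lambda>y. a y i j)" "i < m" "j < m"
  shows "smooth_at x (\<lambda>y. madj m (a y) i j)"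
  unfolding madj_expand[OF assms(2,3)]
  by (intro smooth_at_mult smooth_at_const smooth_at_mdet assms(1)) auto

text \<open>Cramer's rule: the inverse is the adjugate over the determinant. Invertibility is
  assumed at \<open>x\<close> only and spreads to a neighbourhood because the determinant is
  continuous.\<close>

lemma smooth_matrix_inverse:
  fixes m :: nat
  assumes "\<And>i j. i < m \<Longrightarrow> j < m \<Longrightarrow> smooth_at x (\<lambda>y. a y i j)"
    and "\<forall>c. (\<forall>j<m. (\<Sum>i<m. c i * a x i j) = 0) \<longrightarrow> (\<forall>i<m. c i = (0::real))"
  obtains b where "\<forall>i<m. \<forall>j<m. smooth_at x (\<lambda>y. b y i j)"
    "\<forall>\<^sub>F y in nhds x. \<forall>i<m. \<forall>j<m. (\<Sum>k<m. a y i k * b y k j) = (if i = j then 1 else 0) \<and>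
      (\<Sum>k<m. b y i k * a y k j) = (if i = j then 1 else (0::real))"
proof (rule that)
  let ?b = "\<lambda>y i j. inverse (mdet m (a y)) * madj m (a y) i j"
  have nz: "mdet m (a x) \<noteq> 0" by (rule mdet_nonzero) (use assms(2) in blast)
  have sm: "smooth_at x (\<lambda>y. mdet m (a y))" by (rule smooth_at_mdet) (rule assms(1))
  show "\<forall>i<m. \<forall>j<m. smooth_at x (\<lambda>y. ?b y i j)"
    by (intro allI impI smooth_at_mult smooth_at_inverse sm nz smooth_at_madj assms(1))
  show "\<forall>\<^sub>F y in nhds x. \<forall>i<m. \<forall>j<m. (\<Sum>k<m. a y i k * ?b y k j) = (if i = j then 1 else 0) \<and>
      (\<Sum>k<m. ?b y i k * a y k j) = (if i = j then 1 else (0::real))"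
    using smooth_at_nonzero[OF sm nz]
  proof eventually_elim
    case (elim y)
    have "(\<Sum>k<m. a y i k * ?b y k j) = inverse (mdet m (a y)) * (\<Sum>k<m. a y i k * madj m (a y) k j)"
      "(\<Sum>k<m. ?b y i k * a y k j) = inverse (mdet m (a y)) * (\<Sum>k<m. madj m (a y) i k * a y k j)" for i j
      by (simp_all add: sum_distrib_left mult_ac)
    with elim show ?case by (simp add: madj_mult)
  qed
qed

end

text \<open>Bases as numbered families rather than sets fit matrices and frames, whose members are
  indexed sections; \<open>basis_family_iff\<close> links them to \<open>span\<close> and
  \<open>independent\<close>.\<close>

definition basis_family :: "'v::real_vector set \<Rightarrow> nat \<Rightarrow> (nat \<Rightarrow> 'v) \<Rightarrow> bool" where
  "basis_family V k s \<longleftrightarrow> (\<forall>i<k. s i \<in> V) \<and> (\<forall>v\<in>V. \<exists>c. v = (\<Sum>i<k. c i *\<^sub>R s i)) \<and>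
     (\<forall>c. (\<Sum>i<k. c i *\<^sub>R s i) = 0 \<longrightarrow> (\<forall>i<k. c i = 0))"

lemma span_family:
  fixes k :: nat
  shows "span (s ` {..<k}) = {\<Sum>i<k. c i *\<^sub>R s i | c. True}"
proof (rule antisym)
  have "subspace {\<Sum>i<k. c i *\<^sub>R s i | c. True}"
    unfolding subspace_def
  proof (intro conjI ballI allI)
    show "0 \<in> {\<Sum>i<k. c i *\<^sub>R s i | c. True}" by (auto intro!: exI[of _ "\<lambda>_. 0"])
    fix u v assume "u \<in> {\<Sum>i<k. c i *\<^sub>R s i | c. True}" "v \<in> {\<Sum>i<k. c i *\<^sub>R s i | c. True}"
    then obtain c d where "u = (\<Sum>i<k. c i *\<^sub>R s i)" "v = (\<Sum>i<k. d i *\<^sub>R s i)" by blast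
    then have "u + v = (\<Sum>i<k. (c i + d i) *\<^sub>R s i)" by (simp only: scaleR_add_left sum.distrib)
    then show "u + v \<in> {\<Sum>i<k. c i *\<^sub>R s i | c. True}"
      by (intro CollectI exI[of _ "\<lambda>i. c i + d i"]) simp
  next
    fix a v assume "v \<in> {\<Sum>i<k. c i *\<^sub>R s i | c. True}"
    then obtain c where "v = (\<Sum>i<k. c i *\<^sub>R s i)" by blast
    then have "a *\<^sub>R v = (\<Sum>i<k. (a * c i) *\<^sub>R s i)" by (simp only: scaleR_sum_right scaleR_scaleR)
    then show "a *\<^sub>R v \<in> {\<Sum>i<k. c i *\<^sub>R s i | c. True}"
      by (intro CollectI exI[of _ "\<lambda>i. a * c i"]) simp
  qed
  moreover have "s ` {..<k} \<subseteq> {\<Sum>i<k. c i *\<^sub>R s i | c. True}"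
  proof
    fix v assume "v \<in> s ` {..<k}"
    then obtain j where j: "j < k" "v = s j" by auto
    have "(\<Sum>i<k. (if i = j then 1 else 0) *\<^sub>R s i) = (\<Sum>i<k. if i = j then s i else 0)"
      by (rule sum.cong) auto
    then have "v = (\<Sum>i<k. (if i = j then 1 else 0) *\<^sub>R s i)" using j by simp
    then show "v \<in> {\<Sum>i<k. c i *\<^sub>R s i | c. True}"
      by (intro CollectI exI[of _ "\<lambda>i. if i = j then 1 else 0"]) simp
  qed
  ultimately show "span (s ` {..<k}) \<subseteq> {\<Sum>i<k. c i *\<^sub>R s i | c. True}" by (rule span_minimal[rotated])
next
  show "{\<Sum>i<k. c i *\<^sub>R s i | c. True} \<subseteq> span (s ` {..<k})"
  proof
    fix v assume "v \<in> {\<Sum>i<k. c i *\<^sub>R s i | c. True}"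
    then obtain c where "v = (\<Sum>i<k. c i *\<^sub>R s i)" by blast
    then show "v \<in> span (s ` {..<k})" by (simp only:) (intro span_sum span_scale span_base imageI)
  qed
qed

lemma independent_family:
  fixes k :: nat
  shows "inj_on s {..<k} \<and> independent (s ` {..<k}) \<longleftrightarrow> (\<forall>c. (\<Sum>i<k. c i *\<^sub>R s i) = 0 \<longrightarrow> (\<forall>i<k. c i = 0))"
proof safe
  fix c i assume inj: "inj_on s {..<k}" and ind: "independent (s ` {..<k})"
    and 0: "(\<Sum>i<k. c i *\<^sub>R s i) = 0" and i: "i < k"
  have "(\<Sum>v\<in>s ` {..<k}. c (the_inv_into {..<k} s v) *\<^sub>R v) = (\<Sum>i<k. c i *\<^sub>R s i)"
    using inj by (simp add: sum.reindex the_inv_into_f_f)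
  then have "c (the_inv_into {..<k} s (s i)) = 0"
    using independentD[OF ind, of "s ` {..<k}" "\<lambda>v. c (the_inv_into {..<k} s v)" "s i"] 0 i by simp
  then show "c i = 0" using inj i by (simp add: the_inv_into_f_f)
next
  assume *: "\<forall>c. (\<Sum>i<k. c i *\<^sub>R s i) = 0 \<longrightarrow> (\<forall>i<k. c i = 0)"
  show inj: "inj_on s {..<k}"
  proof (rule inj_onI, rule ccontr)
    fix i j assume ij: "i \<in> {..<k}" "j \<in> {..<k}" "s i = s j" "i \<noteq> j"
    let ?c = "\<lambda>l. (if l = i then 1 else 0) - (if l = j then 1 else (0::real))"
    have "(\<Sum>l<k. ?c l *\<^sub>R s l) = (\<Sum>l<k. (if l = i then s l else 0) - (if l = j then s l else 0))"
      by (rule sum.cong) auto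
    also have "\<dots> = 0" using ij by (simp add: sum_subtractf)
    finally have "\<forall>l<k. ?c l = 0" by (rule spec[OF *, THEN mp])
    then have "?c i = 0" using ij(1) by blast
    with ij(4) show False by simp
  qed
  assume "dependent (s ` {..<k})"
  then obtain u where u: "(\<Sum>v\<in>s ` {..<k}. u v *\<^sub>R v) = 0" "\<exists>v\<in>s ` {..<k}. u v \<noteq> 0"
    by (auto simp: dependent_finite)
  then have "(\<Sum>i<k. u (s i) *\<^sub>R s i) = 0" using inj by (simp add: sum.reindex)
  from spec[OF *, of "\<lambda>i. u (s i)"] this u(2) show False by auto
qed

lemma basis_family_iff:
  assumes "subspace V"
  shows "basis_family V k s \<longleftrightarrow> inj_on s {..<k} \<and> independent (s ` {..<k}) \<and> span (s ` {..<k}) = V"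
proof -
  have "(\<forall>i<k. s i \<in> V) \<and> (\<forall>v\<in>V. \<exists>c. v = (\<Sum>i<k. c i *\<^sub>R s i)) \<longleftrightarrow> span (s ` {..<k}) = V"
  proof
    assume *: "(\<forall>i<k. s i \<in> V) \<and> (\<forall>v\<in>V. \<exists>c. v = (\<Sum>i<k. c i *\<^sub>R s i))"
    show "span (s ` {..<k}) = V"
    proof
      show "span (s ` {..<k}) \<subseteq> V" using * by (intro span_minimal assms) auto
      show "V \<subseteq> span (s ` {..<k})" using * unfolding span_family by blast
    qed
  next
    assume *: "span (s ` {..<k}) = V"
    have "s i \<in> V" if "i < k" for i unfolding *[symmetric] using that by (intro span_base imageI) simp
    moreover have "\<exists>c. v = (\<Sum>i<k. c i *\<^sub>R s i)" if "v \<in> V" for v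
      using that unfolding *[symmetric] span_family by blast
    ultimately show "(\<forall>i<k. s i \<in> V) \<and> (\<forall>v\<in>V. \<exists>c. v = (\<Sum>i<k. c i *\<^sub>R s i))" by blast
  qed
  then show ?thesis unfolding basis_family_def using independent_family[of s k] by argo
qed

lemma basis_family_dim: "subspace V \<Longrightarrow> basis_family V k s \<Longrightarrow> dim V = k"
  by (auto simp: basis_family_iff card_image dim_span dim_eq_card_independent)

lemma basis_family_exists:
  assumes V: "subspace V" and fin: "finite S" "V \<subseteq> span S"
  obtains s where "basis_family V (dim V) s"
proof -
  obtain B where B: "B \<subseteq> V" "independent B" "V \<subseteq> span B" "card B = dim V"
    using basis_exists by blast
  have "finite B" using independent_span_bound[OF fin(1) B(2)] B(1) fin(2) by auto
  then obtain s where s: "bij_betw s {..<card B} B" by (metis bij_betw_from_nat_into_finite)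
  have "span B = V" using B V by (meson span_subspace)
  then have "basis_family V (dim V) s" using s B by (auto simp: basis_family_iff[OF V] bij_betw_def)
  then show ?thesis by (rule that)
qed

lemma basis_family_in: "basis_family V k s \<Longrightarrow> i < k \<Longrightarrow> s i \<in> V"
  and basis_family_expand: "basis_family V k s \<Longrightarrow> v \<in> V \<Longrightarrow> \<exists>c. v = (\<Sum>i<k. c i *\<^sub>R s i)"
  and basis_family_indep: "basis_family V k s \<Longrightarrow> (\<Sum>i<k. c i *\<^sub>R s i) = 0 \<Longrightarrow> i < k \<Longrightarrow> c i = 0"
  by (auto simp: basis_family_def)

lemma sum_lessThan_add: "(\<Sum>i<a + (b::nat). f i) = (\<Sum>i<a. f i) + (\<Sum>i<b. f (a + i))"
  by (induction b) (simp_all add: add.assoc)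

text \<open>The conditions on \<open>t\<close> say that its classes form a basis of \<open>V\<close>
  modulo \<open>P\<close>.\<close>

lemma basis_family_concat:
  assumes s: "basis_family P a s" and t: "\<And>i. i < b \<Longrightarrow> t i \<in> V" and P: "P \<subseteq> V"
    and span: "\<And>v. v \<in> V \<Longrightarrow> \<exists>d. v - (\<Sum>i<b. d i *\<^sub>R t i) \<in> P"
    and ind: "\<And>d i. (\<Sum>i<b. d i *\<^sub>R t i) \<in> P \<Longrightarrow> i < b \<Longrightarrow> d i = 0" and "subspace P"
  shows "basis_family V (a + b) (\<lambda>i. if i < a then s i else t (i - a))"
  unfolding basis_family_def
proof (intro conjI allI impI ballI)
  fix i assume "i < a + b"
  then show "(if i < a then s i else t (i - a)) \<in> V" using basis_family_in[OF s] t P by auto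
next
  fix v assume "v \<in> V"
  from span[OF this] obtain d where "v - (\<Sum>i<b. d i *\<^sub>R t i) \<in> P" by blast
  from basis_family_expand[OF s this] obtain c where "v - (\<Sum>i<b. d i *\<^sub>R t i) = (\<Sum>i<a. c i *\<^sub>R s i)" by blast
  then have "v = (\<Sum>i<a + b. (if i < a then c i else d (i - a)) *\<^sub>R (if i < a then s i else t (i - a)))"
    by (simp add: sum_lessThan_add algebra_simps)
  then show "\<exists>c. v = (\<Sum>i<a + b. c i *\<^sub>R (if i < a then s i else t (i - a)))" by (rule exI[of _ "\<lambda>i. if i < a then c i else d (i - a)"])
next
  fix c i assume 0: "(\<Sum>i<a + b. c i *\<^sub>R (if i < a then s i else t (i - a))) = 0" and i: "i < a + b"
  then have 1: "(\<Sum>i<a. c i *\<^sub>R s i) + (\<Sum>i<b. c (a + i) *\<^sub>R t i) = 0"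
    by (simp add: sum_lessThan_add)
  have "(\<Sum>i<a. c i *\<^sub>R s i) \<in> P"
    using basis_family_in[OF s] by (intro subspace_sum[OF assms(6)] subspace_scale[OF assms(6)]) auto
  moreover have "(\<Sum>i<b. c (a + i) *\<^sub>R t i) = - (\<Sum>i<a. c i *\<^sub>R s i)"
    using 1 by (simp add: add_eq_0_iff)
  ultimately have "(\<Sum>i<b. c (a + i) *\<^sub>R t i) \<in> P" using subspace_neg[OF assms(6)] by metis
  from ind[OF this] have b: "c (a + j) = 0" if "j < b" for j using that by simp
  with 1 have "(\<Sum>i<a. c i *\<^sub>R s i) = 0" by simp
  from basis_family_indep[OF s this] have "c j = 0" if "j < a" for j using that by simp
  with b[of "i - a"] i show "c i = 0" by (cases "i < a") auto
qed

text \<open>A basis of the image is lifted to \<open>V\<close> and appended to a basis of the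
  kernel; the lifts are a basis modulo the kernel.\<close>

lemma rank_nullity:
  assumes V: "subspace V" "basis_family V m e" and "linear \<phi>"
  shows "m = dim {v \<in> V. \<phi> v = 0} + dim (\<phi> ` V)"
    and "\<exists>s. basis_family {v \<in> V. \<phi> v = 0} (dim {v \<in> V. \<phi> v = 0}) s" and "\<exists>s. basis_family (\<phi> ` V) (dim (\<phi> ` V)) s"
proof -
  let ?K = "{v \<in> V. \<phi> v = 0}"
  have K: "subspace ?K" using V(1) assms(3) by (auto simp: subspace_def linear_add linear_scale linear_0)
  have P: "subspace (\<phi> ` V)" by (rule linear_subspace_image[OF assms(3) V(1)])
  have spanV: "span (e ` {..<m}) = V" using V by (simp add: basis_family_iff)
  have "?K \<subseteq> span (e ` {..<m})" using spanV by auto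
  from basis_family_exists[OF K _ this] obtain s where s: "basis_family ?K (dim ?K) s" by auto
  then show "\<exists>s. basis_family ?K (dim ?K) s" by blast
  have "\<phi> ` V \<subseteq> span (\<phi> ` e ` {..<m})" using spanV linear_span_image[OF assms(3)] by auto
  from basis_family_exists[OF P _ this] obtain p where p: "basis_family (\<phi> ` V) (dim (\<phi> ` V)) p" by auto
  then show "\<exists>s. basis_family (\<phi> ` V) (dim (\<phi> ` V)) s" by blast
  let ?d = "dim (\<phi> ` V)"
  have "\<forall>i. \<exists>v. i < ?d \<longrightarrow> v \<in> V \<and> \<phi> v = p i" using basis_family_in[OF p] by force
  from choice[OF this] obtain t where t: "\<And>i. i < ?d \<Longrightarrow> t i \<in> V" "\<And>i. i < ?d \<Longrightarrow> \<phi> (t i) = p i" by blast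
  have \<phi>t: "\<phi> (\<Sum>i<?d. d i *\<^sub>R t i) = (\<Sum>i<?d. d i *\<^sub>R p i)" for d
    using t by (simp add: linear_sum[OF assms(3)] linear_scale[OF assms(3)])
  have tV: "(\<Sum>i<?d. d i *\<^sub>R t i) \<in> V" for d
    using t by (intro subspace_sum[OF V(1)] subspace_scale[OF V(1)]) auto
  have "basis_family V (dim ?K + ?d) (\<lambda>i. if i < dim ?K then s i else t (i - dim ?K))"
  proof (rule basis_family_concat[OF s])
    fix v assume v: "v \<in> V"
    then have "\<phi> v \<in> \<phi> ` V" by simp
    from basis_family_expand[OF p this] obtain d where "\<phi> v = (\<Sum>i<?d. d i *\<^sub>R p i)" by blast
    then have "v - (\<Sum>i<?d. d i *\<^sub>R t i) \<in> ?K"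
      using v tV subspace_diff[OF V(1)] \<phi>t by (simp add: linear_diff[OF assms(3)])
    then show "\<exists>d. v - (\<Sum>i<?d. d i *\<^sub>R t i) \<in> ?K" by blast
  next
    fix d i assume "(\<Sum>i<?d. d i *\<^sub>R t i) \<in> ?K" "i < ?d"
    then show "d i = 0" using basis_family_indep[OF p] \<phi>t by auto
  qed (use t K in auto)
  from basis_family_dim[OF V(1) this] basis_family_dim[OF V] show "m = dim ?K + ?d" by simp
qed

definition basis_coeff :: "nat \<Rightarrow> (nat \<Rightarrow> 'v::real_vector) \<Rightarrow> 'v \<Rightarrow> nat \<Rightarrow> real" where
  "basis_coeff k s v = (SOME c. v = (\<Sum>i<k. c i *\<^sub>R s i))"

lemma basis_coeff_expand:
  assumes "basis_family V k s" "v \<in> V"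
  shows "v = (\<Sum>i<k. basis_coeff k s v i *\<^sub>R s i)"
  unfolding basis_coeff_def using basis_family_expand[OF assms] by (rule someI_ex)

lemma basis_family_unique:
  assumes s: "basis_family V k s" and eq: "(\<Sum>i<k. c i *\<^sub>R s i) = (\<Sum>i<k. d i *\<^sub>R s i)" and j: "j < k"
  shows "c j = d j"
proof -
  have "(\<Sum>i<k. (c i - d i) *\<^sub>R s i) = 0"
    using eq by (simp add: scaleR_diff_left sum_subtractf)
  from basis_family_indep[OF s this j] show ?thesis by simp
qed

lemma basis_coeff_sum:
  assumes s: "basis_family V k s" and V: "subspace V" and j: "j < k"
  shows "basis_coeff k s (\<Sum>i<k. c i *\<^sub>R s i) j = c j"
proof -
  have "(\<Sum>i<k. c i *\<^sub>R s i) \<in> V"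
    using basis_family_in[OF s] by (intro subspace_sum[OF V] subspace_scale[OF V]) auto
  from basis_family_unique[OF s basis_coeff_expand[OF s this] j] show ?thesis by simp
qed

lemma basis_coeff_linear:
  assumes s: "basis_family V k s" and V: "subspace V" and j: "j < k"
  shows "linear_fun_on V (\<lambda>v. basis_coeff k s v j)"
  unfolding linear_fun_on_def
proof (intro ballI allI)
  fix u v a b assume uv: "u \<in> V" "v \<in> V"
  have "a *\<^sub>R u + b *\<^sub>R v = a *\<^sub>R (\<Sum>i<k. basis_coeff k s u i *\<^sub>R s i) + b *\<^sub>R (\<Sum>i<k. basis_coeff k s v i *\<^sub>R s i)"
    by (simp only: basis_coeff_expand[OF s uv(1), symmetric] basis_coeff_expand[OF s uv(2), symmetric])
  also have "\<dots> = (\<Sum>i<k. (a * basis_coeff k s u i + b * basis_coeff k s v i) *\<^sub>R s i)"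
    by (simp only: scaleR_sum_right scaleR_scaleR scaleR_add_left sum.distrib)
  finally have eq: "a *\<^sub>R u + b *\<^sub>R v = (\<Sum>i<k. (a * basis_coeff k s u i + b * basis_coeff k s v i) *\<^sub>R s i)" .
  show "basis_coeff k s (a *\<^sub>R u + b *\<^sub>R v) j = a * basis_coeff k s u j + b * basis_coeff k s v j"
    unfolding eq by (rule basis_coeff_sum[OF s V j])
qed

section \<open>Split structures\<close>

context manifold
begin

abbreviation "TS \<equiv> cotangent_space A"
abbreviation "TT \<equiv> gen_tangent_space A"

lemma cotangentD: "\<alpha> \<in> TS x \<Longrightarrow> linear_fun_on (T x) \<alpha>" "\<alpha> \<in> TS x \<Longrightarrow> v \<notin> T x \<Longrightarrow> \<alpha> v = 0"
  by (auto simp: cotangent_space_def)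

lemma subspace_cotangent: "subspace (TS x)"
  unfolding subspace_def cotangent_space_def linear_fun_on_def
  by (auto simp: scaleR_fun_def algebra_simps)

lemma subspace_TT: "subspace (TT x)"
  unfolding gen_tangent_space_def by (rule subspace_Times[OF subspace_tangent subspace_cotangent])

lemma pairing_alt: "pairing u w = 2 * (snd u (fst w) + snd w (fst u))"
  by (cases u; cases w) simp

lemma pairing_sym: "pairing u w = pairing w u"
  by (simp add: pairing_alt)

lemma pairing_linear:
  assumes "w \<in> TT x"
  shows "linear_fun_on (TT x) (\<lambda>u. pairing u w)"
  unfolding linear_fun_on_def
proof (intro ballI allI)
  fix u v a b assume uv: "u \<in> TT x" "v \<in> TT x"
  have "linear_fun_on (T x) (snd w)" using assms by (auto simp: gen_tangent_space_def cotangentD)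
  from linear_fun_onD[OF this, of "fst u" "fst v" a b] uv
  show "pairing (a *\<^sub>R u + b *\<^sub>R v) w = a * pairing u w + b * pairing v w"
    by (auto simp: pairing_alt gen_tangent_space_def scaleR_fun_def algebra_simps)
qed

text \<open>Smoothness of covector fields is tested on global fields. This makes it applicable to
  local fields, such as the vector parts of a local frame of \<open>E\<close>.\<close>

lemma vector_field_local:
  assumes Y: "vector_field_on A W Y" and W: "open W" "y \<in> W"
  shows "\<exists>Z\<in>VF. \<forall>\<^sub>F z in nhds y. Z z = Y z"
proof -
  obtain \<rho> K where \<rho>: "\<rho> \<in> C" "\<forall>\<^sub>F z in nhds y. \<rho> z = 1" "closed K" "K \<subseteq> W"
    "\<forall>z. z \<notin> K \<longrightarrow> \<rho> z = 0" by (rule bump[OF W])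
  define Z where "Z z = (if z \<in> W then \<rho> z *\<^sub>R Y z else 0)" for z
  have "Z \<in> VF"
    unfolding VF_iff
  proof (intro conjI allI ballI)
    show "Z z \<in> T z" for z
      using Y subspace_scale[OF subspace_tangent] subspace_0[OF subspace_tangent]
      by (auto simp: Z_def vector_field_on_def)
    fix f assume f: "f \<in> C"
    have sm: "smooth_at z (\<lambda>z. Y z f)" if "z \<in> W" for z
      using Y f that smooth_fun_on_iff[OF W(1)] by (auto simp: vector_field_on_def)
    show "(\<lambda>z. Z z f) \<in> C"
      by (rule smooth_extension_bump[OF W(1) \<rho>(1,3,4) \<rho>(5)[rule_format] sm])
        (auto simp: Z_def scaleR_fun_def)
  qed
  moreover have "\<forall>\<^sub>F z in nhds y. Z z = Y z"
    using \<rho>(2) eventually_nhds_in_open[OF W] by eventually_elim (simp add: Z_def)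
  ultimately show ?thesis by blast
qed

lemma frame_basis_family:
  assumes fr: "is_frame n W f F" and y: "y \<in> W"
  shows "basis_family (T y) n (\<lambda>i. F i y)"
  unfolding basis_family_def
proof (intro conjI allI impI ballI)
  show "F i y \<in> T y" if "i < n" for i using VF_T[OF frame_VF[OF fr that]] .
  show "\<exists>c. v = (\<Sum>i<n. c i *\<^sub>R F i y)" if "v \<in> T y" for v
    using frame_expand[OF fr y that] by (rule exI[of _ "\<lambda>i. v (f i)"])
  fix c i assume 0: "(\<Sum>i<n. c i *\<^sub>R F i y) = 0" and i: "i < n"
  from arg_cong[OF 0, of "\<lambda>v. v (f i)"] have "(\<Sum>j<n. c j * F j y (f i)) = 0"
    by (simp add: sum_fun_apply scaleR_fun_def)
  also have "(\<Sum>j<n. c j * F j y (f i)) = (\<Sum>j<n. if j = i then c j else 0)"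
    by (rule sum.cong) (use frame_dual[OF fr y] i in auto)
  finally show "c i = 0" using i by simp
qed

lemma basis_family_tangent_dim: "basis_family (T x) k s \<Longrightarrow> k = manifold_dim"
proof -
  assume s: "basis_family (T x) k s"
  obtain W f F where "x \<in> W" "is_frame manifold_dim W f F" by (rule frame_at)
  from basis_family_dim[OF subspace_tangent frame_basis_family[OF this(2,1)]] basis_family_dim[OF subspace_tangent s]
  show ?thesis by simp
qed

lemma tangent_subspace_basis_family:
  assumes "subspace V" "V \<subseteq> T x"
  shows "\<exists>s. basis_family V (dim V) s"
proof -
  obtain W f F where "x \<in> W" "is_frame manifold_dim W f F" by (rule frame_at)
  then have "span ((\<lambda>i. F i x) ` {..<manifold_dim}) = T x"
    using frame_basis_family basis_family_iff[OF subspace_tangent] by blast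
  with assms(2) have "V \<subseteq> span ((\<lambda>i. F i x) ` {..<manifold_dim})" by simp
  from basis_family_exists[OF assms(1) _ this] show ?thesis by blast
qed

end

section \<open>The orthogonal projection onto \<open>E\<close> and the images \<open>P\<close> and
  \<open>Q\<close>\<close>

locale gsplit = manifold A for A :: "('a::{t2_space, second_countable_topology}, 'b::{real_inner, heine_borel}) atlas" +
  fixes E :: "'a \<Rightarrow> 'a gvec set" and r :: nat
  assumes E_subbundle: "subbundle (gen_tangent_space A) (gen_section_on A) (2 * r) E"
    and E_nondegenerate: "nondegenerate_on (E x) pairing"
begin

abbreviation "E' \<equiv> orth_compl A E"
abbreviation "P x \<equiv> fst ` E x"
abbreviation "Q x \<equiv> fst ` orth_compl A E x"

lemma E_subspace: "subspace (E x)" and E_TT: "E x \<subseteq> TT x"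
  using E_subbundle by (auto simp: subbundle_def)

lemma E'_subspace: "subspace (E' x)" and E'_TT: "E' x \<subseteq> TT x"
proof -
  show "E' x \<subseteq> TT x" by (auto simp: orth_compl_def)
  have lin: "linear_fun_on (TT x) (\<lambda>u. pairing u e)" if "e \<in> E x" for e
    using pairing_linear E_TT that by blast
  show "subspace (E' x)"
    unfolding subspace_def orth_compl_def
    using linear_fun_on_zero[OF lin subspace_0[OF subspace_TT]] linear_fun_on_add[OF lin] linear_fun_on_scale[OF lin]
    by (auto simp: subspace_0[OF subspace_TT] subspace_add[OF subspace_TT] subspace_scale[OF subspace_TT])
qed

lemma E_snd: "e \<in> E x \<Longrightarrow> snd e \<in> TS x"
  and E'_snd: "e \<in> E' x \<Longrightarrow> snd e \<in> TS x"
  by (auto simp: gen_tangent_space_def mem_Times_iff dest!: subsetD[OF E_TT] subsetD[OF E'_TT])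

lemma E_frame:
  obtains W s where "open W" "x \<in> W" "\<And>i. i < 2 * r \<Longrightarrow> gen_section_on A W (s i)"
    "\<And>y. y \<in> W \<Longrightarrow> basis_family (E y) (2 * r) (\<lambda>i. s i y)"
proof -
  have "\<exists>W s. open W \<and> x \<in> W \<and> (\<forall>i<2 * r. gen_section_on A W (s i)) \<and>
        (\<forall>y\<in>W. inj_on (\<lambda>i. s i y) {..<2 * r} \<and> independent ((\<lambda>i. s i y) ` {..<2 * r}) \<and>
           span ((\<lambda>i. s i y) ` {..<2 * r}) = E y)"
    using E_subbundle unfolding subbundle_def by (elim conjE allE[of _ x])
  then obtain W s where W: "open W" "x \<in> W" "\<forall>i<2 * r. gen_section_on A W (s i)"
    "\<forall>y\<in>W. inj_on (\<lambda>i. s i y) {..<2 * r} \<and> independent ((\<lambda>i. s i y) ` {..<2 * r}) \<and>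
           span ((\<lambda>i. s i y) ` {..<2 * r}) = E y" by (elim exE conjE)
  show ?thesis
  proof (rule that[OF W(1,2)])
    show "gen_section_on A W (s i)" if "i < 2 * r" for i using W(3) that by simp
    show "basis_family (E y) (2 * r) (\<lambda>i. s i y)" if "y \<in> W" for y
      using W(4) that by (simp add: basis_family_iff[OF E_subspace])
  qed
qed

text \<open>A relation between the rows of the Gram matrix produces an element of \<open>E x\<close>
  orthogonal to all of \<open>E x\<close>, which is 0 by nondegeneracy.\<close>

lemma gram_kernel:
  assumes s: "basis_family (E x) m s" and 0: "\<And>j. j < m \<Longrightarrow> (\<Sum>i<m. c i * pairing (s i) (s j)) = 0" and i: "i < m"
  shows "c i = 0"
proof -
  define e where "e = (\<Sum>i<m. c i *\<^sub>R s i)"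
  have sT: "s i \<in> TT x" if "i < m" for i using basis_family_in[OF s that] E_TT by blast
  have e: "e \<in> E x"
    unfolding e_def using basis_family_in[OF s] by (intro subspace_sum[OF E_subspace] subspace_scale[OF E_subspace]) auto
  have ej: "pairing e (s j) = 0" if "j < m" for j
    using linear_fun_on_sum[OF pairing_linear[OF sT[OF that]] subspace_TT, of "{..<m}" s c] sT 0[OF that]
    by (simp add: e_def)
  have "pairing e w = 0" if w: "w \<in> E x" for w
  proof -
    obtain d where d: "w = (\<Sum>i<m. d i *\<^sub>R s i)" using basis_family_expand[OF s w] by blast
    have "pairing (\<Sum>i<m. d i *\<^sub>R s i) e = (\<Sum>i<m. d i * pairing (s i) e)"
      by (rule linear_fun_on_sum[OF pairing_linear subspace_TT]) (use e E_TT sT in auto)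
    then show ?thesis using ej by (simp add: d pairing_sym[of _ e])
  qed
  then have "e = 0" using E_nondegenerate[of x] e by (auto simp: nondegenerate_on_def)
  then show ?thesis using basis_family_indep[OF s _ i] by (simp add: e_def)
qed

text \<open>The vector \<open>e\<close> is the orthogonal projection of \<open>w\<close>, written
  with a right inverse \<open>b\<close> of the Gram matrix. Its coefficients are explicit, so they
  are smooth whenever \<open>b\<close>, \<open>w\<close> and the frame are.\<close>

lemma gram_projection:
  assumes s: "basis_family (E x) m s" and w: "w \<in> TT x"
    and b: "\<And>i j. i < m \<Longrightarrow> j < m \<Longrightarrow> (\<Sum>k<m. pairing (s i) (s k) * b k j) = (if i = j then 1 else 0)"
  defines "e \<equiv> \<Sum>i<m. (\<Sum>j<m. b i j * pairing w (s j)) *\<^sub>R s i"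
  shows "e \<in> E x" "w - e \<in> E' x"
proof -
  have sT: "s i \<in> TT x" if "i < m" for i using basis_family_in[OF s that] E_TT by blast
  show e: "e \<in> E x"
    unfolding e_def using basis_family_in[OF s] by (intro subspace_sum[OF E_subspace] subspace_scale[OF E_subspace]) auto
  have eT: "e \<in> TT x" using e E_TT by blast
  have dT: "w - e \<in> TT x" by (rule subspace_diff[OF subspace_TT w eT])
  have k: "pairing (w - e) (s k) = 0" if k: "k < m" for k
  proof -
    have "pairing e (s k) = (\<Sum>i<m. (\<Sum>j<m. b i j * pairing w (s j)) * pairing (s i) (s k))"
      unfolding e_def by (rule linear_fun_on_sum[OF pairing_linear[OF sT[OF k]] subspace_TT]) (use sT in auto)
    also have "\<dots> = (\<Sum>i<m. \<Sum>j<m. pairing w (s j) * (pairing (s k) (s i) * b i j))"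
      by (simp add: sum_distrib_left sum_distrib_right pairing_sym[of "s k"] mult_ac)
    also have "\<dots> = (\<Sum>j<m. pairing w (s j) * (\<Sum>i<m. pairing (s k) (s i) * b i j))"
      by (subst sum.swap) (simp add: sum_distrib_left)
    also have "\<dots> = (\<Sum>j<m. if k = j then pairing w (s j) else 0)"
      by (rule sum.cong) (use b[OF k] in auto)
    also have "\<dots> = pairing w (s k)" using k by simp
    finally show ?thesis using linear_fun_on_diff[OF pairing_linear[OF sT[OF k]] w eT] by simp
  qed
  have "pairing (w - e) v = 0" if v: "v \<in> E x" for v
  proof -
    obtain d where d: "v = (\<Sum>i<m. d i *\<^sub>R s i)" using basis_family_expand[OF s v] by blast
    have "pairing (\<Sum>i<m. d i *\<^sub>R s i) (w - e) = (\<Sum>i<m. d i * pairing (s i) (w - e))"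
      by (rule linear_fun_on_sum[OF pairing_linear[OF dT] subspace_TT]) (use sT in auto)
    then show ?thesis using k by (simp add: d pairing_sym[of _ "w - e"])
  qed
  with dT show "w - e \<in> E' x" by (auto simp: orth_compl_def)
qed

text \<open>The pairing restricted to \<open>E\<close> is nondegenerate, so the Gram matrix of a
  local frame is invertible at \<open>x\<close>, and its inverse depends smoothly on the
  point.\<close>

lemma local_gram:
  obtains s b where "\<And>i. i < 2 * r \<Longrightarrow> \<exists>W. open W \<and> x \<in> W \<and> gen_section_on A W (s i)"
    "\<And>i j. i < 2 * r \<Longrightarrow> j < 2 * r \<Longrightarrow> smooth_at x (\<lambda>y. b y i j)"
    "\<forall>\<^sub>F y in nhds x. basis_family (E y) (2 * r) (\<lambda>i. s i y) \<and>
      (\<forall>i<2 * r. \<forall>j<2 * r. (\<Sum>k<2 * r. pairing (s i y) (s k y) * b y k j) = (if i = j then 1 else 0))"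
proof -
  obtain W s where W: "open W" "x \<in> W" and s: "\<And>i. i < 2 * r \<Longrightarrow> gen_section_on A W (s i)"
    "\<And>y. y \<in> W \<Longrightarrow> basis_family (E y) (2 * r) (\<lambda>i. s i y)" by (rule E_frame[of x]) blast
  \<comment> \<open>Near \<open>x\<close> the local field \<open>fst (s j y)\<close> agrees with a
    global field \<open>Z\<close>, on which the covector part of \<open>s i\<close> may be
    tested.\<close>
  have half: "smooth_at x (\<lambda>y. snd (s i y) (fst (s j y)))" if ij: "i < 2 * r" "j < 2 * r" for i j
  proof -
    from s(1)[OF ij(2)] have "vector_field_on A W (\<lambda>y. fst (s j y))" by (simp add: gen_section_on_def)
    from vector_field_local[OF this W] obtain Z where Z: "Z \<in> VF" "\<forall>\<^sub>F y in nhds x. Z y = fst (s j y)" by blast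
    have "smooth_fun_on A W (\<lambda>y. snd (s i y) (Z y))"
      using s(1)[OF ij(1)] Z(1) by (simp add: gen_section_on_def covector_field_on_def)
    then have "smooth_at x (\<lambda>y. snd (s i y) (Z y))" using smooth_fun_on_iff[OF W(1)] W(2) by blast
    moreover have "\<forall>\<^sub>F y in nhds x. snd (s i y) (Z y) = snd (s i y) (fst (s j y))"
      using Z(2) by eventually_elim simp
    ultimately show ?thesis by (rule smooth_at_cong)
  qed
  have g: "smooth_at x (\<lambda>y. pairing (s i y) (s j y))" if "i < 2 * r" "j < 2 * r" for i j
    unfolding pairing_alt by (intro smooth_at_mult smooth_at_add smooth_at_const half that)
  have ker: "\<forall>c. (\<forall>j<2 * r. (\<Sum>i<2 * r. c i * pairing (s i x) (s j x)) = 0) \<longrightarrow> (\<forall>i<2 * r. c i = 0)"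
    using gram_kernel[OF s(2)[OF W(2)]] by blast
  obtain b where b: "\<forall>i<2 * r. \<forall>j<2 * r. smooth_at x (\<lambda>y. b y i j)"
    "\<forall>\<^sub>F y in nhds x. \<forall>i<2 * r. \<forall>j<2 * r. (\<Sum>k<2 * r. pairing (s i y) (s k y) * b y k j) = (if i = j then 1 else 0) \<and>
      (\<Sum>k<2 * r. b y i k * pairing (s k y) (s j y)) = (if i = j then 1 else 0)"
    by (rule smooth_matrix_inverse[of "2 * r" x "\<lambda>y i j. pairing (s i y) (s j y)", OF g ker])
  show ?thesis
  proof (rule that[of s b])
    show "\<exists>W. open W \<and> x \<in> W \<and> gen_section_on A W (s i)" if "i < 2 * r" for i using W s(1)[OF that] by blast
    show "smooth_at x (\<lambda>y. b y i j)" if "i < 2 * r" "j < 2 * r" for i j using b(1) that by blast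
    show "\<forall>\<^sub>F y in nhds x. basis_family (E y) (2 * r) (\<lambda>i. s i y) \<and>
      (\<forall>i<2 * r. \<forall>j<2 * r. (\<Sum>k<2 * r. pairing (s i y) (s k y) * b y k j) = (if i = j then 1 else 0))"
      using b(2) eventually_nhds_in_open[OF W] by eventually_elim (use s(2) in blast)
  qed
qed

lemma orthogonal_decomposition:
  assumes "w \<in> TT x"
  shows "\<exists>e\<in>E x. w - e \<in> E' x"
proof -
  obtain s b where "\<forall>\<^sub>F y in nhds x. basis_family (E y) (2 * r) (\<lambda>i. s i y) \<and>
      (\<forall>i<2 * r. \<forall>j<2 * r. (\<Sum>k<2 * r. pairing (s i y) (s k y) * b y k j) = (if i = j then 1 else (0::real)))"
    by (rule local_gram[of x]) blast
  from eventually_nhds_x_imp_x[OF this] have s: "basis_family (E x) (2 * r) (\<lambda>i. s i x)"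
    and b: "\<And>i j. i < 2 * r \<Longrightarrow> j < 2 * r \<Longrightarrow> (\<Sum>k<2 * r. pairing (s i x) (s k x) * b x k j) = (if i = j then 1 else 0)"
    by blast+
  from gram_projection[OF s assms b] show ?thesis by blast
qed

lemma P_T: "P x \<subseteq> T x" and Q_T: "Q x \<subseteq> T x"
  using E_TT[of x] E'_TT[of x] by (auto simp: gen_tangent_space_def)

lemma P_subspace: "subspace (P x)" and Q_subspace: "subspace (Q x)"
  by (intro linear_subspace_image linear_fst E_subspace E'_subspace)+

lemma PQ_sum:
  assumes "v \<in> T x"
  shows "\<exists>p\<in>P x. v - p \<in> Q x"
proof -
  have "(v, 0) \<in> TT x" using assms subspace_0[OF subspace_cotangent] by (simp add: gen_tangent_space_def)
  from orthogonal_decomposition[OF this] obtain e where e: "e \<in> E x" "(v, 0) - e \<in> E' x" by blast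
  then have "fst ((v, 0) - e) \<in> Q x" by blast
  then show ?thesis using e(1) by auto
qed

lemma E'_covector:
  assumes "\<alpha> \<in> TS x"
  shows "(0, \<alpha>) \<in> E' x \<longleftrightarrow> (\<forall>v\<in>P x. \<alpha> v = 0)"
proof -
  have "snd e 0 = 0" if "e \<in> E x" for e
    using linear_fun_on_zero[OF cotangentD(1)] E_TT that subspace_0[OF subspace_tangent]
    by (fastforce simp: gen_tangent_space_def)
  then show ?thesis
    using assms subspace_0[OF subspace_tangent] by (auto simp: orth_compl_def pairing_alt gen_tangent_space_def)
qed

lemma E_covector_Q: "(0, \<alpha>) \<in> E x \<Longrightarrow> v \<in> Q x \<Longrightarrow> \<alpha> v = 0"
proof -
  assume \<alpha>: "(0, \<alpha>) \<in> E x" and "v \<in> Q x"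
  then obtain e where e: "e \<in> E' x" "v = fst e" by blast
  have "snd e \<in> TS x" using E'_snd[OF e(1)] .
  then have "snd e 0 = 0" using linear_fun_on_zero[OF cotangentD(1) subspace_0[OF subspace_tangent]] by blast
  moreover have "pairing e (0, \<alpha>) = 0" using e(1) \<alpha> by (auto simp: orth_compl_def)
  ultimately show ?thesis by (simp add: pairing_alt e(2))
qed

text \<open>\<open>E \<inter> T*M\<close> pairs nondegenerately with \<open>P\<close> and vanishes on \<open>Q\<close>.\<close>

lemma direct_sum_of_rank:
  assumes "dim (P x) = r"
  shows "direct_sum (T x) (P x) (Q x)"
proof -
  let ?K = "{e \<in> E x. fst e = 0}"
  obtain W s where "x \<in> W" "\<And>y. y \<in> W \<Longrightarrow> basis_family (E y) (2 * r) (\<lambda>i. s i y)" by (rule E_frame[of x]) blast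
  then have s: "basis_family (E x) (2 * r) (\<lambda>i. s i x)" by blast
  note rn = rank_nullity[OF E_subspace s linear_fst]
  \<comment> \<open>The kernel of the projection on \<open>E x\<close> has dimension
    \<open>2 * r - r\<close>, the same as \<open>P x\<close>; the pairing matrix below is therefore
    square.\<close>
  from rn(1) assms have dK: "dim ?K = r" by simp
  obtain \<kappa> where \<kappa>: "basis_family ?K r \<kappa>" using rn(2) dK by auto
  obtain p where p: "basis_family (P x) r p" using rn(3) assms by auto
  have \<kappa>K: "\<kappa> i \<in> E x" "fst (\<kappa> i) = 0" "\<kappa> i = (0, snd (\<kappa> i))" "snd (\<kappa> i) \<in> TS x" if "i < r" for i
    using basis_family_in[OF \<kappa> that] E_snd[of "\<kappa> i" x] by (auto simp: prod_eq_iff)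
  have K: "subspace ?K"
    using E_subspace[of x] by (auto simp: subspace_def)
  \<comment> \<open>The matrix pairs the covectors in \<open>E x\<close> with \<open>P x\<close>. A
    row relation gives a covector in \<open>E x\<close> that annihilates \<open>P x\<close>; it is
    then orthogonal to \<open>E x\<close>, hence 0.\<close>
  define a where "a i j = snd (\<kappa> i) (p j)" for i j
  have "mdet r a \<noteq> 0"
  proof (rule mdet_nonzero)
    fix c i assume 0: "\<And>j. j < r \<Longrightarrow> (\<Sum>i<r. c i * a i j) = 0" and i: "i < r"
    define e where "e = (\<Sum>i<r. c i *\<^sub>R \<kappa> i)"
    have e: "e \<in> ?K" unfolding e_def
      by (intro subspace_sum[OF K] subspace_scale[OF K] basis_family_in[OF \<kappa>]) simp
    then have eT: "snd e \<in> TS x" using E_snd by blast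
    have snd_e: "snd e v = (\<Sum>i<r. c i * snd (\<kappa> i) v)" for v
      by (simp add: e_def snd_sum sum_fun_apply scaleR_fun_def)
    have "snd e v = 0" if v: "v \<in> P x" for v
    proof -
      obtain d where d: "v = (\<Sum>j<r. d j *\<^sub>R p j)" using basis_family_expand[OF p v] by blast
      have "snd e (\<Sum>j<r. d j *\<^sub>R p j) = (\<Sum>j<r. d j * snd e (p j))"
        by (rule linear_fun_on_sum[OF cotangentD(1)[OF eT] subspace_tangent])
          (use basis_family_in[OF p] P_T in blast)
      then show ?thesis using 0 by (simp add: d snd_e a_def)
    qed
    moreover have "e = (0, snd e)" using e by (simp add: prod_eq_iff)
    ultimately have "\<forall>w\<in>E x. pairing e w = 0"
      using E'_covector[OF eT] pairing_sym by (auto simp: orth_compl_def)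
    then have "e = 0" using E_nondegenerate[of x] e by (auto simp: nondegenerate_on_def)
    then show "c i = 0" using basis_family_indep[OF \<kappa> _ i] by (simp add: e_def)
  qed
  have "v = 0" if v: "v \<in> P x" "v \<in> Q x" for v
  proof -
    obtain d where d: "v = (\<Sum>j<r. d j *\<^sub>R p j)" using basis_family_expand[OF p v(1)] by blast
    have ad: "(\<Sum>j<r. a i j * d j) = 0" if i: "i < r" for i
    proof -
      have "snd (\<kappa> i) (\<Sum>j<r. d j *\<^sub>R p j) = (\<Sum>j<r. d j * snd (\<kappa> i) (p j))"
        by (rule linear_fun_on_sum[OF cotangentD(1)[OF \<kappa>K(4)[OF i]] subspace_tangent])
          (use basis_family_in[OF p] P_T in blast)
      moreover have "snd (\<kappa> i) v = 0" using E_covector_Q[OF _ v(2), of "snd (\<kappa> i)"] \<kappa>K[OF i] by metis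
      ultimately show ?thesis by (simp add: d a_def mult.commute)
    qed
    \<comment> \<open>A vector of \<open>P x\<close> that lies in \<open>Q x\<close> is annihilated
      by all covectors in \<open>E x\<close>, so its coordinates \<open>d\<close> solve a
      homogeneous system, which the adjugate inverts from the left.\<close>
    have "mdet r a * d k = 0" if k: "k < r" for k
    proof -
      have "mdet r a * d k = (\<Sum>j<r. (if k = j then mdet r a else 0) * d j)" using k by (simp add: if_distrib[of "\<lambda>x. x * _"] cong: if_cong)
      also have "\<dots> = (\<Sum>j<r. (\<Sum>i<r. madj r a k i * a i j) * d j)"
        by (intro sum.cong refl) (simp add: madj_mult(2) k)
      also have "\<dots> = (\<Sum>j<r. \<Sum>i<r. madj r a k i * (a i j * d j))"
        by (simp add: sum_distrib_right mult.assoc)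
      also have "\<dots> = (\<Sum>i<r. madj r a k i * (\<Sum>j<r. a i j * d j))"
        by (subst sum.swap) (simp add: sum_distrib_left)
      also have "\<dots> = 0" by (simp add: ad)
      finally show ?thesis .
    qed
    with \<open>mdet r a \<noteq> 0\<close> have "d k = 0" if "k < r" for k using that by simp
    then show "v = 0" by (simp add: d)
  qed
  then have "P x \<inter> Q x = {0}" using subspace_0[OF P_subspace] subspace_0[OF Q_subspace] by blast
  moreover have "T x = {p + n | p n. p \<in> P x \<and> n \<in> Q x}"
  proof (intro antisym subsetI)
    fix v assume "v \<in> T x"
    from PQ_sum[OF this] obtain q where "q \<in> P x" "v - q \<in> Q x" by blast
    then show "v \<in> {p + n | p n. p \<in> P x \<and> n \<in> Q x}"
      by (intro CollectI exI[of _ q] exI[of _ "v - q"]) simp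
  next
    fix v assume "v \<in> {p + n | p n. p \<in> P x \<and> n \<in> Q x}"
    then show "v \<in> T x" using P_T Q_T subspace_add[OF subspace_tangent] by blast
  qed
  ultimately show ?thesis by (simp add: direct_sum_def)
qed

end

section \<open>The splitting of the tangent bundle and its projection\<close>

locale gproduct = gsplit A E r for A :: "('a::{t2_space, second_countable_topology}, 'b::{real_inner, heine_borel}) atlas"
    and E :: "'a \<Rightarrow> 'a gvec set" and r :: nat +
  assumes PQ_direct: "direct_sum (tangent_space A x) (fst ` E x) (fst ` orth_compl A E x)"
begin

definition J :: "'a \<Rightarrow> 'a tvec \<Rightarrow> 'a tvec" where
  "J x v = (THE p. p \<in> P x \<and> v - p \<in> Q x)"

lemma PQ_Int: "v \<in> P x \<Longrightarrow> v \<in> Q x \<Longrightarrow> v = 0"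
  using PQ_direct[of x] by (auto simp: direct_sum_def)

lemma J_eqI: "p \<in> P x \<Longrightarrow> v - p \<in> Q x \<Longrightarrow> J x v = p"
  unfolding J_def
proof (rule the_equality)
  fix p' assume *: "p \<in> P x" "v - p \<in> Q x" "p' \<in> P x \<and> v - p' \<in> Q x"
  then have "p' - p \<in> P x" "(v - p) - (v - p') \<in> Q x"
    using subspace_diff[OF P_subspace] subspace_diff[OF Q_subspace] by blast+
  moreover have "(v - p) - (v - p') = p' - p" by simp
  ultimately have "p' - p \<in> P x" "p' - p \<in> Q x" by (simp_all only:)
  then have "p' - p = 0" by (rule PQ_Int)
  then show "p' = p" by simp
qed auto

lemma J_P: "v \<in> T x \<Longrightarrow> J x v \<in> P x" and J_Q: "v \<in> T x \<Longrightarrow> v - J x v \<in> Q x"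
proof -
  assume "v \<in> T x"
  from PQ_sum[OF this] obtain p where p: "p \<in> P x" "v - p \<in> Q x" by blast
  then show "J x v \<in> P x" "v - J x v \<in> Q x" using J_eqI[OF p] by simp_all
qed

lemma J_id: "v \<in> P x \<Longrightarrow> J x v = v"
  by (rule J_eqI) (simp_all only: diff_self subspace_0[OF Q_subspace])

lemma J_zero: "v \<in> Q x \<Longrightarrow> J x v = 0"
  by (rule J_eqI) (simp_all only: diff_zero subspace_0[OF P_subspace])

lemma J_T: "v \<in> T x \<Longrightarrow> J x v \<in> T x" and J_T': "v \<in> T x \<Longrightarrow> v - J x v \<in> T x"
  by (auto intro: subsetD[OF P_T] subsetD[OF Q_T] J_P J_Q)

lemma J_linear:
  assumes "u \<in> T x" "v \<in> T x"
  shows "J x (a *\<^sub>R u + b *\<^sub>R v) = a *\<^sub>R J x u + b *\<^sub>R J x v"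
proof (rule J_eqI)
  show "a *\<^sub>R J x u + b *\<^sub>R J x v \<in> P x"
    using assms by (intro subspace_add[OF P_subspace] subspace_scale[OF P_subspace] J_P)
  have "a *\<^sub>R (u - J x u) + b *\<^sub>R (v - J x v) \<in> Q x"
    using assms by (intro subspace_add[OF Q_subspace] subspace_scale[OF Q_subspace] J_Q)
  then show "a *\<^sub>R u + b *\<^sub>R v - (a *\<^sub>R J x u + b *\<^sub>R J x v) \<in> Q x"
    by (simp only: scaleR_diff_right) (simp only: add_diff_add)
qed

definition J_field :: "'a vfield \<Rightarrow> 'a vfield" where
  "J_field X = (\<lambda>x. J x (X x))"

text \<open>The orthogonal projection of \<open>(X y, 0)\<close> onto \<open>E y\<close> has vector
  part \<open>J y (X y)\<close>, because the remainder has its vector part in \<open>Q y\<close>.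
  Near each point the projection is a sum over a local frame with smooth coefficients.\<close>

lemma J_field_VF:
  assumes X: "X \<in> VF"
  shows "J_field X \<in> VF"
  unfolding VF_iff
proof (intro conjI allI ballI)
  show "J_field X x \<in> T x" for x using J_T[OF VF_T[OF X]] by (simp add: J_field_def)
  fix f assume f: "f \<in> C"
  show "(\<lambda>x. J_field X x f) \<in> C"
    unfolding smooth_funs_iff
  proof
    fix x
    obtain s b where sec: "\<And>i. i < 2 * r \<Longrightarrow> \<exists>W. open W \<and> x \<in> W \<and> gen_section_on A W (s i)"
      and b: "\<And>i j. i < 2 * r \<Longrightarrow> j < 2 * r \<Longrightarrow> smooth_at x (\<lambda>y. b y i j)"
      and ev: "\<forall>\<^sub>F y in nhds x. basis_family (E y) (2 * r) (\<lambda>i. s i y) \<and>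
        (\<forall>i<2 * r. \<forall>j<2 * r. (\<Sum>k<2 * r. pairing (s i y) (s k y) * b y k j) = (if i = j then 1 else 0))"
      by (rule local_gram[of x]) blast
    have sV: "smooth_at x (\<lambda>y. fst (s i y) f)" and sC: "smooth_at x (\<lambda>y. snd (s i y) (X y))" if "i < 2 * r" for i
      using sec[OF that] f X smooth_fun_on_iff
      by (auto simp: gen_section_on_def vector_field_on_def covector_field_on_def)
    have "smooth_at x (\<lambda>y. \<Sum>i<2 * r. (\<Sum>j<2 * r. b y i j * (2 * snd (s j y) (X y))) * fst (s i y) f)"
      by (intro smooth_at_sum smooth_at_mult smooth_at_const b sV sC) auto
    then show "smooth_at x (\<lambda>y. J_field X y f)"
    proof (rule smooth_at_cong)
      show "\<forall>\<^sub>F y in nhds x. (\<Sum>i<2 * r. (\<Sum>j<2 * r. b y i j * (2 * snd (s j y) (X y))) * fst (s i y) f) = J_field X y f"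
        using ev
      proof eventually_elim
        case (elim y)
        let ?w = "(X y, 0)"
        let ?e = "\<Sum>i<2 * r. (\<Sum>j<2 * r. b y i j * pairing ?w (s j y)) *\<^sub>R s i y"
        have w: "?w \<in> TT y" using VF_T[OF X] subspace_0[OF subspace_cotangent] by (simp add: gen_tangent_space_def)
        have "?e \<in> E y" "?w - ?e \<in> E' y"
          using gram_projection[of y "2 * r" "\<lambda>i. s i y" ?w "b y"] elim w by blast+
        then have "fst ?e \<in> P y" "fst (?w - ?e) \<in> Q y" by blast+
        then have "J y (X y) = fst ?e" by (intro J_eqI) simp_all
        then show ?case
          by (simp add: J_field_def fst_sum sum_fun_apply scaleR_fun_def pairing_alt)
      qed
    qed
  qed
qed

lemma J_field_compl_VF: "X \<in> VF \<Longrightarrow> X - J_field X \<in> VF"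
  by (intro VF_minus J_field_VF)

lemma adapted_basis_family:
  obtains e where "basis_family (T x) manifold_dim e" "\<And>i. i < dim (P x) \<Longrightarrow> e i \<in> P x"
    "\<And>i. dim (P x) \<le> i \<Longrightarrow> i < manifold_dim \<Longrightarrow> e i \<in> Q x" "dim (P x) \<le> manifold_dim"
proof -
  obtain p where p: "basis_family (P x) (dim (P x)) p" using tangent_subspace_basis_family[OF P_subspace P_T] by blast
  obtain q where q: "basis_family (Q x) (dim (Q x)) q" using tangent_subspace_basis_family[OF Q_subspace Q_T] by blast
  let ?a = "dim (P x)" and ?b = "dim (Q x)"
  let ?e = "\<lambda>i. if i < ?a then p i else q (i - ?a)"
  have e: "basis_family (T x) (?a + ?b) ?e"
  proof (rule basis_family_concat[OF p])
    show "q i \<in> T x" if "i < ?b" for i using basis_family_in[OF q that] Q_T by blast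
    fix v assume v: "v \<in> T x"
    obtain d where "v - J x v = (\<Sum>i<?b. d i *\<^sub>R q i)" using basis_family_expand[OF q J_Q[OF v]] by blast
    then have "v - (\<Sum>i<?b. d i *\<^sub>R q i) = J x v" by (simp add: algebra_simps)
    then show "\<exists>d. v - (\<Sum>i<?b. d i *\<^sub>R q i) \<in> P x" using J_P[OF v] by (intro exI[of _ d]) (simp only:)
  next
    fix d i assume 0: "(\<Sum>i<?b. d i *\<^sub>R q i) \<in> P x" and i: "i < ?b"
    have "(\<Sum>i<?b. d i *\<^sub>R q i) \<in> Q x"
      by (intro subspace_sum[OF Q_subspace] subspace_scale[OF Q_subspace] basis_family_in[OF q]) simp
    with 0 have "(\<Sum>i<?b. d i *\<^sub>R q i) = 0" using PQ_Int by blast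
    then show "d i = 0" using basis_family_indep[OF q _ i] by blast
  qed (use P_T P_subspace in auto)
  have n: "?a + ?b = manifold_dim" by (rule basis_family_tangent_dim[OF e])
  show ?thesis
  proof (rule that[of ?e])
    show "basis_family (T x) manifold_dim ?e" using e n by simp
    show "?e i \<in> P x" if "i < ?a" for i using basis_family_in[OF p that] that by simp
    show "?e i \<in> Q x" if "?a \<le> i" "i < manifold_dim" for i using basis_family_in[OF q, of "i - ?a"] that n by simp
    show "?a \<le> manifold_dim" using n by simp
  qed
qed

text \<open>The first \<open>dim (P x)\<close> dual covectors vanish on \<open>Q x\<close>, the
  others on \<open>P x\<close>; this is what places them in \<open>E x\<close> and in its orthogonal
  complement, and it yields generators for the bigraded fibres.\<close>

lemma adapted_dual_basis:
  obtains e \<epsilon> where "basis_family (T x) manifold_dim e" "\<And>i. i < dim (P x) \<Longrightarrow> e i \<in> P x"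
    "\<And>i. dim (P x) \<le> i \<Longrightarrow> i < manifold_dim \<Longrightarrow> e i \<in> Q x" "dim (P x) \<le> manifold_dim"
    "\<And>i. i < manifold_dim \<Longrightarrow> \<epsilon> i \<in> TS x"
    "\<And>i. i < dim (P x) \<Longrightarrow> (0, \<epsilon> i) \<in> E x"
    "\<And>i. dim (P x) \<le> i \<Longrightarrow> i < manifold_dim \<Longrightarrow> (0, \<epsilon> i) \<in> E' x"
    "\<And>v. v \<in> T x \<Longrightarrow> v = (\<Sum>i<manifold_dim. \<epsilon> i v *\<^sub>R e i)"
    "\<And>i j. i < manifold_dim \<Longrightarrow> j < manifold_dim \<Longrightarrow> \<epsilon> i (e j) = (if i = j then 1 else 0)"
proof -
  obtain e where e: "basis_family (T x) manifold_dim e" and eP: "\<And>i. i < dim (P x) \<Longrightarrow> e i \<in> P x"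
    and eQ: "\<And>i. dim (P x) \<le> i \<Longrightarrow> i < manifold_dim \<Longrightarrow> e i \<in> Q x" and le: "dim (P x) \<le> manifold_dim"
    by (rule adapted_basis_family) blast
  let ?a = "dim (P x)"
  define \<epsilon> where "\<epsilon> i v = (if v \<in> T x then basis_coeff manifold_dim e v i else 0)" for i v
  have \<epsilon>T: "\<epsilon> i \<in> TS x" if "i < manifold_dim" for i
    using basis_coeff_linear[OF e subspace_tangent that] subspace_add[OF subspace_tangent] subspace_scale[OF subspace_tangent]
    by (auto simp: cotangent_space_def \<epsilon>_def linear_fun_on_def)
  have expand: "v = (\<Sum>i<manifold_dim. \<epsilon> i v *\<^sub>R e i)" if "v \<in> T x" for v
    using basis_coeff_expand[OF e that] that by (simp add: \<epsilon>_def)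
  have dual: "\<epsilon> i (e j) = (if i = j then 1 else 0)" if ij: "i < manifold_dim" "j < manifold_dim" for i j
  proof -
    have ej: "e j \<in> T x" by (rule basis_family_in[OF e ij(2)])
    have "(\<Sum>i<manifold_dim. \<epsilon> i (e j) *\<^sub>R e i) = (\<Sum>i<manifold_dim. (if i = j then 1 else 0) *\<^sub>R e i)"
    proof -
      have "(\<Sum>i<manifold_dim. (if i = j then 1 else 0) *\<^sub>R e i) = (\<Sum>i<manifold_dim. if i = j then e i else 0)"
        by (rule sum.cong) auto
      also have "\<dots> = e j" using ij by simp
      finally show ?thesis using expand[OF ej] by simp
    qed
    from basis_family_unique[OF e this ij(1)] show ?thesis .
  qed
  have onP: "\<epsilon> i v = 0" if i: "?a \<le> i" "i < manifold_dim" and v: "v \<in> P x" for i v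
  proof -
    obtain p where p: "basis_family (P x) ?a p" using tangent_subspace_basis_family[OF P_subspace P_T] by blast
    have vT: "v \<in> T x" using v P_T by blast
    let ?p = "\<Sum>j<?a. \<epsilon> j v *\<^sub>R e j" and ?q = "\<Sum>j<manifold_dim - ?a. \<epsilon> (?a + j) v *\<^sub>R e (?a + j)"
    have split: "v = ?p + ?q"
      using expand[OF vT] sum_lessThan_add[of "\<lambda>j. \<epsilon> j v *\<^sub>R e j" ?a "manifold_dim - ?a"] le by simp
    have "?p \<in> P x" by (intro subspace_sum[OF P_subspace] subspace_scale[OF P_subspace] eP) simp
    then have "v - ?p \<in> P x" using v subspace_diff[OF P_subspace] by blast
    moreover have "v - ?p = ?q" using split by (simp add: algebra_simps)
    moreover have "?q \<in> Q x" using le by (intro subspace_sum[OF Q_subspace] subspace_scale[OF Q_subspace] eQ) auto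
    ultimately have "?q = 0" by (intro PQ_Int) (simp_all only:)
    then have vp: "v = ?p" using split by simp
    have "(\<Sum>j<manifold_dim. \<epsilon> j v *\<^sub>R e j) = (\<Sum>j<manifold_dim. (if j < ?a then \<epsilon> j v else 0) *\<^sub>R e j)"
      using expand[OF vT] vp sum_lessThan_add[of "\<lambda>j. (if j < ?a then \<epsilon> j v else 0) *\<^sub>R e j" ?a "manifold_dim - ?a"] le
      by simp
    from basis_family_unique[OF e this i(2)] i(1) show ?thesis by simp
  qed
  have onQ: "\<epsilon> i v = 0" if i: "i < ?a" and v: "v \<in> Q x" for i v
  proof -
    have vT: "v \<in> T x" using v Q_T by blast
    let ?p = "\<Sum>j<?a. \<epsilon> j v *\<^sub>R e j" and ?q = "\<Sum>j<manifold_dim - ?a. \<epsilon> (?a + j) v *\<^sub>R e (?a + j)"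
    have split: "v = ?p + ?q"
      using expand[OF vT] sum_lessThan_add[of "\<lambda>j. \<epsilon> j v *\<^sub>R e j" ?a "manifold_dim - ?a"] le by simp
    have "?q \<in> Q x" using le by (intro subspace_sum[OF Q_subspace] subspace_scale[OF Q_subspace] eQ) auto
    then have "v - ?q \<in> Q x" using v subspace_diff[OF Q_subspace] by blast
    moreover have "v - ?q = ?p" using split by (simp add: algebra_simps)
    moreover have "?p \<in> P x" by (intro subspace_sum[OF P_subspace] subspace_scale[OF P_subspace] eP) simp
    ultimately have "?p = 0" by (intro PQ_Int) (simp_all only:)
    then have vq: "v = ?q" using split by simp
    have "(\<Sum>j<manifold_dim. \<epsilon> j v *\<^sub>R e j) = (\<Sum>j<manifold_dim. (if j < ?a then 0 else \<epsilon> j v) *\<^sub>R e j)"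
      using expand[OF vT] vq sum_lessThan_add[of "\<lambda>j. (if j < ?a then 0 else \<epsilon> j v) *\<^sub>R e j" ?a "manifold_dim - ?a"] le
      by simp
    from basis_family_unique[OF e this, of i] i le show ?thesis by simp
  qed
  have inE': "(0, \<epsilon> i) \<in> E' x" if "?a \<le> i" "i < manifold_dim" for i
    using E'_covector[OF \<epsilon>T[OF that(2)]] onP[OF that] by blast
  \<comment> \<open>The element \<open>(0, \<epsilon> i)\<close> is decomposed orthogonally. Its two
    parts have opposite vector components, one in \<open>P x\<close> and one in \<open>Q x\<close>,
    so both are 0; and the covector \<open>\<epsilon> i - \<beta>\<close> of the second part
    vanishes on \<open>P x\<close> and on \<open>Q x\<close>.\<close>
  have inE: "(0, \<epsilon> i) \<in> E x" if i: "i < ?a" for i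
  proof -
    have im: "i < manifold_dim" using i le by simp
    have "(0, \<epsilon> i) \<in> TT x" using \<epsilon>T[OF im] subspace_0[OF subspace_tangent] by (simp add: gen_tangent_space_def)
    from orthogonal_decomposition[OF this] obtain u where u: "u \<in> E x" "(0, \<epsilon> i) - u \<in> E' x" by blast
    then have "fst u \<in> P x" "fst ((0, \<epsilon> i) - u) \<in> Q x" by blast+
    then have "fst u \<in> P x" "- fst u \<in> Q x" by simp_all
    then have "fst u = 0" using subspace_neg[OF Q_subspace, of "- fst u"] PQ_Int by simp
    then obtain \<beta> where \<beta>: "u = (0, \<beta>)" by (cases u) simp
    have \<beta>E: "(0, \<beta>) \<in> E x" using u(1) by (simp only: \<beta>)
    have dT: "\<epsilon> i - \<beta> \<in> TS x"
      using E_snd[OF \<beta>E] by (intro subspace_diff[OF subspace_cotangent \<epsilon>T[OF im]]) simp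
    have "(0, \<epsilon> i - \<beta>) \<in> E' x" using u(2) by (simp add: \<beta>)
    then have dP: "(\<epsilon> i - \<beta>) v = 0" if "v \<in> P x" for v using E'_covector[OF dT] that by blast
    have dQ: "(\<epsilon> i - \<beta>) v = 0" if "v \<in> Q x" for v
      using onQ[OF i that] E_covector_Q[OF \<beta>E that] by simp
    have "\<epsilon> i v = \<beta> v" for v
    proof (cases "v \<in> T x")
      case True
      have "(\<epsilon> i - \<beta>) (J x v + (v - J x v)) = 0"
        using linear_fun_on_add[OF cotangentD(1)[OF dT] J_T[OF True] J_T'[OF True]]
          dP[OF J_P[OF True]] dQ[OF J_Q[OF True]] by simp
      then show ?thesis by simp
    next
      case False
      then show ?thesis using cotangentD(2)[OF dT] by simp
    qed
    then have "\<epsilon> i = \<beta>" by (rule ext)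
    then show ?thesis using \<beta>E by simp
  qed
  show ?thesis
    by (rule that[of e \<epsilon>]; (rule e le | rule eP \<epsilon>T inE expand, assumption | rule eQ inE' dual, assumption, assumption))
qed

text \<open>The kernel of the projection on \<open>E x\<close> consists of the covectors in
  \<open>E x\<close>, for which the first \<open>dim (P x)\<close> dual covectors form a basis.
  Rank-nullity then reads \<open>2 * r = dim (P x) + dim (P x)\<close>.\<close>

lemma dim_P: "dim (P x) = r"
proof -
  let ?a = "dim (P x)" and ?K = "{e \<in> E x. fst e = 0}"
  obtain W s where "x \<in> W" "\<And>y. y \<in> W \<Longrightarrow> basis_family (E y) (2 * r) (\<lambda>i. s i y)" by (rule E_frame[of x]) blast
  then have s: "basis_family (E x) (2 * r) (\<lambda>i. s i x)" by blast
  note rn = rank_nullity[OF E_subspace s linear_fst]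
  obtain e \<epsilon> where e: "basis_family (T x) manifold_dim e" and eQ: "\<And>i. ?a \<le> i \<Longrightarrow> i < manifold_dim \<Longrightarrow> e i \<in> Q x"
    and le: "?a \<le> manifold_dim" and \<epsilon>E: "\<And>i. i < ?a \<Longrightarrow> (0, \<epsilon> i) \<in> E x"
    and ex: "\<And>v. v \<in> T x \<Longrightarrow> v = (\<Sum>i<manifold_dim. \<epsilon> i v *\<^sub>R e i)"
    and dual: "\<And>i j. i < manifold_dim \<Longrightarrow> j < manifold_dim \<Longrightarrow> \<epsilon> i (e j) = (if i = j then 1 else 0)"
    and \<epsilon>T: "\<And>i. i < manifold_dim \<Longrightarrow> \<epsilon> i \<in> TS x"
    by (rule adapted_dual_basis[of x]) blast
  have sum0: "(\<Sum>i<?a. c i *\<^sub>R (0 :: 'a tvec, \<epsilon> i)) = (0, \<Sum>i<?a. c i *\<^sub>R \<epsilon> i)" for c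
    by (simp add: prod_eq_iff fst_sum snd_sum)
  have "basis_family ?K ?a (\<lambda>i. (0, \<epsilon> i))"
    unfolding basis_family_def
  proof (intro conjI allI impI ballI)
    show "(0, \<epsilon> i) \<in> ?K" if "i < ?a" for i using \<epsilon>E that by simp
  next
    fix k assume k: "k \<in> ?K"
    have kT: "snd k \<in> TS x" using k E_snd by blast
    have k0: "k = (0, snd k)" using k by (simp add: prod_eq_iff)
    have kQ: "snd k v = 0" if "v \<in> Q x" for v using E_covector_Q[of "snd k" x v] k k0 that by simp
    have "snd k = (\<Sum>i<?a. snd k (e i) *\<^sub>R \<epsilon> i)"
    proof
      fix v
      show "snd k v = (\<Sum>i<?a. snd k (e i) *\<^sub>R \<epsilon> i) v"
      proof (cases "v \<in> T x")
        case True
        have "snd k v = snd k (\<Sum>i<manifold_dim. \<epsilon> i v *\<^sub>R e i)" using ex[OF True] by simp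
        also have "\<dots> = (\<Sum>i<manifold_dim. \<epsilon> i v * snd k (e i))"
          by (rule linear_fun_on_sum[OF cotangentD(1)[OF kT] subspace_tangent]) (use basis_family_in[OF e] in simp)
        also have "\<dots> = (\<Sum>i<?a. \<epsilon> i v * snd k (e i))"
          using sum_lessThan_add[of "\<lambda>i. \<epsilon> i v * snd k (e i)" ?a "manifold_dim - ?a"] le kQ[OF eQ] by simp
        finally show ?thesis by (simp add: sum_fun_apply scaleR_fun_def mult.commute)
      next
        case False
        then have "\<epsilon> i v = 0" if "i < ?a" for i using cotangentD(2)[OF \<epsilon>T] that le by simp
        then show ?thesis using cotangentD(2)[OF kT False] by (simp add: sum_fun_apply scaleR_fun_def)
      qed
    qed
    then have "k = (\<Sum>i<?a. snd k (e i) *\<^sub>R (0, \<epsilon> i))" using k0 sum0 by metis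
    then show "\<exists>c. k = (\<Sum>i<?a. c i *\<^sub>R (0, \<epsilon> i))" by (rule exI[of _ "\<lambda>i. snd k (e i)"])
  next
    fix c i assume 0: "(\<Sum>i<?a. c i *\<^sub>R (0, \<epsilon> i)) = 0" and i: "i < ?a"
    from arg_cong[OF 0, of snd] have "(\<Sum>i<?a. c i *\<^sub>R \<epsilon> i) = 0" by (simp add: snd_sum)
    from fun_cong[OF this, of "e i"] have "(\<Sum>j<?a. c j * \<epsilon> j (e i)) = 0"
      by (simp add: sum_fun_apply scaleR_fun_def)
    also have "(\<Sum>j<?a. c j * \<epsilon> j (e i)) = (\<Sum>j<?a. if j = i then c j else 0)"
      by (rule sum.cong) (use dual i le in auto)
    finally show "c i = 0" using i by simp
  qed
  moreover have "subspace ?K" using E_subspace[of x] by (auto simp: subspace_def)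
  ultimately have "dim ?K = ?a" using basis_family_dim by blast
  with rn(1) show ?thesis by simp
qed

text \<open>An adapted basis at \<open>x\<close> is extended to fields, which are projected by
  \<open>J\<close> and its complement. They still form a basis near \<open>x\<close>, because the
  matrix of their derivatives of the frame functions is invertible at \<open>x\<close>; the constant
  ranks come from \<open>dim_P\<close>.\<close>

lemma PQ_subbundle:
  shows "subbundle T (vector_field_on A) r P" and "subbundle T (vector_field_on A) (manifold_dim - r) Q"
proof -
  have main: "\<exists>W s. open W \<and> x \<in> W \<and> (\<forall>i<manifold_dim. s i \<in> VF) \<and> r \<le> manifold_dim \<and>
    (\<forall>y\<in>W. basis_family (P y) r (\<lambda>i. s i y)) \<and> (\<forall>y\<in>W. basis_family (Q y) (manifold_dim - r) (\<lambda>i. s (r + i) y))" for x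
  proof -
    obtain e where e: "basis_family (T x) manifold_dim e" and eP: "\<And>i. i < r \<Longrightarrow> e i \<in> P x"
      and eQ: "\<And>i. r \<le> i \<Longrightarrow> i < manifold_dim \<Longrightarrow> e i \<in> Q x" and le: "r \<le> manifold_dim"
      by (rule adapted_basis_family[of x, unfolded dim_P]) blast
    note eT = basis_family_in[OF e]
    \<comment> \<open>At \<open>x\<close> the projections change nothing, since \<open>e i\<close>
      already lies in \<open>P x\<close> or \<open>Q x\<close>; elsewhere they force the values into
      \<open>P\<close> and \<open>Q\<close>.\<close>
    define s where "s i = (if i < r then J_field (extension_field x (e i)) else extension_field x (e i) - J_field (extension_field x (e i)))" for i
    have sVF: "s i \<in> VF" if "i < manifold_dim" for i
      using extension_field_VF[OF eT[OF that]] J_field_VF by (auto simp: s_def)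
    have sP: "s i y \<in> P y" if "i < r" for i y
      using J_P[OF VF_T[OF extension_field_VF[OF eT[of i]]]] that le by (simp add: s_def J_field_def)
    have sQ: "s i y \<in> Q y" if "r \<le> i" "i < manifold_dim" for i y
      using J_Q[OF VF_T[OF extension_field_VF[OF eT[of i]]]] that by (simp add: s_def J_field_def)
    have sx: "s i x = e i" if i: "i < manifold_dim" for i
      using eP[of i] eQ[of i] i J_id J_zero by (cases "i < r") (simp_all add: s_def J_field_def extension_field_at[OF eT[OF i]])
    obtain W0 f F where W0: "x \<in> W0" and fr: "is_frame manifold_dim W0 f F" by (rule frame_at)
    have sm: "smooth_at x (\<lambda>y. s i y (f j))" if "i < manifold_dim" "j < manifold_dim" for i j
      using smooth_funsD[OF VF_C[OF sVF frame_fun[OF fr]]] that by simp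
    have ker: "\<forall>c. (\<forall>j<manifold_dim. (\<Sum>i<manifold_dim. c i * s i x (f j)) = 0) \<longrightarrow> (\<forall>i<manifold_dim. c i = 0)"
    proof (intro allI impI)
      fix c i assume 0: "\<forall>j<manifold_dim. (\<Sum>i<manifold_dim. c i * s i x (f j)) = 0" and i: "i < manifold_dim"
      let ?v = "\<Sum>i<manifold_dim. c i *\<^sub>R e i"
      have vT: "?v \<in> T x" by (intro tangent_lincomb) (use eT in auto)
      have "?v (f j) = 0" if "j < manifold_dim" for j
        using 0 that by (simp add: sum_fun_apply scaleR_fun_def sx)
      then have "?v = 0" using frame_expand[OF fr W0 vT] by simp
      then show "c i = 0" by (rule basis_family_indep[OF e _ i])
    qed
    obtain b where b: "\<forall>\<^sub>F y in nhds x. \<forall>i<manifold_dim. \<forall>j<manifold_dim. (\<Sum>k<manifold_dim. s i y (f k) * b y k j) = (if i = j then 1 else 0) \<and>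
      (\<Sum>k<manifold_dim. b y i k * s k y (f j)) = (if i = j then 1 else (0::real))"
      by (rule smooth_matrix_inverse[of manifold_dim x "\<lambda>y i j. s i y (f j)", OF sm ker]) blast
    from b obtain W1 where W1: "open W1" "x \<in> W1" "\<forall>y\<in>W1. \<forall>i<manifold_dim. \<forall>j<manifold_dim. (\<Sum>k<manifold_dim. s i y (f k) * b y k j) = (if i = j then 1 else 0) \<and>
      (\<Sum>k<manifold_dim. b y i k * s k y (f j)) = (if i = j then 1 else (0::real))"
      unfolding eventually_nhds by blast
    define W where "W = W0 \<inter> W1"
    have W: "open W" "x \<in> W" using W1 W0 frame_open[OF fr] by (auto simp: W_def)
    have basis: "basis_family (T y) manifold_dim (\<lambda>i. s i y)" if y: "y \<in> W" for y
      unfolding basis_family_def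
    proof (intro conjI allI impI ballI)
      have y0: "y \<in> W0" and y1: "y \<in> W1" using y by (auto simp: W_def)
      show "s i y \<in> T y" if "i < manifold_dim" for i using VF_T[OF sVF[OF that]] .
      show "\<exists>c. v = (\<Sum>i<manifold_dim. c i *\<^sub>R s i y)" if v: "v \<in> T y" for v
      proof -
        define c where "c i = (\<Sum>j<manifold_dim. v (f j) * b y j i)" for i
        define w where "w = v - (\<Sum>i<manifold_dim. c i *\<^sub>R s i y)"
        have wT: "w \<in> T y"
          unfolding w_def by (intro subspace_diff[OF subspace_tangent] v tangent_lincomb VF_T sVF) simp
        have "w (f k) = 0" if k: "k < manifold_dim" for k
        proof -
          have "(\<Sum>i<manifold_dim. c i * s i y (f k)) = (\<Sum>i<manifold_dim. \<Sum>j<manifold_dim. v (f j) * (b y j i * s i y (f k)))"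
            by (simp add: c_def sum_distrib_right mult.assoc)
          also have "\<dots> = (\<Sum>j<manifold_dim. v (f j) * (\<Sum>i<manifold_dim. b y j i * s i y (f k)))"
            by (subst sum.swap) (simp add: sum_distrib_left)
          also have "\<dots> = (\<Sum>j<manifold_dim. if j = k then v (f j) else 0)"
            by (rule sum.cong) (use W1(3) y1 k in auto)
          also have "\<dots> = v (f k)" using k by simp
          finally show ?thesis by (simp add: w_def sum_fun_apply scaleR_fun_def)
        qed
        then have "w = 0" using frame_expand[OF fr y0 wT] by simp
        then have "v = (\<Sum>i<manifold_dim. c i *\<^sub>R s i y)" by (simp add: w_def)
        then show ?thesis by (rule exI[of _ c])
      qed
      fix c i assume 0: "(\<Sum>i<manifold_dim. c i *\<^sub>R s i y) = 0" and i: "i < manifold_dim"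
      have z: "(\<Sum>l<manifold_dim. c l * s l y (f k)) = 0" for k
        using fun_cong[OF 0, of "f k"] by (simp add: sum_fun_apply scaleR_fun_def)
      have "c i = (\<Sum>l<manifold_dim. c l * (\<Sum>k<manifold_dim. s l y (f k) * b y k i))"
      proof -
        have "(\<Sum>l<manifold_dim. c l * (\<Sum>k<manifold_dim. s l y (f k) * b y k i)) = (\<Sum>l<manifold_dim. if l = i then c l else 0)"
          by (rule sum.cong) (use W1(3) y1 i in auto)
        then show ?thesis using i by simp
      qed
      also have "\<dots> = (\<Sum>l<manifold_dim. \<Sum>k<manifold_dim. c l * s l y (f k) * b y k i)"
        by (simp add: sum_distrib_left mult.assoc)
      also have "\<dots> = (\<Sum>k<manifold_dim. (\<Sum>l<manifold_dim. c l * s l y (f k)) * b y k i)"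
        by (subst sum.swap) (simp add: sum_distrib_right)
      also have "\<dots> = 0" by (simp add: z)
      finally show "c i = 0" .
    qed
    have split: "(\<Sum>i<manifold_dim. c i *\<^sub>R s i y) = (\<Sum>i<r. c i *\<^sub>R s i y) + (\<Sum>i<manifold_dim - r. c (r + i) *\<^sub>R s (r + i) y)" for c y
      using sum_lessThan_add[of "\<lambda>i. c i *\<^sub>R s i y" r "manifold_dim - r"] le by simp
    have inP: "(\<Sum>i<r. c i *\<^sub>R s i y) \<in> P y" for c y
      by (intro subspace_sum[OF P_subspace] subspace_scale[OF P_subspace] sP) simp
    have inQ: "(\<Sum>i<manifold_dim - r. c i *\<^sub>R s (r + i) y) \<in> Q y" for c y
      using le by (intro subspace_sum[OF Q_subspace] subspace_scale[OF Q_subspace] sQ) auto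
    have "basis_family (P y) r (\<lambda>i. s i y)" if y: "y \<in> W" for y
      unfolding basis_family_def
    proof (intro conjI allI impI ballI)
      show "s i y \<in> P y" if "i < r" for i by (rule sP[OF that])
      fix v assume v: "v \<in> P y"
      then have "v \<in> T y" using P_T by blast
      from basis_family_expand[OF basis[OF y] this] obtain c where c: "v = (\<Sum>i<manifold_dim. c i *\<^sub>R s i y)" by blast
      let ?p = "\<Sum>i<r. c i *\<^sub>R s i y"
      have "v - ?p \<in> P y" using v inP subspace_diff[OF P_subspace] by blast
      moreover have "v - ?p \<in> Q y" using inQ[of "\<lambda>i. c (r + i)" y] by (simp add: c split)
      ultimately have "v - ?p = 0" by (rule PQ_Int)
      then have "v = ?p" by simp
      then show "\<exists>c. v = (\<Sum>i<r. c i *\<^sub>R s i y)" by (rule exI[of _ c])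
    next
      fix c i assume 0: "(\<Sum>i<r. c i *\<^sub>R s i y) = 0" and i: "i < r"
      have "(\<Sum>i<manifold_dim. (if i < r then c i else 0) *\<^sub>R s i y) = 0"
        using 0 by (simp add: split)
      from basis_family_indep[OF basis[OF y] this, of i] i le show "c i = 0" by simp
    qed
    moreover have "basis_family (Q y) (manifold_dim - r) (\<lambda>i. s (r + i) y)" if y: "y \<in> W" for y
      unfolding basis_family_def
    proof (intro conjI allI impI ballI)
      show "s (r + i) y \<in> Q y" if "i < manifold_dim - r" for i using sQ[of "r + i"] that by simp
      fix v assume v: "v \<in> Q y"
      then have "v \<in> T y" using Q_T by blast
      from basis_family_expand[OF basis[OF y] this] obtain c where c: "v = (\<Sum>i<manifold_dim. c i *\<^sub>R s i y)" by blast
      let ?q = "\<Sum>i<manifold_dim - r. c (r + i) *\<^sub>R s (r + i) y"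
      have "v - ?q \<in> Q y" using v inQ[of "\<lambda>i. c (r + i)" y] subspace_diff[OF Q_subspace] by blast
      moreover have "v - ?q \<in> P y" using inP[of c y] by (simp add: c split)
      ultimately have "v - ?q = 0" using PQ_Int by blast
      then have "v = ?q" by simp
      then show "\<exists>c. v = (\<Sum>i<manifold_dim - r. c i *\<^sub>R s (r + i) y)" by (rule exI[of _ "\<lambda>i. c (r + i)"])
    next
      fix c i assume 0: "(\<Sum>i<manifold_dim - r. c i *\<^sub>R s (r + i) y) = 0" and i: "i < manifold_dim - r"
      have "(\<Sum>i<manifold_dim. (if i < r then 0 else c (i - r)) *\<^sub>R s i y) = 0"
        using 0 by (simp add: split)
      from basis_family_indep[OF basis[OF y] this, of "r + i"] i show "c i = 0" by simp
    qed
    ultimately show ?thesis using W sVF le by (intro exI[of _ W] exI[of _ s] conjI) auto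
  qed
  have VFon: "X \<in> VF \<Longrightarrow> vector_field_on A W X" for X W
    using smooth_fun_on_subset[OF _ subset_UNIV] by (auto simp: vector_fields_def vector_field_on_def)
  show "subbundle T (vector_field_on A) r P"
    unfolding subbundle_def
  proof (intro conjI allI P_subspace P_T)
    fix x
    from main[of x] obtain W s where W: "open W" "x \<in> W" "\<forall>i<manifold_dim. s i \<in> VF" "r \<le> manifold_dim"
      "\<forall>y\<in>W. basis_family (P y) r (\<lambda>i. s i y)" by (elim exE conjE)
    then show "\<exists>W s. open W \<and> x \<in> W \<and> (\<forall>i<r. vector_field_on A W (s i)) \<and>
        (\<forall>y\<in>W. inj_on (\<lambda>i. s i y) {..<r} \<and> independent ((\<lambda>i. s i y) ` {..<r}) \<and> span ((\<lambda>i. s i y) ` {..<r}) = P y)"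
      by (intro exI[of _ W] exI[of _ s]) (simp add: VFon basis_family_iff[OF P_subspace])
  qed
  show "subbundle T (vector_field_on A) (manifold_dim - r) Q"
    unfolding subbundle_def
  proof (intro conjI allI Q_subspace Q_T)
    fix x
    from main[of x] obtain W s where W: "open W" "x \<in> W" "\<forall>i<manifold_dim. s i \<in> VF" "r \<le> manifold_dim"
      "\<forall>y\<in>W. basis_family (Q y) (manifold_dim - r) (\<lambda>i. s (r + i) y)" by (elim exE conjE)
    then show "\<exists>W s. open W \<and> x \<in> W \<and> (\<forall>i<manifold_dim - r. vector_field_on A W (s i)) \<and>
        (\<forall>y\<in>W. inj_on (\<lambda>i. s i y) {..<manifold_dim - r} \<and> independent ((\<lambda>i. s i y) ` {..<manifold_dim - r}) \<and>
          span ((\<lambda>i. s i y) ` {..<manifold_dim - r}) = Q y)"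
      by (intro exI[of _ W] exI[of _ "\<lambda>i. s (r + i)"]) (simp add: VFon basis_family_iff[OF Q_subspace])
  qed
qed

end

section \<open>Bidegree components\<close>

text \<open>Each argument \<open>v\<close> is split as \<open>J v + (v - J v)\<close>, and the terms
  with exactly \<open>p\<close> factors \<open>J v\<close> are collected. The degree is an integer
  because the recursion may lower it below 0, where everything vanishes.\<close>

primrec component :: "('v::real_vector \<Rightarrow> 'v) \<Rightarrow> 'v list \<Rightarrow> int \<Rightarrow> ('v list \<Rightarrow> real) \<Rightarrow> real" where
  "component J [] p F = (if p = 0 then F [] else 0)"
| "component J (v # vs) p F = component J vs (p - 1) (\<lambda>w. F (J v # w)) + component J vs p (\<lambda>w. F ((v - J v) # w))"

text \<open>The index counts the entries taken from \<open>P\<close>. The sets need not be disjoint: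
  the zero vector may be counted either way, which is harmless for multilinear functions.\<close>

inductive adapted :: "'v set \<Rightarrow> 'v set \<Rightarrow> int \<Rightarrow> 'v list \<Rightarrow> bool" for P Q where
  adapted_Nil: "adapted P Q 0 []"
| adapted_P: "v \<in> P \<Longrightarrow> adapted P Q p vs \<Longrightarrow> adapted P Q (p + 1) (v # vs)"
| adapted_Q: "v \<in> Q \<Longrightarrow> adapted P Q p vs \<Longrightarrow> adapted P Q p (v # vs)"

definition pure :: "'v set \<Rightarrow> 'v set \<Rightarrow> nat \<Rightarrow> int \<Rightarrow> ('v list \<Rightarrow> real) \<Rightarrow> bool" where
  "pure P Q k p F \<longleftrightarrow> (\<forall>p' w. adapted P Q p' w \<longrightarrow> length w = k \<longrightarrow> p' \<noteq> p \<longrightarrow> F w = 0)"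

lemma pureD: "pure P Q k p F \<Longrightarrow> adapted P Q p' w \<Longrightarrow> length w = k \<Longrightarrow> p' \<noteq> p \<Longrightarrow> F w = 0"
  by (simp add: pure_def)

lemma component_range: "p < 0 \<or> int (length vs) < p \<Longrightarrow> component J vs p F = 0"
proof (induction vs arbitrary: p F)
  case (Cons v vs)
  then have "p - 1 < 0 \<or> int (length vs) < p - 1" "p < 0 \<or> int (length vs) < p" by auto
  from Cons.IH[OF this(1)] Cons.IH[OF this(2)] show ?case by simp
qed auto

lemma component_add: "component J vs p (\<lambda>w. F w + G w) = component J vs p F + component J vs p G"
  by (induction vs arbitrary: p F G) simp_all

lemma component_scale: "component J vs p (\<lambda>w. a * F w) = a * component J vs p F"
  by (induction vs arbitrary: p F) (simp_all add: algebra_simps)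

lemma component_zero [simp]: "component J vs p (\<lambda>w. 0) = 0"
  using component_scale[of J vs p 0 "\<lambda>w. 0"] by simp

lemma component_sum: "component J vs p (\<lambda>w. \<Sum>i\<in>I. F i w) = (\<Sum>i\<in>I. component J vs p (F i))"
  by (induction I rule: infinite_finite_induct) (simp_all add: component_add)

text \<open>Linear algebra in one fibre; \<open>splitting_J\<close> applies it to the tangent space
  at each point.\<close>

locale splitting =
  fixes V P Q :: "'v::real_vector set" and J :: "'v \<Rightarrow> 'v"
  assumes V: "subspace V" and PV: "P \<subseteq> V" and QV: "Q \<subseteq> V"
    and JP: "v \<in> V \<Longrightarrow> J v \<in> P" and JQ: "v \<in> V \<Longrightarrow> v - J v \<in> Q"
    and J_on_P: "v \<in> P \<Longrightarrow> J v = v" and J_on_Q: "v \<in> Q \<Longrightarrow> J v = 0"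
    and J_lin: "u \<in> V \<Longrightarrow> v \<in> V \<Longrightarrow> J (a *\<^sub>R u + b *\<^sub>R v) = a *\<^sub>R J u + b *\<^sub>R J v"
begin

lemma JV: "v \<in> V \<Longrightarrow> J v \<in> V" and JV': "v \<in> V \<Longrightarrow> v - J v \<in> V"
  by (auto intro: subsetD[OF PV] subsetD[OF QV] JP JQ)

lemma adapted_V: "adapted P Q p vs \<Longrightarrow> vs \<in> lists V"
  by (induction rule: adapted.induct) (auto intro: subsetD[OF PV] subsetD[OF QV])

lemma component_cong:
  "vs \<in> lists V \<Longrightarrow> (\<And>w. w \<in> lists V \<Longrightarrow> length w = length vs \<Longrightarrow> F w = G w) \<Longrightarrow> component J vs p F = component J vs p G"
proof (induction vs arbitrary: p F G)
  case (Cons v vs)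
  have "component J vs (p - 1) (\<lambda>w. F (J v # w)) = component J vs (p - 1) (\<lambda>w. G (J v # w))"
    "component J vs p (\<lambda>w. F ((v - J v) # w)) = component J vs p (\<lambda>w. G ((v - J v) # w))"
    by (rule Cons.IH; use Cons.prems JV JV' in auto)+
  then show ?case by simp
qed simp

lemma component_eq_0:
  "vs \<in> lists V \<Longrightarrow> (\<And>w. w \<in> lists V \<Longrightarrow> length w = length vs \<Longrightarrow> F w = 0) \<Longrightarrow> component J vs p F = 0"
  using component_cong[of vs F "\<lambda>w. 0" p] by simp

lemma altmul_head_zero:
  assumes "altmul V (Suc k) F" "w \<in> lists V" "length w = k"
  shows "F (0 # w) = 0"
  using linear_fun_on_zero[OF altmul_linear[OF V assms] subspace_0[OF V]] .

lemma altmul_head_split: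
  assumes "altmul V (Suc k) F" "w \<in> lists V" "length w = k" "v \<in> V"
  shows "F (J v # w) + F ((v - J v) # w) = F (v # w)"
  using linear_fun_on_add[OF altmul_linear[OF V assms(1-3)] JV[OF assms(4)] JV'[OF assms(4)]] by simp

text \<open>The set \<open>S\<close> may be any finite superset of the possible degrees, because the
  recursion shifts the range of summation by 1 and leaves terms that are 0.\<close>

lemma component_total:
  "altmul V k F \<Longrightarrow> vs \<in> lists V \<Longrightarrow> length vs = k \<Longrightarrow> finite S \<Longrightarrow> {0..int k} \<subseteq> S \<Longrightarrow> (\<Sum>p\<in>S. component J vs p F) = F vs"
proof (induction k arbitrary: F vs S)
  case 0
  then have "(\<Sum>p\<in>S. component J vs p F) = (\<Sum>p\<in>S. if p = 0 then F vs else 0)" by (intro sum.cong) auto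
  also have "\<dots> = F vs" using 0 by simp
  finally show ?case .
next
  case (Suc k)
  from Suc.prems obtain v w where vs: "vs = v # w" "v \<in> V" "w \<in> lists V" "length w = k" by (cases vs) auto
  note F = Suc.prems(1)
  have "(\<Sum>p\<in>S. component J w (p - 1) (\<lambda>w. F (J v # w))) = (\<Sum>p\<in>(\<lambda>p. p - 1) ` S. component J w p (\<lambda>w. F (J v # w)))"
    by (subst sum.reindex) (auto simp: inj_on_def)
  also have "\<dots> = F (J v # w)"
  proof (rule Suc.IH[OF altmul_contract[OF V F JV[OF vs(2)]] vs(3,4)])
    show "{0..int k} \<subseteq> (\<lambda>p. p - 1) ` S"
    proof
      fix p assume "p \<in> {0..int k}"
      then have "p + 1 \<in> S" using Suc.prems(5) by auto
      then show "p \<in> (\<lambda>p. p - 1) ` S" by (rule rev_image_eqI) simp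
    qed
  qed (use Suc.prems in simp)
  finally have 1: "(\<Sum>p\<in>S. component J w (p - 1) (\<lambda>w. F (J v # w))) = F (J v # w)" .
  have 2: "(\<Sum>p\<in>S. component J w p (\<lambda>w. F ((v - J v) # w))) = F ((v - J v) # w)"
    by (rule Suc.IH[OF altmul_contract[OF V F JV'[OF vs(2)]] vs(3,4)]) (use Suc.prems in auto)
  have "(\<Sum>p\<in>S. component J vs p F) = F (J v # w) + F ((v - J v) # w)"
    by (simp add: vs(1) sum.distrib 1 2)
  then show ?case using altmul_head_split[OF F vs(3,4,2)] vs(1) by simp
qed

text \<open>Unfolding \<open>component\<close> evaluates \<open>F\<close> only on lists of vectors
  from \<open>P\<close> and \<open>Q\<close> in which exactly \<open>p\<close> entries come from
  \<open>P\<close>.\<close>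

lemma component_vanish:
  "vs \<in> lists V \<Longrightarrow> (\<And>w. adapted P Q p w \<Longrightarrow> length w = length vs \<Longrightarrow> F w = 0) \<Longrightarrow> component J vs p F = 0"
proof (induction vs arbitrary: p F)
  case Nil
  then show ?case using adapted_Nil by auto
next
  case (Cons v vs)
  then have v: "v \<in> V" "vs \<in> lists V" by auto
  have "component J vs (p - 1) (\<lambda>w. F (J v # w)) = 0"
    by (rule Cons.IH[OF v(2)]) (use Cons.prems(2) adapted_P[OF JP[OF v(1)], where p = "p - 1"] in auto)
  moreover have "component J vs p (\<lambda>w. F ((v - J v) # w)) = 0"
    by (rule Cons.IH[OF v(2)]) (use Cons.prems(2) adapted_Q[OF JQ[OF v(1)]] in auto)
  ultimately show ?case by simp
qed

text \<open>On an entry from \<open>P\<close> the summand with \<open>v - J v\<close> contains 0, on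
  an entry from \<open>Q\<close> the one with \<open>J v\<close> does; so a single summand
  survives.\<close>

lemma component_adapted:
  "adapted P Q p vs \<Longrightarrow> altmul V (length vs) F \<Longrightarrow> component J vs p' F = (if p' = p then F vs else 0)"
proof (induction arbitrary: F p' rule: adapted.induct)
  case adapted_Nil
  then show ?case by simp
next
  case (adapted_P v p vs)
  have v: "v \<in> V" "vs \<in> lists V" using adapted_P PV adapted_V by auto
  have F: "altmul V (Suc (length vs)) F" using adapted_P.prems by simp
  have "component J vs p' (\<lambda>w. F (0 # w)) = 0"
    by (rule component_eq_0[OF v(2)]) (rule altmul_head_zero[OF F])
  moreover have "component J vs (p' - 1) (\<lambda>w. F (v # w)) = (if p' - 1 = p then F (v # vs) else 0)"
    by (rule adapted_P.IH[OF altmul_contract[OF V F v(1)]])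
  ultimately show ?case using J_on_P[OF adapted_P.hyps(1)] by auto
next
  case (adapted_Q v p vs)
  have v: "v \<in> V" "vs \<in> lists V" using adapted_Q QV adapted_V by auto
  have F: "altmul V (Suc (length vs)) F" using adapted_Q.prems by simp
  have "component J vs (p' - 1) (\<lambda>w. F (0 # w)) = 0"
    by (rule component_eq_0[OF v(2)]) (rule altmul_head_zero[OF F])
  moreover have "component J vs p' (\<lambda>w. F (v # w)) = (if p' = p then F (v # vs) else 0)"
    by (rule adapted_Q.IH[OF altmul_contract[OF V F v(1)]])
  ultimately show ?case using J_on_Q[OF adapted_Q.hyps(1)] by auto
qed

text \<open>For two equal arguments the mixed terms, with \<open>J v\<close> and
  \<open>v - J v\<close> in either order, occur in the same degree and cancel by antisymmetry; the
  unmixed ones vanish since \<open>F\<close> alternates.\<close>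

lemma component_altmul: "altmul V k F \<Longrightarrow> altmul V k (\<lambda>vs. component J vs p F)"
proof (induction k arbitrary: F p)
  case (Suc k)
  note F = Suc.prems
  have "altmul V k (\<lambda>w. component J (v # w) p F)" if v: "v \<in> V" for v
    unfolding component.simps
    by (intro altmul_add[OF V] Suc.IH altmul_contract[OF V F] JV JV' v)
  moreover have "linear_fun_on V (\<lambda>v. component J (v # w) p F)" if w: "w \<in> lists V" "length w = k" for w
    unfolding linear_fun_on_def
  proof (intro ballI allI)
    fix u v a b assume uv: "u \<in> V" "v \<in> V"
    have lin: "F ((a *\<^sub>R x + b *\<^sub>R y) # t) = a * F (x # t) + b * F (y # t)"
      if "x \<in> V" "y \<in> V" "t \<in> lists V" "length t = length w" for x y t
      using linear_fun_onD[OF altmul_linear[OF V F that(3)] that(1,2)] that(4) w(2) by simp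
    have 1: "component J w (p - 1) (\<lambda>t. F (J (a *\<^sub>R u + b *\<^sub>R v) # t)) =
        component J w (p - 1) (\<lambda>t. a * F (J u # t) + b * F (J v # t))"
      by (rule component_cong[OF w(1)]) (simp only: J_lin[OF uv] lin JV uv)
    have eq: "a *\<^sub>R u + b *\<^sub>R v - J (a *\<^sub>R u + b *\<^sub>R v) = a *\<^sub>R (u - J u) + b *\<^sub>R (v - J v)"
      by (simp add: J_lin[OF uv] scaleR_diff_right)
    have 2: "component J w p (\<lambda>t. F ((a *\<^sub>R u + b *\<^sub>R v - J (a *\<^sub>R u + b *\<^sub>R v)) # t)) =
        component J w p (\<lambda>t. a * F ((u - J u) # t) + b * F ((v - J v) # t))"
      by (rule component_cong[OF w(1)]) (simp only: eq lin JV' uv)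
    show "component J ((a *\<^sub>R u + b *\<^sub>R v) # w) p F = a * component J (u # w) p F + b * component J (v # w) p F"
      unfolding component.simps 1 2 component_add component_scale by (simp add: algebra_simps)
  qed
  moreover have "component J (v # v # w) p F = 0" if v: "v \<in> V" and w: "w \<in> lists V" "Suc (length w) = k" for v w
  proof -
    note F2 = F[folded w(2)]
    have 1: "component J w q (\<lambda>t. F (x # x # t)) = 0" if "x \<in> V" for x q
      by (rule component_eq_0[OF w(1)]) (rule altmul_same[OF V F2 that]; simp)
    have "component J w q (\<lambda>t. F (J v # (v - J v) # t)) = component J w q (\<lambda>t. - 1 * F ((v - J v) # J v # t))" for q
    proof (rule component_cong[OF w(1)])
      fix t assume "t \<in> lists V" "length t = length w"
      from altmul_swap[OF V F2 JV[OF v] JV'[OF v] this]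
      show "F (J v # (v - J v) # t) = - 1 * F ((v - J v) # J v # t)" by simp
    qed
    then have "component J w q (\<lambda>t. F (J v # (v - J v) # t)) = - component J w q (\<lambda>t. F ((v - J v) # J v # t))" for q
      by (simp add: component_scale[of J w q "- 1", simplified])
    then show ?thesis using 1[OF JV[OF v]] 1[OF JV'[OF v]] by simp
  qed
  ultimately show ?case by simp
qed simp

lemma component_pure: "altmul V k F \<Longrightarrow> pure P Q k p (\<lambda>vs. component J vs p F)"
  unfolding pure_def using component_adapted by auto

text \<open>All other components vanish, and the sum of all components is \<open>F\<close>.\<close>

lemma pure_component:
  assumes F: "altmul V k F" "pure P Q k p F" and vs: "vs \<in> lists V" "length vs = k"
  shows "component J vs p' F = (if p' = p then F vs else 0)"
proof -
  have off: "component J vs q F = 0" if "q \<noteq> p" for q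
    by (rule component_vanish[OF vs(1)]) (use pureD[OF F(2)] that vs(2) in auto)
  have "(\<Sum>q\<in>insert p {0..int k}. component J vs q F) = F vs"
    by (rule component_total[OF F(1) vs]) auto
  moreover have "(\<Sum>q\<in>insert p {0..int k}. component J vs q F) = (\<Sum>q\<in>insert p {0..int k}. if q = p then component J vs p F else 0)"
    by (rule sum.cong) (auto simp: off)
  ultimately have "component J vs p F = F vs" by simp
  then show ?thesis using off by auto
qed

end

text \<open>The sum runs over all index lists, not only increasing ones; the repetition is accounted
  for by the factor \<open>1 / fact k\<close> in \<open>alternating_wedge_expand\<close>.\<close>

lemma altmul_multilinear_expand:
  assumes V: "subspace V" and e: "\<And>i. i < n \<Longrightarrow> e i \<in> V" and ex: "\<And>v. v \<in> V \<Longrightarrow> v = (\<Sum>i<n. \<epsilon> i v *\<^sub>R e i)"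
  shows "altmul V k F \<Longrightarrow> vs \<in> lists V \<Longrightarrow> length vs = k \<Longrightarrow>
    F vs = (\<Sum>I | set I \<subseteq> {..<n} \<and> length I = k. (\<Prod>i<k. \<epsilon> (I ! i) (vs ! i)) * F (map e I))"
proof (induction k arbitrary: F vs)
  case 0
  have "{I. set I \<subseteq> {..<n} \<and> length I = 0} = {[]}" by auto
  then show ?case using 0 by simp
next
  case (Suc k)
  from Suc.prems obtain v w where vs: "vs = v # w" "v \<in> V" "w \<in> lists V" "length w = k" by (cases vs) auto
  note F = Suc.prems(1)
  let ?L = "\<lambda>k. {I. set I \<subseteq> {..<n} \<and> length I = k}"
  have img: "?L (Suc k) = (\<lambda>(i, I). i # I) ` ({..<n} \<times> ?L k)"
    by (force simp: length_Suc_conv)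
  have "F (v # w) = F ((\<Sum>i<n. \<epsilon> i v *\<^sub>R e i) # w)" using ex[OF vs(2)] by simp
  also have "\<dots> = (\<Sum>i<n. \<epsilon> i v * F (e i # w))"
    by (rule linear_fun_on_sum[OF altmul_linear[OF V F vs(3,4)] V]) (use e in simp)
  also have "\<dots> = (\<Sum>i<n. \<Sum>I\<in>?L k. \<epsilon> i v * ((\<Prod>j<k. \<epsilon> (I ! j) (w ! j)) * F (e i # map e I)))"
  proof (rule sum.cong[OF refl])
    fix i assume "i \<in> {..<n}"
    then have "e i \<in> V" using e by simp
    from Suc.IH[OF altmul_contract[OF V F this] vs(3,4)]
    show "\<epsilon> i v * F (e i # w) = (\<Sum>I\<in>?L k. \<epsilon> i v * ((\<Prod>j<k. \<epsilon> (I ! j) (w ! j)) * F (e i # map e I)))"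
      by (simp add: sum_distrib_left)
  qed
  also have "\<dots> = (\<Sum>(i, I)\<in>{..<n} \<times> ?L k. \<epsilon> i v * ((\<Prod>j<k. \<epsilon> (I ! j) (w ! j)) * F (e i # map e I)))"
    by (rule sum.cartesian_product)
  also have "\<dots> = (\<Sum>I\<in>?L (Suc k). (\<Prod>i<Suc k. \<epsilon> (I ! i) (vs ! i)) * F (map e I))"
    unfolding img
    by (subst sum.reindex)
      (auto simp: inj_on_def vs(1) prod.lessThan_Suc_shift mult.assoc simp del: prod.lessThan_Suc intro!: sum.cong)
  finally show ?case by (simp add: vs(1))
qed

lemma altmul_transpose:
  assumes V: "subspace V" and F: "altmul V k F" and vs: "vs \<in> lists V" "length vs = k" and ab: "a < k" "b < k" "a \<noteq> b"
  shows "F (permute_list (Transposition.transpose a b) vs) = - F vs"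
proof -
  define H where "H u v = F (vs[a := u, b := v])" for u v
  have in1: "vs[a := u] \<in> lists V" if "u \<in> V" for u
    using vs(1) that set_update_subset_insert[of vs a u] by (auto simp: in_lists_conv_set)
  have in2: "vs[b := u] \<in> lists V" if "u \<in> V" for u
    using vs(1) that set_update_subset_insert[of vs b u] by (auto simp: in_lists_conv_set)
  have lin2: "linear_fun_on V (\<lambda>v. H u v)" if "u \<in> V" for u
    unfolding H_def by (rule altmul_linear_slot[OF V F in1[OF that]]) (use vs ab in auto)
  have lin1: "linear_fun_on V (\<lambda>u. H u v)" if "v \<in> V" for v
    using altmul_linear_slot[OF V F in2[OF that], of a] vs ab by (simp add: H_def list_update_swap)
  have same: "H u u = 0" if "u \<in> V" for u
  proof -
    have l: "vs[a := u, b := u] \<in> lists V"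
      using in1[OF that] that set_update_subset_insert[of "vs[a := u]" b u] by (auto simp: in_lists_conv_set)
    show ?thesis
      unfolding H_def
    proof (cases "a < b")
      case True
      show "F (vs[a := u, b := u]) = 0"
        by (rule altmul_eq_zero[OF V F l _ True ab(2)]) (use vs ab in auto)
    next
      case False
      then have "b < a" using ab by simp
      show "F (vs[a := u, b := u]) = 0"
        by (rule altmul_eq_zero[OF V F l _ \<open>b < a\<close> ab(1)]) (use vs ab in auto)
    qed
  qed
  have av: "vs ! a \<in> V" "vs ! b \<in> V" using vs ab by (auto simp: in_lists_conv_set)
  then have s: "vs ! a + vs ! b \<in> V" using subspace_add[OF V] by blast
  have "0 = H (vs ! a + vs ! b) (vs ! a + vs ! b)" using same[OF s] by simp
  also have "\<dots> = H (vs ! a) (vs ! b) + H (vs ! b) (vs ! a)"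
    using linear_fun_on_add[OF lin1[OF s] av] linear_fun_on_add[OF lin2[OF av(1)] av]
      linear_fun_on_add[OF lin2[OF av(2)] av] same av by simp
  finally have "H (vs ! b) (vs ! a) = - H (vs ! a) (vs ! b)" by linarith
  moreover have "permute_list (Transposition.transpose a b) vs = vs[a := vs ! b, b := vs ! a]"
    using vs ab by (intro nth_equalityI) (auto simp: permute_list_def nth_list_update Transposition.transpose_def)
  ultimately show ?thesis by (simp add: H_def)
qed

lemma altmul_permute:
  assumes V: "subspace V" and F: "altmul V k F" and \<sigma>: "\<sigma> permutes {..<k}"
  shows "vs \<in> lists V \<Longrightarrow> length vs = k \<Longrightarrow> F (permute_list \<sigma> vs) = of_int (sign \<sigma>) * F vs"
  using finite_lessThan[of k] \<sigma>
proof (induction arbitrary: vs rule: permutes_rev_induct)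
  case id
  then show ?case by simp
next
  case (swap a b p)
  have tr: "Transposition.transpose a b permutes {..<length vs}" using swap by (intro permutes_swap_id) auto
  have p: "p permutes {..<length vs}" using swap by simp
  have "permute_list (p \<circ> Transposition.transpose a b) vs = permute_list (Transposition.transpose a b) (permute_list p vs)"
    by (rule permute_list_compose[OF tr])
  moreover have "permute_list p vs \<in> lists V"
    using swap.prems set_permute_list[OF p] by (simp add: in_lists_conv_set)
  then have "F (permute_list (Transposition.transpose a b) (permute_list p vs)) = - F (permute_list p vs)"
    using swap by (intro altmul_transpose[OF V F]) auto
  moreover have "sign (p \<circ> Transposition.transpose a b) = - sign p"
    using swap permutes_imp_permutation[OF finite_lessThan] by (simp add: sign_compose permutation_swap_id sign_swap_id)
  ultimately show ?case
    using swap.IH[OF swap.prems] by (simp only: of_int_minus mult_minus_left)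
qed

section \<open>Expansion of alternating forms in wedge products\<close>

context manifold
begin

text \<open>Substituting \<open>\<sigma> \<circ> \<tau>\<close> for the summation variable moves the
  permutation from the covectors to the vectors and costs the sign of \<open>\<tau>\<close>.\<close>

lemma wedge_permute:
  assumes \<tau>: "\<tau> permutes {..<length \<alpha>s}"
  shows "wedge A x (permute_list \<tau> \<alpha>s) = (\<lambda>vs. of_int (sign \<tau>) * wedge A x \<alpha>s vs)"
proof
  fix vs
  let ?k = "length \<alpha>s"
  show "wedge A x (permute_list \<tau> \<alpha>s) vs = of_int (sign \<tau>) * wedge A x \<alpha>s vs"
  proof (cases "vs \<in> tangent_lists A ?k x")
    case True
    have fin: "permutation \<tau>" by (rule permutes_imp_permutation[OF _ \<tau>]) simp
    have "wedge A x (permute_list \<tau> \<alpha>s) vs =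
        (\<Sum>\<sigma> | \<sigma> permutes {..<?k}. of_int (sign \<sigma>) * (\<Prod>i<?k. (\<alpha>s ! \<tau> i) (vs ! \<sigma> i)))"
      using True \<tau> by (simp add: wedge_def permute_list_nth)
    also have "\<dots> = (\<Sum>\<sigma> | \<sigma> permutes {..<?k}. of_int (sign (\<sigma> \<circ> \<tau>)) * (\<Prod>i<?k. (\<alpha>s ! \<tau> i) (vs ! (\<sigma> \<circ> \<tau>) i)))"
      by (rule sum_permutations_compose_right[OF \<tau>])
    also have "\<dots> = (\<Sum>\<sigma> | \<sigma> permutes {..<?k}. of_int (sign \<tau>) * (of_int (sign \<sigma>) * (\<Prod>i<?k. (\<alpha>s ! i) (vs ! \<sigma> i))))"
    proof (rule sum.cong[OF refl])
      fix \<sigma> assume "\<sigma> \<in> {\<sigma>. \<sigma> permutes {..<?k}}"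
      then have \<sigma>: "permutation \<sigma>" using permutes_imp_permutation[of "{..<?k}" \<sigma>] by simp
      have "(\<Prod>i<?k. (\<alpha>s ! i) (vs ! \<sigma> i)) = (\<Prod>i<?k. (\<alpha>s ! \<tau> i) (vs ! (\<sigma> \<circ> \<tau>) i))"
        using prod.permute[OF \<tau>, of "\<lambda>i. (\<alpha>s ! i) (vs ! \<sigma> i)"] by (simp add: o_def)
      then show "of_int (sign (\<sigma> \<circ> \<tau>)) * (\<Prod>i<?k. (\<alpha>s ! \<tau> i) (vs ! (\<sigma> \<circ> \<tau>) i)) =
          of_int (sign \<tau>) * (of_int (sign \<sigma>) * (\<Prod>i<?k. (\<alpha>s ! i) (vs ! \<sigma> i)))"
        by (simp add: sign_compose[OF \<sigma> fin])
    qed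
    also have "\<dots> = of_int (sign \<tau>) * wedge A x \<alpha>s vs"
      using True by (simp add: wedge_def sum_distrib_left)
    finally show ?thesis .
  next
    case False
    then show ?thesis by (simp add: wedge_def)
  qed
qed

text \<open>The multilinear expansion is applied to every permutation of \<open>vs\<close> and
  averaged with signs. The left side is unchanged as \<open>\<eta>\<close> alternates, and the
  products add up to \<open>wedge\<close>, a determinant without normalising factor, so division by
  \<open>fact k\<close> is the right weight.\<close>

lemma alternating_wedge_expand:
  assumes e: "\<And>i. i < n \<Longrightarrow> e i \<in> T x" and ex: "\<And>v. v \<in> T x \<Longrightarrow> v = (\<Sum>i<n. \<epsilon> i v *\<^sub>R e i)"
    and \<eta>: "\<eta> \<in> alternating_forms A k x"
  shows "\<eta> = (\<Sum>I | set I \<subseteq> {..<n} \<and> length I = k. (\<eta> (map e I) / fact k) *\<^sub>R wedge A x (map \<epsilon> I))"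
proof
  fix vs
  let ?L = "{I. set I \<subseteq> {..<n} \<and> length I = k}" and ?S = "{\<sigma>. \<sigma> permutes {..<k}}"
  have altmul: "altmul (T x) k \<eta>" and undef: "vs \<notin> tangent_lists A k x \<Longrightarrow> \<eta> vs = 0"
    using \<eta> by (auto simp: alternating_forms_iff)
  show "\<eta> vs = (\<Sum>I\<in>?L. (\<eta> (map e I) / fact k) *\<^sub>R wedge A x (map \<epsilon> I)) vs"
  proof (cases "vs \<in> tangent_lists A k x")
    case True
    then have vs: "vs \<in> lists (T x)" "length vs = k" by (auto simp: tangent_lists_iff)
    have perm: "(\<Sum>I\<in>?L. (\<Prod>i<k. \<epsilon> (I ! i) (vs ! \<sigma> i)) * \<eta> (map e I)) = of_int (sign \<sigma>) * \<eta> vs"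
      if \<sigma>: "\<sigma> \<in> ?S" for \<sigma>
    proof -
      have \<sigma>': "\<sigma> permutes {..<length vs}" using \<sigma> vs by simp
      have l: "permute_list \<sigma> vs \<in> lists (T x)"
        using vs(1) set_permute_list[OF \<sigma>'] by (simp add: in_lists_conv_set)
      have "of_int (sign \<sigma>) * \<eta> vs = \<eta> (permute_list \<sigma> vs)"
        using altmul_permute[OF subspace_tangent altmul _ vs] \<sigma> by simp
      also have "\<dots> = (\<Sum>I\<in>?L. (\<Prod>i<k. \<epsilon> (I ! i) (permute_list \<sigma> vs ! i)) * \<eta> (map e I))"
        by (rule altmul_multilinear_expand[OF subspace_tangent e ex altmul l]) (use vs in simp_all)
      also have "\<dots> = (\<Sum>I\<in>?L. (\<Prod>i<k. \<epsilon> (I ! i) (vs ! \<sigma> i)) * \<eta> (map e I))"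
        using \<sigma>' vs(2) by (simp add: permute_list_nth)
      finally show ?thesis ..
    qed
    have "(\<Sum>I\<in>?L. (\<eta> (map e I) / fact k) *\<^sub>R wedge A x (map \<epsilon> I)) vs =
        (\<Sum>I\<in>?L. \<eta> (map e I) / fact k * (\<Sum>\<sigma>\<in>?S. of_int (sign \<sigma>) * (\<Prod>i<k. \<epsilon> (I ! i) (vs ! \<sigma> i))))"
      using True by (simp add: sum_fun_apply scaleR_fun_def wedge_def)
    also have "\<dots> = (\<Sum>I\<in>?L. \<Sum>\<sigma>\<in>?S. of_int (sign \<sigma>) / fact k * ((\<Prod>i<k. \<epsilon> (I ! i) (vs ! \<sigma> i)) * \<eta> (map e I)))"
      by (simp add: sum_distrib_left mult_ac)
    also have "\<dots> = (\<Sum>\<sigma>\<in>?S. of_int (sign \<sigma>) / fact k * (\<Sum>I\<in>?L. (\<Prod>i<k. \<epsilon> (I ! i) (vs ! \<sigma> i)) * \<eta> (map e I)))"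
      by (subst sum.swap) (simp add: sum_distrib_left)
    also have "\<dots> = (\<Sum>\<sigma>\<in>?S. of_int (sign \<sigma>) / fact k * (of_int (sign \<sigma>) * \<eta> vs))"
      by (intro sum.cong refl arg_cong2[where f = "(*)"] perm)
    also have "\<dots> = (\<Sum>\<sigma>\<in>?S. \<eta> vs / fact k)"
      by (intro sum.cong refl) (simp add: sign_def)
    also have "\<dots> = \<eta> vs"
      using card_permutations[of "{..<k}" k] by simp
    finally show ?thesis ..
  next
    case False
    then have "wedge A x (map \<epsilon> I) vs = 0" if "I \<in> ?L" for I using that by (simp add: wedge_def)
    then show ?thesis using undef[OF False] by (simp add: sum_fun_apply scaleR_fun_def)
  qed
qed

end

text \<open>The inductive count becomes a set of positions, which can be compared with the image of
  a permutation in \<open>wedge_pure\<close>.\<close>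

lemma adapted_index_set:
  "adapted P Q p w \<Longrightarrow> \<exists>S\<subseteq>{..<length w}. int (card S) = p \<and> (\<forall>i<length w. if i \<in> S then w ! i \<in> P else w ! i \<in> Q)"
proof (induction rule: adapted.induct)
  case adapted_Nil
  then show ?case by simp
next
  case (adapted_P v p vs)
  then obtain S where S: "S \<subseteq> {..<length vs}" "int (card S) = p"
    "\<And>i. i < length vs \<Longrightarrow> if i \<in> S then vs ! i \<in> P else vs ! i \<in> Q" by blast
  have fin: "finite S" using S(1) finite_subset by blast
  show ?case
  proof (intro exI[of _ "insert 0 (Suc ` S)"] conjI allI impI)
    show "int (card (insert 0 (Suc ` S))) = p + 1" using fin S(2) by (simp add: card_image)
    show "if i \<in> insert 0 (Suc ` S) then (v # vs) ! i \<in> P else (v # vs) ! i \<in> Q" if "i < length (v # vs)" for i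
      using S(3)[of "i - 1"] that adapted_P.hyps(1) by (cases i) (auto split: if_splits)
  qed (use S(1) in auto)
next
  case (adapted_Q v p vs)
  then obtain S where S: "S \<subseteq> {..<length vs}" "int (card S) = p"
    "\<And>i. i < length vs \<Longrightarrow> if i \<in> S then vs ! i \<in> P else vs ! i \<in> Q" by blast
  show ?case
  proof (intro exI[of _ "Suc ` S"] conjI allI impI)
    show "int (card (Suc ` S)) = p" using S(2) by (simp add: card_image)
    show "if i \<in> Suc ` S then (v # vs) ! i \<in> P else (v # vs) ! i \<in> Q" if "i < length (v # vs)" for i
      using S(3)[of "i - 1"] that adapted_Q.hyps(1) by (cases i) (auto split: if_splits)
  qed (use S(1) in auto)
qed

lemma adapted_map:
  assumes "\<And>i. i \<in> set I \<Longrightarrow> R i \<Longrightarrow> e i \<in> P" "\<And>i. i \<in> set I \<Longrightarrow> \<not> R i \<Longrightarrow> e i \<in> Q"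
  shows "adapted P Q (int (length (filter R I))) (map e I)"
  using assms
proof (induction I)
  case (Cons i I)
  then have "adapted P Q (int (length (filter R I))) (map e I)" by simp
  then show ?case
    using Cons.prems adapted_P[of "e i" P Q "int (length (filter R I))"] adapted_Q[of "e i" Q P "int (length (filter R I))"]
    by (auto simp: add.commute)
qed (simp add: adapted_Nil)

section \<open>Bigraded forms as forms with prescribed zeros\<close>

context gproduct
begin

lemma splitting_J: "splitting (T x) (P x) (Q x) (J x)"
  by (rule splitting.intro[OF subspace_tangent P_T Q_T J_P J_Q J_id J_zero J_linear])

text \<open>In a nonzero product the permutation must send the positions of the covectors from
  \<open>E\<close> onto the positions of the vectors from \<open>P\<close>, since these covectors
  vanish on \<open>Q\<close> and the others on \<open>P\<close>. The two numbers therefore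
  agree.\<close>

lemma wedge_pure:
  assumes \<alpha>: "set \<alpha>s \<subseteq> cotangent_part A E x" and \<beta>: "set \<beta>s \<subseteq> cotangent_part A E' x"
  shows "pure (P x) (Q x) (length \<alpha>s + length \<beta>s) (int (length \<alpha>s)) (wedge A x (\<alpha>s @ \<beta>s))"
  unfolding pure_def
proof (intro allI impI)
  fix p' w assume w: "adapted (P x) (Q x) p' w" "length w = length \<alpha>s + length \<beta>s" "p' \<noteq> int (length \<alpha>s)"
  let ?k = "length \<alpha>s + length \<beta>s"
  obtain S where S: "S \<subseteq> {..<?k}" "int (card S) = p'"
    "\<And>i. i < ?k \<Longrightarrow> if i \<in> S then w ! i \<in> P x else w ! i \<in> Q x"
    using adapted_index_set[OF w(1)] w(2) by auto
  have "(\<Prod>i<?k. ((\<alpha>s @ \<beta>s) ! i) (w ! \<sigma> i)) = 0" if \<sigma>: "\<sigma> permutes {..<?k}" for \<sigma>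
  proof (rule ccontr)
    assume nz: "(\<Prod>i<?k. ((\<alpha>s @ \<beta>s) ! i) (w ! \<sigma> i)) \<noteq> 0"
    then have nz': "((\<alpha>s @ \<beta>s) ! i) (w ! \<sigma> i) \<noteq> 0" if "i < ?k" for i using that by simp
    have \<sigma>k: "\<sigma> i < ?k" if "i < ?k" for i using permutes_in_image[OF \<sigma>] that by simp
    have 1: "\<sigma> i \<in> S" if i: "i < length \<alpha>s" for i
    proof (rule ccontr)
      assume "\<sigma> i \<notin> S"
      then have "w ! \<sigma> i \<in> Q x" using S(3)[OF \<sigma>k, of i] i by simp
      moreover have "(0, \<alpha>s ! i) \<in> E x" using \<alpha> i by (auto simp: cotangent_part_def dest!: nth_mem)
      ultimately have "(\<alpha>s ! i) (w ! \<sigma> i) = 0" using E_covector_Q by blast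
      with nz'[of i] i show False by (simp add: nth_append)
    qed
    have 2: "\<sigma> i \<notin> S" if i: "length \<alpha>s \<le> i" "i < ?k" for i
    proof
      assume "\<sigma> i \<in> S"
      then have "w ! \<sigma> i \<in> P x" using S(3)[OF \<sigma>k, of i] i by simp
      moreover have "\<beta>s ! (i - length \<alpha>s) \<in> cotangent_part A E' x" using \<beta> i by (auto dest!: nth_mem)
      then have "\<beta>s ! (i - length \<alpha>s) \<in> TS x" "(0, \<beta>s ! (i - length \<alpha>s)) \<in> E' x"
        by (auto simp: cotangent_part_def)
      ultimately have "(\<beta>s ! (i - length \<alpha>s)) (w ! \<sigma> i) = 0" using E'_covector by blast
      with nz'[of i] i show False by (simp add: nth_append)
    qed
    have "\<sigma> ` {..<length \<alpha>s} = S"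
    proof (intro antisym subsetI)
      fix j assume j: "j \<in> S"
      then have "j \<in> \<sigma> ` {..<?k}" using permutes_image[OF \<sigma>] S(1) by auto
      then obtain i where i: "i < ?k" "j = \<sigma> i" by auto
      then have "i < length \<alpha>s" using 2[of i] j by (meson not_le)
      with i show "j \<in> \<sigma> ` {..<length \<alpha>s}" by simp
    qed (use 1 in auto)
    then have "card S = length \<alpha>s"
      using card_image[OF inj_on_subset[OF permutes_inj[OF \<sigma>] subset_UNIV], of "{..<length \<alpha>s}"] by simp
    with S(2) w(3) show False by simp
  qed
  then have "(\<Sum>\<sigma> | \<sigma> permutes {..<?k}. of_int (sign \<sigma>) * (\<Prod>i<?k. ((\<alpha>s @ \<beta>s) ! i) (w ! \<sigma> i))) = 0"
    by (intro sum.neutral ballI) (simp del: prod_zero_iff)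
  then show "wedge A x (\<alpha>s @ \<beta>s) w = 0" by (simp add: wedge_def del: prod_zero_iff)
qed

text \<open>The condition on the right is preserved by linear combinations and holds for the
  generators. Conversely \<open>\<eta>\<close> is expanded in an adapted dual basis, where only
  index lists with exactly \<open>p\<close> indices below \<open>dim (P x)\<close> have nonzero
  coefficients.\<close>

lemma bigraded_fibre_pure:
  assumes \<eta>: "\<eta> \<in> alternating_forms A (p + q) x"
  shows "\<eta> \<in> bigraded_fibre A E p q x \<longleftrightarrow> pure (P x) (Q x) (p + q) (int p) \<eta>"
proof
  let ?G = "{wedge A x (\<alpha>s @ \<beta>s) | \<alpha>s \<beta>s. length \<alpha>s = p \<and> set \<alpha>s \<subseteq> cotangent_part A E x \<and>
     length \<beta>s = q \<and> set \<beta>s \<subseteq> cotangent_part A E' x}"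
  assume "\<eta> \<in> bigraded_fibre A E p q x"
  then have "\<eta> \<in> span ?G" by (simp only: bigraded_fibre_def)
  moreover have "span ?G \<subseteq> {F. pure (P x) (Q x) (p + q) (int p) F}"
  proof (rule span_minimal)
    show "subspace {F. pure (P x) (Q x) (p + q) (int p) F}"
      by (auto simp: subspace_def pure_def scaleR_fun_def)
    show "?G \<subseteq> {F. pure (P x) (Q x) (p + q) (int p) F}" using wedge_pure by auto
  qed
  ultimately show "pure (P x) (Q x) (p + q) (int p) \<eta>" by blast
next
  assume pure: "pure (P x) (Q x) (p + q) (int p) \<eta>"
  obtain e \<epsilon> where e: "basis_family (T x) manifold_dim e" and eP: "\<And>i. i < dim (P x) \<Longrightarrow> e i \<in> P x"
    and eQ: "\<And>i. dim (P x) \<le> i \<Longrightarrow> i < manifold_dim \<Longrightarrow> e i \<in> Q x" and \<epsilon>T: "\<And>i. i < manifold_dim \<Longrightarrow> \<epsilon> i \<in> TS x"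
    and \<epsilon>E: "\<And>i. i < dim (P x) \<Longrightarrow> (0, \<epsilon> i) \<in> E x" and \<epsilon>E': "\<And>i. dim (P x) \<le> i \<Longrightarrow> i < manifold_dim \<Longrightarrow> (0, \<epsilon> i) \<in> E' x"
    and ex: "\<And>v. v \<in> T x \<Longrightarrow> v = (\<Sum>i<manifold_dim. \<epsilon> i v *\<^sub>R e i)"
    by (rule adapted_dual_basis[of x]) blast
  let ?R = "\<lambda>i. i < dim (P x)"
  have "(\<Sum>I | set I \<subseteq> {..<manifold_dim} \<and> length I = p + q. (\<eta> (map e I) / fact (p + q)) *\<^sub>R wedge A x (map \<epsilon> I))
      \<in> bigraded_fibre A E p q x"
    unfolding bigraded_fibre_def
  proof (rule span_sum)
    fix I assume "I \<in> {I. set I \<subseteq> {..<manifold_dim} \<and> length I = p + q}"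
    then have I: "set I \<subseteq> {..<manifold_dim}" "length I = p + q" by auto
    let ?G = "{wedge A x (\<alpha>s @ \<beta>s) | \<alpha>s \<beta>s. length \<alpha>s = p \<and> set \<alpha>s \<subseteq> cotangent_part A E x \<and>
     length \<beta>s = q \<and> set \<beta>s \<subseteq> cotangent_part A E' x}"
    show "(\<eta> (map e I) / fact (p + q)) *\<^sub>R wedge A x (map \<epsilon> I) \<in> span ?G"
    proof (cases "length (filter ?R I) = p")
      case False
      have "adapted (P x) (Q x) (int (length (filter ?R I))) (map e I)"
        by (rule adapted_map) (use I eP eQ in auto)
      from pureD[OF pure this] False I have "\<eta> (map e I) = 0" by simp
      then show ?thesis by (simp add: span_zero)
    next
      case True
      \<comment> \<open>Generators have the covectors from \<open>E\<close> in front; sorting the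
        indices accordingly changes the wedge product only by a sign.\<close>
      define I' where "I' = filter ?R I @ filter (\<lambda>i. \<not> ?R i) I"
      have len: "length (filter (\<lambda>i. \<not> ?R i) I) = q"
        using sum_length_filter_compl[of ?R I] True I by simp
      have "mset I = mset I'" by (simp add: I'_def)
      then obtain \<sigma> where \<sigma>: "\<sigma> permutes {..<length I'}" "permute_list \<sigma> I' = I"
        by (rule mset_eq_permutation)
      have "map \<epsilon> I = permute_list \<sigma> (map \<epsilon> I')"
        using \<sigma> by (metis permute_list_map)
      then have w: "wedge A x (map \<epsilon> I) = of_int (sign \<sigma>) *\<^sub>R wedge A x (map \<epsilon> I')"
        using wedge_permute[of \<sigma> "map \<epsilon> I'" x] \<sigma>(1) by (simp add: scaleR_fun_def)
      have "wedge A x (map \<epsilon> I') \<in> ?G"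
      proof (intro CollectI exI conjI)
        show "wedge A x (map \<epsilon> I') = wedge A x (map \<epsilon> (filter ?R I) @ map \<epsilon> (filter (\<lambda>i. \<not> ?R i) I))"
          by (simp add: I'_def)
        show "set (map \<epsilon> (filter ?R I)) \<subseteq> cotangent_part A E x"
          using \<epsilon>E \<epsilon>T I by (auto simp: cotangent_part_def)
        show "set (map \<epsilon> (filter (\<lambda>i. \<not> ?R i) I)) \<subseteq> cotangent_part A E' x"
          using \<epsilon>E' \<epsilon>T I by (auto simp: cotangent_part_def)
      qed (use True len in auto)
      then show ?thesis unfolding w by (intro span_scale span_base)
    qed
  qed
  then show "\<eta> \<in> bigraded_fibre A E p q x"
    using alternating_wedge_expand[OF basis_family_in[OF e] ex \<eta>] by simp
qed

definition form_component :: "nat \<Rightarrow> int \<Rightarrow> 'a form \<Rightarrow> 'a form" where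
  "form_component k p \<omega> = (\<lambda>x vs. if vs \<in> tangent_lists A k x then component (J x) vs p (\<omega> x) else 0)"

text \<open>The splitting of an argument is carried out on fields: both \<open>J_field X\<close> and
  \<open>X - J_field X\<close> are smooth, so the induction stays within forms and vector
  fields.\<close>

lemma component_smooth:
  "\<omega> \<in> forms A k \<Longrightarrow> Zs \<in> lists VF \<Longrightarrow> length Zs = k \<Longrightarrow>
    (\<lambda>x. component (J x) (map (\<lambda>X. X x) Zs) p (\<omega> x)) \<in> C"
proof (induction Zs arbitrary: \<omega> k p)
  case Nil
  then show ?case using forms_smooth[of \<omega> 0 "[]"] by (cases "p = 0") (auto simp: on_fields_def smooth_funs_const)
next
  case (Cons X Zs)
  have X: "X \<in> VF" "Zs \<in> lists VF" and \<omega>: "\<omega> \<in> forms A (Suc (length Zs))" using Cons.prems by auto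
  have 1: "(\<lambda>x. component (J x) (map (\<lambda>X. X x) Zs) (p - 1) (\<lambda>w. \<omega> x (J_field X x # w))) \<in> C"
    by (rule Cons.IH[OF forms_contract[OF \<omega> J_field_VF[OF X(1)]] X(2) refl])
  have 2: "(\<lambda>x. component (J x) (map (\<lambda>X. X x) Zs) p (\<lambda>w. \<omega> x ((X - J_field X) x # w))) \<in> C"
    by (rule Cons.IH[OF forms_contract[OF \<omega> J_field_compl_VF[OF X(1)]] X(2) refl])
  from smooth_funs_add[OF 1 2] show ?case by (simp add: J_field_def)
qed

lemma form_component_forms:
  assumes \<omega>: "\<omega> \<in> forms A k"
  shows "form_component k p \<omega> \<in> forms A k"
  unfolding forms_iff
proof (intro conjI allI impI ballI)
  show "altmul (T x) k (form_component k p \<omega> x)" for x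
    by (rule altmul_cong[OF subspace_tangent splitting.component_altmul[OF splitting_J forms_altmul[OF \<omega>]]])
      (simp add: form_component_def tangent_lists_iff)
  show "form_component k p \<omega> x vs = 0" if "vs \<notin> tangent_lists A k x" for x vs
    using that by (simp add: form_component_def)
  fix Zs assume Zs: "Zs \<in> lists VF" "length Zs = k"
  have "on_fields (form_component k p \<omega>) Zs = (\<lambda>x. component (J x) (map (\<lambda>X. X x) Zs) p (\<omega> x))"
    using map_VF_lists[OF Zs(1)] Zs(2) by (simp add: on_fields_def form_component_def tangent_lists_iff)
  then show "on_fields (form_component k p \<omega>) Zs \<in> C" using component_smooth[OF \<omega> Zs] by simp
qed

definition pure_form :: "nat \<Rightarrow> int \<Rightarrow> 'a form \<Rightarrow> bool" where
  "pure_form k p \<omega> \<longleftrightarrow> \<omega> \<in> forms A k \<and> (\<forall>x. pure (P x) (Q x) k p (\<omega> x))"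

lemma form_component_pure_form: "\<omega> \<in> forms A k \<Longrightarrow> pure_form k p (form_component k p \<omega>)"
  using splitting.component_pure[OF splitting_J forms_altmul] form_component_forms
  by (auto simp: pure_form_def pure_def form_component_def)

lemma form_eqI:
  assumes "\<And>x vs. vs \<notin> tangent_lists A k x \<Longrightarrow> \<omega> x vs = 0" "\<And>x vs. vs \<notin> tangent_lists A k x \<Longrightarrow> \<eta> x vs = 0"
    "\<And>x vs. vs \<in> lists (T x) \<Longrightarrow> length vs = k \<Longrightarrow> \<omega> x vs = \<eta> x vs"
  shows "\<omega> = (\<eta> :: 'a form)"
  using assms by (intro ext) (metis tangent_lists_iff)

lemma form_component_pure:
  assumes "pure_form k p \<omega>"
  shows "form_component k p' \<omega> = (if p' = p then \<omega> else 0)"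
proof (rule form_eqI[of k])
  have \<omega>: "\<omega> \<in> forms A k" using assms by (simp add: pure_form_def)
  show "form_component k p' \<omega> x vs = 0" "(if p' = p then \<omega> else 0) x vs = 0" if "vs \<notin> tangent_lists A k x" for x vs
    using that forms_undef[OF \<omega>] by (auto simp: form_component_def)
  fix x vs assume vs: "vs \<in> lists (T x)" "length vs = k"
  have "pure (P x) (Q x) k p (\<omega> x)" using assms by (simp add: pure_form_def)
  from splitting.pure_component[OF splitting_J forms_altmul[OF \<omega>] this vs]
  show "form_component k p' \<omega> x vs = (if p' = p then \<omega> else 0) x vs"
    using vs by (simp add: form_component_def tangent_lists_iff)
qed

lemma form_component_sum: "form_component k p (\<Sum>i\<in>I. \<omega> i) = (\<Sum>i\<in>I. form_component k p (\<omega> i))"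
proof (intro ext)
  fix x vs
  have "(\<Sum>i\<in>I. \<omega> i) x = (\<lambda>w. \<Sum>i\<in>I. \<omega> i x w)" by (simp add: sum_fun_apply fun_eq_iff)
  then show "form_component k p (\<Sum>i\<in>I. \<omega> i) x vs = (\<Sum>i\<in>I. form_component k p (\<omega> i)) x vs"
    by (simp add: sum_fun_apply form_component_def component_sum)
qed

lemma form_component_total:
  assumes \<omega>: "\<omega> \<in> forms A k" and "finite S" "{0..int k} \<subseteq> S"
  shows "\<omega> = (\<Sum>p\<in>S. form_component k p \<omega>)"
proof (rule form_eqI[of k])
  show "\<omega> x vs = 0" "(\<Sum>p\<in>S. form_component k p \<omega>) x vs = 0" if "vs \<notin> tangent_lists A k x" for x vs
    using that forms_undef[OF \<omega>] by (simp_all add: sum_fun_apply form_component_def)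
  fix x vs assume vs: "vs \<in> lists (T x)" "length vs = k"
  then show "\<omega> x vs = (\<Sum>p\<in>S. form_component k p \<omega>) x vs"
    using splitting.component_total[OF splitting_J forms_altmul[OF \<omega>] vs assms(2,3)]
    by (simp add: sum_fun_apply form_component_def tangent_lists_iff)
qed

lemma bigraded_forms_iff: "i \<le> k \<Longrightarrow> \<omega> \<in> bigraded_forms A E i (k - i) \<longleftrightarrow> pure_form k (int i) \<omega>"
proof -
  assume "i \<le> k"
  then have k: "i + (k - i) = k" by simp
  have "\<omega> x \<in> bigraded_fibre A E i (k - i) x \<longleftrightarrow> pure (P x) (Q x) k (int i) (\<omega> x)" if "\<omega> \<in> forms A k" for x
    using bigraded_fibre_pure[of "\<omega> x" i "k - i" x] that unfolding k by (simp add: forms_def)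
  then show ?thesis unfolding bigraded_forms_def pure_form_def k by blast
qed

text \<open>The components of \<open>form_component\<close> are one decomposition into bigraded
  forms. For uniqueness the projection is applied to an arbitrary decomposition and keeps exactly
  the summand of its own degree. Outside the range of degrees both sides are 0.\<close>

lemma bidegree_component_eq:
  assumes \<omega>: "\<omega> \<in> forms A k"
  shows "bidegree_component A E k p \<omega> = form_component k p \<omega>"
proof (cases "0 \<le> p \<and> p \<le> int k")
  case False
  have "form_component k p \<omega> = 0"
  proof (intro ext)
    fix x vs
    show "form_component k p \<omega> x vs = 0 x vs"
      using component_range[of p vs "J x" "\<omega> x"] False by (auto simp: form_component_def tangent_lists_iff)
  qed
  then show ?thesis using False by (simp only: bidegree_component_def if_False)
next
  case True
  have un: "\<eta> = form_component k p \<omega>"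
    if c: "\<forall>i\<le>k. c i \<in> bigraded_forms A E i (k - i)" "\<omega> = (\<Sum>i\<le>k. c i)" "\<eta> = c (nat p)" for c \<eta>
  proof -
    have "form_component k p \<omega> = (\<Sum>i\<le>k. form_component k p (c i))" by (simp add: c(2) form_component_sum)
    also have "\<dots> = (\<Sum>i\<le>k. if i = nat p then c i else 0)"
      by (rule sum.cong) (use c(1) True bigraded_forms_iff form_component_pure in auto)
    also have "\<dots> = c (nat p)" using True nat_le_iff[of p k] by simp
    finally show ?thesis using c(3) by simp
  qed
  have "\<omega> = (\<Sum>i\<le>k. form_component k (int i) \<omega>)"
  proof -
    have "(\<Sum>i\<le>k. form_component k (int i) \<omega>) = (\<Sum>p\<in>int ` {..k}. form_component k p \<omega>)"
      by (subst sum.reindex) (auto simp: inj_on_def)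
    also have "int ` {..k} = {0..int k}" by (auto simp: image_iff intro!: bexI[of _ "nat _"])
    finally show ?thesis using form_component_total[OF \<omega>, of "{0..int k}"] by simp
  qed
  moreover have "\<forall>i\<le>k. form_component k (int i) \<omega> \<in> bigraded_forms A E i (k - i)"
    using form_component_pure_form[OF \<omega>] bigraded_forms_iff by simp
  ultimately have ex: "\<exists>c. (\<forall>i\<le>k. c i \<in> bigraded_forms A E i (k - i)) \<and> \<omega> = (\<Sum>i\<le>k. c i) \<and> form_component k p \<omega> = c (nat p)"
    using True by (intro exI[of _ "\<lambda>i. form_component k (int i) \<omega>"]) simp
  have "(THE \<eta>. \<exists>c. (\<forall>i\<le>k. c i \<in> bigraded_forms A E i (k - i)) \<and> \<omega> = (\<Sum>i\<le>k. c i) \<and> \<eta> = c (nat p)) = form_component k p \<omega>"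
  proof (rule the_equality, rule ex)
    fix \<eta> assume "\<exists>c. (\<forall>i\<le>k. c i \<in> bigraded_forms A E i (k - i)) \<and> \<omega> = (\<Sum>i\<le>k. c i) \<and> \<eta> = c (nat p)"
    then show "\<eta> = form_component k p \<omega>" using un by (elim exE conjE) blast
  qed
  then show ?thesis using True by (simp add: bidegree_component_def)
qed

end

section \<open>The operator d_E\<close>

context manifold
begin

lemma forms_zero: "0 \<in> forms A k"
proof -
  have "on_fields 0 Zs = (\<lambda>x. 0)" for Zs :: "'a vfield list" by (simp add: on_fields_def)
  then show ?thesis by (simp add: forms_iff altmul_zero[OF subspace_tangent] zero_fun_def smooth_funs_const)
qed

lemma forms_add:
  assumes "\<omega> \<in> forms A k" "\<eta> \<in> forms A k"
  shows "\<omega> + \<eta> \<in> forms A k"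
proof -
  have "(\<omega> + \<eta>) x = (\<lambda>vs. \<omega> x vs + \<eta> x vs)" for x by (simp add: fun_eq_iff)
  then have "altmul (T x) k ((\<omega> + \<eta>) x)" for x
    using altmul_add[OF subspace_tangent forms_altmul forms_altmul, OF assms] by simp
  moreover have "on_fields (\<omega> + \<eta>) Zs \<in> C" if "Zs \<in> lists VF" "length Zs = k" for Zs
    using smooth_funs_add[OF forms_smooth forms_smooth, OF assms(1) that assms(2) that] by (simp add: on_fields_def)
  ultimately show ?thesis using assms by (simp add: forms_iff)
qed

lemma forms_sum: "(\<And>i. i \<in> I \<Longrightarrow> \<omega> i \<in> forms A k) \<Longrightarrow> (\<Sum>i\<in>I. \<omega> i) \<in> forms A k"
  by (induction I rule: infinite_finite_induct) (auto intro: forms_add forms_zero)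

lemma forms_valued: "\<omega> \<in> forms A k \<Longrightarrow> valued k (on_fields \<omega>)"
  by (rule fields_altmul_valued[OF forms_fields_altmul])

lemma de_rham_add:
  assumes "\<omega> \<in> forms A k" "\<eta> \<in> forms A k"
  shows "de_rham A k (\<omega> + \<eta>) = de_rham A k \<omega> + de_rham A k \<eta>"
proof (rule forms_eqI)
  show "de_rham A k (\<omega> + \<eta>) \<in> forms A (Suc k)" "de_rham A k \<omega> + de_rham A k \<eta> \<in> forms A (Suc k)"
    by (intro forms_add de_rham_forms assms)+
  fix Zs x assume Zs: "Zs \<in> lists VF" "length Zs = Suc k"
  have h: "on_fields (\<omega> + \<eta>) = (\<lambda>Zs x. on_fields \<omega> Zs x + on_fields \<eta> Zs x)" by (simp add: on_fields_def fun_eq_iff)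
  have "on_fields (de_rham A k (\<omega> + \<eta>)) Zs x = ext_der A Zs (\<lambda>Zs x. on_fields \<omega> Zs x + on_fields \<eta> Zs x) x"
    using de_rham_on_fields[OF forms_add[OF assms] Zs] by (simp only: h)
  also have "\<dots> = ext_der A Zs (on_fields \<omega>) x + ext_der A Zs (on_fields \<eta>) x"
    by (rule ext_der_add[OF Zs(1)]) (use forms_valued assms Zs(2) in auto)
  also have "\<dots> = on_fields (de_rham A k \<omega> + de_rham A k \<eta>) Zs x"
    using de_rham_on_fields[OF assms(1) Zs] de_rham_on_fields[OF assms(2) Zs] by (simp add: on_fields_def fun_eq_iff)
  finally show "on_fields (de_rham A k (\<omega> + \<eta>)) Zs x = on_fields (de_rham A k \<omega> + de_rham A k \<eta>) Zs x" .
qed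

lemma de_rham_zero: "de_rham A k 0 = 0"
  using de_rham_add[OF forms_zero forms_zero, of k] by simp

lemma de_rham_de_rham:
  assumes "\<omega> \<in> forms A k"
  shows "de_rham A (Suc k) (de_rham A k \<omega>) = 0"
proof (rule forms_eqI)
  show "de_rham A (Suc k) (de_rham A k \<omega>) \<in> forms A (Suc (Suc k))" "0 \<in> forms A (Suc (Suc k))"
    by (intro de_rham_forms assms forms_zero)+
  fix Zs x assume Zs: "Zs \<in> lists VF" "length Zs = Suc (Suc k)"
  have "on_fields (de_rham A (Suc k) (de_rham A k \<omega>)) Zs x = ext_der A Zs (on_fields (de_rham A k \<omega>)) x"
    using de_rham_on_fields[OF de_rham_forms[OF assms] Zs] by simp
  also have "ext_der A Zs (on_fields (de_rham A k \<omega>)) = ext_der A Zs (\<lambda>Ws. ext_der A Ws (on_fields \<omega>))"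
    by (rule ext_der_cong[OF Zs(1)]) (use de_rham_on_fields[OF assms] Zs(2) in simp)
  also have "ext_der A Zs (\<lambda>Ws. ext_der A Ws (on_fields \<omega>)) x = 0"
    by (rule ext_der_ext_der[OF Zs(1) forms_fields_altmul[OF assms] Zs(2)])
  finally show "on_fields (de_rham A (Suc k) (de_rham A k \<omega>)) Zs x = on_fields 0 Zs x" by (simp add: on_fields_def)
qed

end

section \<open>Bidegrees of the exterior derivative\<close>

context gproduct
begin

definition PF :: "'a vfield set" where "PF = {X \<in> VF. \<forall>x. X x \<in> P x}"
definition QF :: "'a vfield set" where "QF = {X \<in> VF. \<forall>x. X x \<in> Q x}"

lemma J_field_PF: "X \<in> VF \<Longrightarrow> J_field X \<in> PF"
  using J_field_VF J_P[OF VF_T] by (simp add: PF_def J_field_def)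

lemma J_field_QF: "X \<in> VF \<Longrightarrow> X - J_field X \<in> QF"
  using J_field_compl_VF J_Q[OF VF_T] by (simp add: QF_def J_field_def)

lemma adapted_VF: "adapted PF QF p Zs \<Longrightarrow> Zs \<in> lists VF"
  by (induction rule: adapted.induct) (auto simp: PF_def QF_def)

lemma adapted_at: "adapted PF QF p Zs \<Longrightarrow> adapted (P x) (Q x) p (map (\<lambda>X. X x) Zs)"
  by (induction rule: adapted.induct) (auto simp: PF_def QF_def intro: adapted.intros)

text \<open>Tangent vectors are extended to global fields and then projected to \<open>P\<close> or
  \<open>Q\<close>. So bidegrees, which are conditions on vectors, can be tested on sections, to
  which the bracket formulas apply.\<close>

lemma adapted_extend:
  "adapted (P x) (Q x) p w \<Longrightarrow> \<exists>Zs. adapted PF QF p Zs \<and> map (\<lambda>X. X x) Zs = w"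
proof (induction rule: adapted.induct)
  case adapted_Nil
  then show ?case using adapted.adapted_Nil by fastforce
next
  case (adapted_P v p vs)
  then obtain Zs where Zs: "adapted PF QF p Zs" "map (\<lambda>X. X x) Zs = vs" by blast
  have v: "v \<in> T x" using adapted_P.hyps(1) P_T by blast
  have "J_field (extension_field x v) x = v" using J_id[OF adapted_P.hyps(1)] by (simp add: J_field_def extension_field_at[OF v])
  then show ?case
    using adapted.adapted_P[OF J_field_PF[OF extension_field_VF[OF v]] Zs(1)] Zs(2)
    by (intro exI[of _ "J_field (extension_field x v) # Zs"]) simp
next
  case (adapted_Q v p vs)
  then obtain Zs where Zs: "adapted PF QF p Zs" "map (\<lambda>X. X x) Zs = vs" by blast
  have v: "v \<in> T x" using adapted_Q.hyps(1) Q_T by blast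
  have "(extension_field x v - J_field (extension_field x v)) x = v" using J_zero[OF adapted_Q.hyps(1)] by (simp add: J_field_def extension_field_at[OF v])
  then show ?case
    using adapted.adapted_Q[OF J_field_QF[OF extension_field_VF[OF v]] Zs(1)] Zs(2)
    by (intro exI[of _ "(extension_field x v - J_field (extension_field x v)) # Zs"]) simp
qed

definition pure_fields :: "nat \<Rightarrow> int \<Rightarrow> ('a vfield list \<Rightarrow> 'a \<Rightarrow> real) \<Rightarrow> bool" where
  "pure_fields k p F \<longleftrightarrow> (\<forall>p' Zs. adapted PF QF p' Zs \<longrightarrow> length Zs = k \<longrightarrow> p' \<noteq> p \<longrightarrow> F Zs = (\<lambda>x. 0))"

lemma pure_fieldsD: "pure_fields k p F \<Longrightarrow> adapted PF QF p' Zs \<Longrightarrow> length Zs = k \<Longrightarrow> p' \<noteq> p \<Longrightarrow> F Zs x = 0"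
  by (simp add: pure_fields_def)

lemma pure_fields_P:
  assumes "pure_fields (Suc k) p F" "X \<in> PF"
  shows "pure_fields k (p - 1) (\<lambda>Zs. F (X # Zs))"
  unfolding pure_fields_def
proof (intro allI impI ext)
  fix p' Zs x assume Zs: "adapted PF QF p' Zs" "length Zs = k" "p' \<noteq> p - 1"
  show "F (X # Zs) x = 0"
    by (rule pure_fieldsD[OF assms(1) adapted_P[OF assms(2) Zs(1)]]) (use Zs in auto)
qed

lemma pure_fields_Q:
  assumes "pure_fields (Suc k) p F" "X \<in> QF"
  shows "pure_fields k p (\<lambda>Zs. F (X # Zs))"
  unfolding pure_fields_def
proof (intro allI impI ext)
  fix p' Zs x assume Zs: "adapted PF QF p' Zs" "length Zs = k" "p' \<noteq> p"
  show "F (X # Zs) x = 0"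
    by (rule pure_fieldsD[OF assms(1) adapted_Q[OF assms(2) Zs(1)]]) (use Zs in auto)
qed

text \<open>Serves for the bracket of a section of \<open>P\<close> with a section of
  \<open>Q\<close>, about whose position nothing is known: it may count as 0 or 1 entry from
  \<open>P\<close>.\<close>

lemma pure_fields_head:
  assumes F: "fields_altmul (Suc k) F" "pure_fields (Suc k) p F" and X: "X \<in> VF"
    and Zs: "adapted PF QF q Zs" "length Zs = k" "q + 1 \<noteq> p" "q \<noteq> p"
  shows "F (X # Zs) x = 0"
proof -
  have "F ((J_field X + (X - J_field X)) # Zs) x = F (J_field X # Zs) x + F ((X - J_field X) # Zs) x"
    by (rule fields_altmul_plus[OF F(1) J_field_VF[OF X] J_field_compl_VF[OF X] adapted_VF[OF Zs(1)] Zs(2)])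
  moreover have "J_field X + (X - J_field X) = X" by simp
  moreover have "F (J_field X # Zs) x = 0"
    by (rule pure_fieldsD[OF F(2) adapted_P[OF J_field_PF[OF X] Zs(1)]]) (use Zs in auto)
  moreover have "F ((X - J_field X) # Zs) x = 0"
    by (rule pure_fieldsD[OF F(2) adapted_Q[OF J_field_QF[OF X] Zs(1)]]) (use Zs in auto)
  ultimately show ?thesis by simp
qed

lemma forms_pure_fields:
  assumes "pure_form k p \<omega>"
  shows "pure_fields k p (on_fields \<omega>)"
  unfolding pure_fields_def
proof (intro allI impI ext)
  fix p' Zs x assume Zs: "adapted PF QF p' Zs" "length Zs = k" "p' \<noteq> p"
  have "pure (P x) (Q x) k p (\<omega> x)" using assms by (simp add: pure_form_def)
  from pureD[OF this adapted_at[OF Zs(1)]] show "on_fields \<omega> Zs x = 0" using Zs by (simp add: on_fields_def)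
qed

context
  assumes P_inv: "involutive A P" and Q_inv: "involutive A Q"
begin

lemma PF_bracket: "X \<in> PF \<Longrightarrow> Y \<in> PF \<Longrightarrow> br X Y \<in> PF"
  using P_inv by (simp add: involutive_def PF_def)

lemma QF_bracket: "X \<in> QF \<Longrightarrow> Y \<in> QF \<Longrightarrow> br X Y \<in> QF"
  using Q_inv by (simp add: involutive_def QF_def)

lemma PF_VF: "X \<in> PF \<Longrightarrow> X \<in> VF" and QF_VF: "X \<in> QF \<Longrightarrow> X \<in> VF"
  by (auto simp: PF_def QF_def)

text \<open>A bracket with a section of \<open>P\<close> stays in \<open>P\<close> by involutivity
  and leaves the count unchanged; a bracket with a section of \<open>Q\<close> may raise it by 1,
  whence the exception \<open>q = p - 1\<close>.\<close>

lemma lie_der_pure_P: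
  "adapted PF QF q Zs \<Longrightarrow> X \<in> PF \<Longrightarrow> fields_altmul (length Zs) F \<Longrightarrow> pure_fields (length Zs) p F \<Longrightarrow> q \<noteq> p \<Longrightarrow> q \<noteq> p - 1 \<Longrightarrow>
    lie_der A X Zs F x = 0"
proof (induction arbitrary: F p rule: adapted.induct)
  case adapted_Nil
  then have "F [] = (\<lambda>x. 0)" using adapted.adapted_Nil[of PF QF] unfolding pure_fields_def by auto
  then show ?case using VF_const[OF PF_VF[OF adapted_Nil.prems(1)]] by simp
next
  case (adapted_P Y q Zs)
  have F: "fields_altmul (Suc (length Zs)) F" and pF: "pure_fields (Suc (length Zs)) p F" using adapted_P.prems by simp_all
  have "lie_der A X Zs (\<lambda>Ws. F (Y # Ws)) x = 0"
    by (rule adapted_P.IH[OF adapted_P.prems(1) fields_altmul_contract[OF F PF_VF[OF adapted_P.hyps(1)]] pure_fields_P[OF pF adapted_P.hyps(1)]])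
      (use adapted_P.prems in auto)
  moreover have "F (br X Y # Zs) x = 0"
    by (rule pure_fieldsD[OF pF adapted.adapted_P[OF PF_bracket[OF adapted_P.prems(1) adapted_P.hyps(1)] adapted_P.hyps(2)]])
      (use adapted_P.prems in auto)
  ultimately show ?case by simp
next
  case (adapted_Q Y q Zs)
  have F: "fields_altmul (Suc (length Zs)) F" and pF: "pure_fields (Suc (length Zs)) p F" using adapted_Q.prems by simp_all
  have "lie_der A X Zs (\<lambda>Ws. F (Y # Ws)) x = 0"
    by (rule adapted_Q.IH[OF adapted_Q.prems(1) fields_altmul_contract[OF F QF_VF[OF adapted_Q.hyps(1)]] pure_fields_Q[OF pF adapted_Q.hyps(1)]])
      (use adapted_Q.prems in auto)
  moreover have "F (br X Y # Zs) x = 0"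
    by (rule pure_fields_head[OF F pF VF_bracket[OF PF_VF[OF adapted_Q.prems(1)] QF_VF[OF adapted_Q.hyps(1)]] adapted_Q.hyps(2)])
      (use adapted_Q.prems in auto)
  ultimately show ?case by simp
qed

text \<open>Here it is the bracket with a section of \<open>P\<close> that may lose its
  \<open>P\<close> part and lower the count by 1, whence the exception
  \<open>q = p + 1\<close>.\<close>

lemma lie_der_pure_Q:
  "adapted PF QF q Zs \<Longrightarrow> X \<in> QF \<Longrightarrow> fields_altmul (length Zs) F \<Longrightarrow> pure_fields (length Zs) p F \<Longrightarrow> q \<noteq> p \<Longrightarrow> q \<noteq> p + 1 \<Longrightarrow>
    lie_der A X Zs F x = 0"
proof (induction arbitrary: F p rule: adapted.induct)
  case adapted_Nil
  then have "F [] = (\<lambda>x. 0)" using adapted.adapted_Nil[of PF QF] unfolding pure_fields_def by auto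
  then show ?case using VF_const[OF QF_VF[OF adapted_Nil.prems(1)]] by simp
next
  case (adapted_P Y q Zs)
  have F: "fields_altmul (Suc (length Zs)) F" and pF: "pure_fields (Suc (length Zs)) p F" using adapted_P.prems by simp_all
  have "lie_der A X Zs (\<lambda>Ws. F (Y # Ws)) x = 0"
    by (rule adapted_P.IH[OF adapted_P.prems(1) fields_altmul_contract[OF F PF_VF[OF adapted_P.hyps(1)]] pure_fields_P[OF pF adapted_P.hyps(1)]])
      (use adapted_P.prems in auto)
  moreover have "F (br X Y # Zs) x = 0"
    by (rule pure_fields_head[OF F pF VF_bracket[OF QF_VF[OF adapted_P.prems(1)] PF_VF[OF adapted_P.hyps(1)]] adapted_P.hyps(2)])
      (use adapted_P.prems in auto)
  ultimately show ?case by simp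
next
  case (adapted_Q Y q Zs)
  have F: "fields_altmul (Suc (length Zs)) F" and pF: "pure_fields (Suc (length Zs)) p F" using adapted_Q.prems by simp_all
  have "lie_der A X Zs (\<lambda>Ws. F (Y # Ws)) x = 0"
    by (rule adapted_Q.IH[OF adapted_Q.prems(1) fields_altmul_contract[OF F QF_VF[OF adapted_Q.hyps(1)]] pure_fields_Q[OF pF adapted_Q.hyps(1)]])
      (use adapted_Q.prems in auto)
  moreover have "F (br X Y # Zs) x = 0"
    by (rule pure_fieldsD[OF pF adapted.adapted_Q[OF QF_bracket[OF adapted_Q.prems(1) adapted_Q.hyps(1)] adapted_Q.hyps(2)]])
      (use adapted_Q.prems in auto)
  ultimately show ?case by simp
qed

text \<open>A first argument from \<open>P\<close> adds 1 to the count of the rest, one from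
  \<open>Q\<close> adds 0; with the exceptions of the two preceding lemmas both cases leave the
  counts \<open>p\<close> and \<open>p + 1\<close>. Thus the parts of bidegrees (-1, 2) and (2, -1)
  vanish.\<close>

lemma ext_der_pure:
  "adapted PF QF q Zs \<Longrightarrow> length Zs = Suc k \<Longrightarrow> fields_altmul k F \<Longrightarrow> pure_fields k p F \<Longrightarrow> q \<noteq> p \<Longrightarrow> q \<noteq> p + 1 \<Longrightarrow>
    ext_der A Zs F x = 0"
proof (induction arbitrary: F p k rule: adapted.induct)
  case adapted_Nil
  then show ?case by simp
next
  case (adapted_P X q Zs)
  have len: "length Zs = k" and F: "fields_altmul k F" "pure_fields k p F" using adapted_P.prems by auto
  have "lie_der A X Zs F x = 0"
    by (rule lie_der_pure_P[OF adapted_P.hyps(2,1), of F p]) (use F len adapted_P.prems in auto)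
  moreover have "ext_der A Zs (\<lambda>Ws. F (X # Ws)) x = 0"
  proof (cases k)
    case 0
    then show ?thesis using len by simp
  next
    case (Suc j)
    show ?thesis
      by (rule adapted_P.IH[OF _ fields_altmul_contract[OF F(1)[unfolded Suc] PF_VF[OF adapted_P.hyps(1)]] pure_fields_P[OF F(2)[unfolded Suc] adapted_P.hyps(1)]])
        (use len Suc adapted_P.prems in auto)
  qed
  ultimately show ?case by simp
next
  case (adapted_Q X q Zs)
  have len: "length Zs = k" and F: "fields_altmul k F" "pure_fields k p F" using adapted_Q.prems by auto
  have "lie_der A X Zs F x = 0"
    by (rule lie_der_pure_Q[OF adapted_Q.hyps(2,1), of F p]) (use F len adapted_Q.prems in auto)
  moreover have "ext_der A Zs (\<lambda>Ws. F (X # Ws)) x = 0"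
  proof (cases k)
    case 0
    then show ?thesis using len by simp
  next
    case (Suc j)
    show ?thesis
      by (rule adapted_Q.IH[OF _ fields_altmul_contract[OF F(1)[unfolded Suc] QF_VF[OF adapted_Q.hyps(1)]] pure_fields_Q[OF F(2)[unfolded Suc] adapted_Q.hyps(1)]])
        (use len Suc adapted_Q.prems in auto)
  qed
  ultimately show ?case by simp
qed

text \<open>A component of degree \<open>q\<close> involves adapted lists with count
  \<open>q\<close> only, and these are values of sections of \<open>P\<close> and \<open>Q\<close>,
  on which \<open>ext_der_pure\<close> decides.\<close>

lemma form_component_de_rham_pure:
  assumes \<omega>: "pure_form k p \<omega>" and q: "q \<noteq> p" "q \<noteq> p + 1"
  shows "form_component (Suc k) q (de_rham A k \<omega>) = 0"
proof (intro ext)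
  fix x vs
  have f: "\<omega> \<in> forms A k" using \<omega> by (simp add: pure_form_def)
  have "component (J x) vs q (de_rham A k \<omega> x) = 0" if vs: "vs \<in> lists (T x)" "length vs = Suc k"
  proof (rule splitting.component_vanish[OF splitting_J vs(1)])
    fix w assume w: "adapted (P x) (Q x) q w" "length w = length vs"
    obtain Zs where Zs: "adapted PF QF q Zs" "map (\<lambda>X. X x) Zs = w" using adapted_extend[OF w(1)] by blast
    have len: "length Zs = Suc k" using Zs(2) w(2) vs(2) by auto
    have "de_rham A k \<omega> x w = on_fields (de_rham A k \<omega>) Zs x" by (simp add: on_fields_def Zs(2))
    also have "\<dots> = ext_der A Zs (on_fields \<omega>) x" using de_rham_on_fields[OF f adapted_VF[OF Zs(1)] len] by simp
    also have "\<dots> = 0" by (rule ext_der_pure[OF Zs(1) len forms_fields_altmul[OF f] forms_pure_fields[OF \<omega>] q])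
    finally show "de_rham A k \<omega> x w = 0" .
  qed
  then show "form_component (Suc k) q (de_rham A k \<omega>) x vs = 0 x vs"
    by (simp add: form_component_def tangent_lists_iff)
qed

lemma d_E_eq:
  assumes \<omega>: "\<omega> \<in> forms A k"
  shows "d_E A E k \<omega> = (\<Sum>p\<in>{0..int k}. form_component (Suc k) (p + 1) (de_rham A k (form_component k p \<omega>)))"
  unfolding d_E_def
proof (rule sum.cong[OF refl])
  fix p
  have "bidegree_component A E k p \<omega> = form_component k p \<omega>" by (rule bidegree_component_eq[OF \<omega>])
  moreover have "form_component (Suc k) (p - 1) (de_rham A k (form_component k p \<omega>)) = 0"
    by (rule form_component_de_rham_pure[OF form_component_pure_form[OF \<omega>]]) auto
  ultimately show "(let \<eta> = de_rham A k (bidegree_component A E k p \<omega>)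
     in bidegree_component A E (Suc k) (p + 1) \<eta> + bidegree_component A E (Suc k) (p - 1) \<eta>) =
     form_component (Suc k) (p + 1) (de_rham A k (form_component k p \<omega>))"
    by (simp add: Let_def bidegree_component_eq[OF de_rham_forms[OF form_component_forms[OF \<omega>]]])
qed

text \<open>The leading component of \<open>d (d \<omega>) = 0\<close> for \<open>\<omega>\<close> of pure bidegree.\<close>

lemma leading_component_squared:
  assumes \<omega>: "pure_form k p \<omega>"
  shows "form_component (Suc (Suc k)) (p + 2) (de_rham A (Suc k) (form_component (Suc k) (p + 1) (de_rham A k \<omega>))) = 0"
proof -
  let ?d = "de_rham A k \<omega>"
  have f: "\<omega> \<in> forms A k" using \<omega> by (simp add: pure_form_def)
  note d = de_rham_forms[OF f]
  let ?e = "form_component (Suc k) (p + 1) ?d" and ?f = "form_component (Suc k) p ?d"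
  have "?d = (\<Sum>q\<in>insert p (insert (p + 1) {0..int (Suc k)}). form_component (Suc k) q ?d)"
    by (rule form_component_total[OF d]) auto
  also have "\<dots> = (\<Sum>q\<in>{p, p + 1}. form_component (Suc k) q ?d)"
    by (rule sum.mono_neutral_right) (use form_component_de_rham_pure[OF \<omega>] in auto)
  also have "\<dots> = ?f + ?e" by simp
  finally have "de_rham A (Suc k) (?f + ?e) = 0" using de_rham_de_rham[OF f] by simp
  then have "de_rham A (Suc k) ?f + de_rham A (Suc k) ?e = 0"
    using de_rham_add[OF form_component_forms form_component_forms, OF d d] by simp
  \<comment> \<open>The two terms are written as a sum over \<open>{True, False}\<close>, and 0 as
    an empty sum, so that \<open>form_component_sum\<close> gives additivity of the
    component.\<close>
  then have "(\<Sum>i\<in>{True, False}. if i then de_rham A (Suc k) ?f else de_rham A (Suc k) ?e) = 0" by simp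
  then have "form_component (Suc (Suc k)) (p + 2) (\<Sum>i\<in>{True, False}. if i then de_rham A (Suc k) ?f else de_rham A (Suc k) ?e)
      = form_component (Suc (Suc k)) (p + 2) (\<Sum>i\<in>{}. 0)" by simp
  then have "form_component (Suc (Suc k)) (p + 2) (de_rham A (Suc k) ?f) + form_component (Suc (Suc k)) (p + 2) (de_rham A (Suc k) ?e) = 0"
    by (simp only: form_component_sum) simp
  \<comment> \<open>The first summand is the derivative of a form of degree \<open>p\<close> and so
    has components of degrees \<open>p\<close> and \<open>p + 1\<close> only.\<close>
  moreover have "form_component (Suc (Suc k)) (p + 2) (de_rham A (Suc k) ?f) = 0"
    by (rule form_component_de_rham_pure[OF form_component_pure_form[OF d]]) auto
  ultimately show ?thesis by simp
qed

lemma d_E_squared: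
  assumes \<omega>: "\<omega> \<in> forms A k"
  shows "d_E A E (Suc k) (d_E A E k \<omega>) = 0"
proof -
  define e where "e p = form_component (Suc k) (p + 1) (de_rham A k (form_component k p \<omega>))" for p
  have d: "de_rham A k (form_component k p \<omega>) \<in> forms A (Suc k)" for p by (intro de_rham_forms form_component_forms \<omega>)
  have ep: "pure_form (Suc k) (p + 1) (e p)" for p unfolding e_def by (rule form_component_pure_form[OF d])
  then have ef: "e p \<in> forms A (Suc k)" for p by (simp add: pure_form_def)
  have "d_E A E k \<omega> = (\<Sum>p\<in>{0..int k}. e p)" unfolding d_E_eq[OF \<omega>] e_def ..
  moreover have "(\<Sum>p\<in>{0..int k}. e p) \<in> forms A (Suc k)" by (rule forms_sum[OF ef])
  ultimately have "d_E A E (Suc k) (d_E A E k \<omega>) = (\<Sum>q\<in>{0..int (Suc k)}.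
      form_component (Suc (Suc k)) (q + 1) (de_rham A (Suc k) (form_component (Suc k) q (\<Sum>p\<in>{0..int k}. e p))))"
    using d_E_eq by simp
  also have "\<dots> = 0"
  proof (rule sum.neutral, rule ballI)
    fix q assume "q \<in> {0..int (Suc k)}"
    have "form_component (Suc k) q (\<Sum>p\<in>{0..int k}. e p) = (\<Sum>p\<in>{0..int k}. if p = q - 1 then e (q - 1) else 0)"
      unfolding form_component_sum by (rule sum.cong) (auto simp: form_component_pure[OF ep])
    \<comment> \<open>The summand \<open>e p\<close> has degree \<open>p + 1\<close>, so degree
      \<open>q\<close> selects \<open>e (q - 1)\<close>; for \<open>q = 0\<close> there is none, and
      the value is 0.\<close>
    then have c: "form_component (Suc k) q (\<Sum>p\<in>{0..int k}. e p) = (if q - 1 \<in> {0..int k} then e (q - 1) else 0)" by simp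
    have "q - 1 + 2 = q + 1" by simp
    from leading_component_squared[OF form_component_pure_form[OF \<omega>], of "q - 1", unfolded this]
    have "form_component (Suc (Suc k)) (q + 1) (de_rham A (Suc k) (e (q - 1))) = 0"
      unfolding e_def by simp
    moreover have "form_component (Suc (Suc k)) (q + 1) 0 = 0" by (intro ext) (simp add: form_component_def zero_fun_def)
    ultimately show "form_component (Suc (Suc k)) (q + 1) (de_rham A (Suc k) (form_component (Suc k) q (\<Sum>p\<in>{0..int k}. e p))) = 0"
      unfolding c by (auto simp: de_rham_zero)
  qed
  finally show ?thesis .
qed

end

lemma form_component_zero: "form_component k p 0 = 0"
  by (intro ext) (simp add: form_component_def zero_fun_def)

lemma d_E_pure_form:
  assumes \<omega>: "pure_form k p \<omega>" and p: "p \<in> {0..int k}"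
  shows "d_E A E k \<omega> = form_component (Suc k) (p + 1) (de_rham A k \<omega>) + form_component (Suc k) (p - 1) (de_rham A k \<omega>)"
proof -
  have f: "\<omega> \<in> forms A k" using \<omega> by (simp add: pure_form_def)
  have "d_E A E k \<omega> = (\<Sum>q\<in>{0..int k}. if q = p
      then form_component (Suc k) (p + 1) (de_rham A k \<omega>) + form_component (Suc k) (p - 1) (de_rham A k \<omega>) else 0)"
    unfolding d_E_def
  proof (rule sum.cong[OF refl])
    fix q
    have b: "bidegree_component A E k q \<omega> = (if q = p then \<omega> else 0)"
      using bidegree_component_eq[OF f] form_component_pure[OF \<omega>] by simp
    show "(let \<eta> = de_rham A k (bidegree_component A E k q \<omega>)
     in bidegree_component A E (Suc k) (q + 1) \<eta> + bidegree_component A E (Suc k) (q - 1) \<eta>) = (if q = p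
      then form_component (Suc k) (p + 1) (de_rham A k \<omega>) + form_component (Suc k) (p - 1) (de_rham A k \<omega>) else 0)"
      unfolding b Let_def
      by (simp add: de_rham_zero bidegree_component_eq[OF de_rham_forms[OF f]] bidegree_component_eq[OF forms_zero] form_component_zero)
  qed
  also have "\<dots> = form_component (Suc k) (p + 1) (de_rham A k \<omega>) + form_component (Suc k) (p - 1) (de_rham A k \<omega>)"
    using p by simp
  finally show ?thesis .
qed

lemma form_component_adapted:
  assumes \<omega>: "\<omega> \<in> forms A k" and Zs: "adapted PF QF p Zs" "length Zs = k"
  shows "on_fields (form_component k q \<omega>) Zs x = (if q = p then on_fields \<omega> Zs x else 0)"
proof -
  have "map (\<lambda>X. X x) Zs \<in> lists (T x)" by (rule map_VF_lists[OF adapted_VF[OF Zs(1)]])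
  moreover have "component (J x) (map (\<lambda>X. X x) Zs) q (\<omega> x) = (if q = p then \<omega> x (map (\<lambda>X. X x) Zs) else 0)"
    by (rule splitting.component_adapted[OF splitting_J adapted_at[OF Zs(1)]]) (use forms_altmul[OF \<omega>] Zs(2) in simp)
  ultimately show ?thesis using Zs(2) by (simp add: on_fields_def form_component_def tangent_lists_iff)
qed

text \<open>The test forms are functions: \<open>d_E f = df \<circ> J\<close>, and the components of bidegree \<open>(2, 0)\<close>
  and \<open>(0, 2)\<close> of \<open>d (df \<circ> J)\<close> measure the failure of \<open>P\<close> and \<open>Q\<close> to be involutive.\<close>

context
  assumes square: "\<forall>k. \<forall>\<omega>\<in>forms A k. d_E A E (Suc k) (d_E A E k \<omega>) = 0"
begin

lemma d_E_function:
  assumes f: "f \<in> C"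
  obtains \<eta> where "\<eta> \<in> forms A 1" "\<And>X. X \<in> VF \<Longrightarrow> on_fields \<eta> [X] = (\<lambda>x. J_field X x f)"
    "\<And>X Y. X \<in> PF \<Longrightarrow> Y \<in> PF \<Longrightarrow> ext_der A [X, Y] (on_fields \<eta>) = (\<lambda>x. 0)"
    "\<And>X Y. X \<in> QF \<Longrightarrow> Y \<in> QF \<Longrightarrow> ext_der A [X, Y] (on_fields \<eta>) = (\<lambda>x. 0)"
proof -
  \<comment> \<open>A function as a form of degree 0: the only admissible argument is the empty
    list, and \<open>forms\<close> requires the value 0 on all others.\<close>
  define \<omega> :: "'a form" where "\<omega> = (\<lambda>x vs. if vs = [] then f x else 0)"
  have \<omega>: "\<omega> \<in> forms A 0"
    using f by (auto simp: forms_iff \<omega>_def on_fields_def tangent_lists_iff)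
  have "pure (P x) (Q x) 0 0 (\<omega> x)" for x
    unfolding pure_def
  proof (intro allI impI)
    fix p' w assume "adapted (P x) (Q x) p' w" "length w = 0" "p' \<noteq> 0"
    then show "\<omega> x w = 0" by cases auto
  qed
  with \<omega> have p\<omega>: "pure_form 0 0 \<omega>" by (simp add: pure_form_def)
  define \<eta> where "\<eta> = form_component 1 1 (de_rham A 0 \<omega>)"
  have d\<omega>: "de_rham A 0 \<omega> \<in> forms A 1" using de_rham_forms[OF \<omega>] by simp
  have p\<eta>: "pure_form 1 1 \<eta>" unfolding \<eta>_def by (rule form_component_pure_form[OF d\<omega>])
  then have \<eta>: "\<eta> \<in> forms A 1" by (simp add: pure_form_def)
  have hd: "on_fields (de_rham A 0 \<omega>) [X] = (\<lambda>x. X x f)" if "X \<in> VF" for X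
  proof -
    have "on_fields \<omega> [] = f" by (simp add: on_fields_def \<omega>_def)
    then show ?thesis using de_rham_on_fields[OF \<omega>, of "[X]"] that by simp
  qed
  have "form_component 1 (- 1) (de_rham A 0 \<omega>) = 0"
    by (intro ext) (simp add: form_component_def component_range)
  then have dE\<omega>: "d_E A E 0 \<omega> = \<eta>"
    using d_E_pure_form[OF p\<omega>] by (simp add: \<eta>_def)
  let ?d = "de_rham A 1 \<eta>"
  have d\<eta>: "?d \<in> forms A 2" using de_rham_forms[OF \<eta>] by (simp add: numeral_2_eq_2)
  have "form_component 2 2 ?d + form_component 2 0 ?d = 0"
    using d_E_pure_form[OF p\<eta>] square[rule_format, OF \<omega>] dE\<omega> by (simp add: numeral_2_eq_2)
  \<comment> \<open>On a pair of sections of \<open>P\<close> only the component of degree 2 can be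
    nonzero, on a pair of sections of \<open>Q\<close> only that of degree 0. The vanishing of the
    sum therefore makes each of the two vanish on its own pairs, and there the component is the full
    derivative.\<close>
  then have z: "on_fields (form_component 2 2 ?d) Zs x + on_fields (form_component 2 0 ?d) Zs x = 0" for Zs x
    by (simp add: on_fields_def fun_eq_iff)
  have hd2: "on_fields ?d [X, Y] = ext_der A [X, Y] (on_fields \<eta>)" if "X \<in> VF" "Y \<in> VF" for X Y
    using de_rham_on_fields[OF \<eta>, of "[X, Y]"] that by simp
  show ?thesis
  proof (rule that[of \<eta>])
    show "\<eta> \<in> forms A 1" by (rule \<eta>)
    show "on_fields \<eta> [X] = (\<lambda>x. J_field X x f)" if X: "X \<in> VF" for X
    proof
      fix x
      have "on_fields \<eta> [X] x = on_fields (de_rham A 0 \<omega>) [J_field X] x"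
        using VF_T[OF X] by (simp add: \<eta>_def on_fields_def form_component_def tangent_lists_iff J_field_def)
      then show "on_fields \<eta> [X] x = J_field X x f" using hd[OF J_field_VF[OF X]] by simp
    qed
    show "ext_der A [X, Y] (on_fields \<eta>) = (\<lambda>x. 0)" if X: "X \<in> PF" "Y \<in> PF" for X Y
    proof
      fix x
      have a: "adapted PF QF 2 [X, Y]"
        using adapted_P[OF X(1) adapted_P[OF X(2) adapted_Nil]] by simp
      have "on_fields ?d [X, Y] x = 0"
        using z[of "[X, Y]" x] form_component_adapted[OF d\<eta> a, of 2 x] form_component_adapted[OF d\<eta> a, of 0 x] by simp
      then show "ext_der A [X, Y] (on_fields \<eta>) x = 0" using hd2[of X Y] X by (simp add: PF_def)
    qed
    show "ext_der A [X, Y] (on_fields \<eta>) = (\<lambda>x. 0)" if X: "X \<in> QF" "Y \<in> QF" for X Y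
    proof
      fix x
      have a: "adapted PF QF 0 [X, Y]"
        using adapted_Q[OF X(1) adapted_Q[OF X(2) adapted_Nil]] by simp
      have "on_fields ?d [X, Y] x = 0"
        using z[of "[X, Y]" x] form_component_adapted[OF d\<eta> a, of 2 x] form_component_adapted[OF d\<eta> a, of 0 x] by simp
      then show "ext_der A [X, Y] (on_fields \<eta>) x = 0" using hd2[of X Y] X by (simp add: QF_def)
    qed
  qed
qed

lemma involutive_P: "involutive A P"
  unfolding involutive_def
proof (intro ballI allI impI)
  fix X Y x assume X: "X \<in> VF" "Y \<in> VF" "\<forall>x. X x \<in> P x" "\<forall>x. Y x \<in> P x"
  have PF: "X \<in> PF" "Y \<in> PF" using X by (simp_all add: PF_def)
  have J: "J_field X = X" "J_field Y = Y" using X J_id by (auto simp: J_field_def)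
  have bT: "br X Y x \<in> T x" using VF_T[OF VF_bracket[OF X(1,2)]] .
  have "br X Y x = J x (br X Y x)"
  \<comment> \<open>Two tangent vectors agree if they agree on all smooth functions; hence the
    function \<open>f\<close> of \<open>d_E_function\<close> must be arbitrary.\<close>
  proof (rule tangent_eqI[OF bT J_T[OF bT]])
    fix f assume f: "f \<in> C"
    obtain \<eta> where \<eta>: "\<And>X. X \<in> VF \<Longrightarrow> on_fields \<eta> [X] = (\<lambda>x. J_field X x f)"
      "\<And>X Y. X \<in> PF \<Longrightarrow> Y \<in> PF \<Longrightarrow> ext_der A [X, Y] (on_fields \<eta>) = (\<lambda>x. 0)"
      by (rule d_E_function[OF f]) blast
    have "ext_der A [X, Y] (on_fields \<eta>) x = 0" using \<eta>(2)[OF PF] by simp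
    then show "br X Y x f = J x (br X Y x) f"
      using \<eta>(1)[OF X(1)] \<eta>(1)[OF X(2)] \<eta>(1)[OF VF_bracket[OF X(1,2)]]
      by (simp add: J bracket_apply[OF f]) (simp add: J_field_def)
  qed
  then show "br X Y x \<in> P x" using J_P[OF bT] by simp
qed

lemma involutive_Q: "involutive A Q"
  unfolding involutive_def
proof (intro ballI allI impI)
  fix X Y x assume X: "X \<in> VF" "Y \<in> VF" "\<forall>x. X x \<in> Q x" "\<forall>x. Y x \<in> Q x"
  have QF: "X \<in> QF" "Y \<in> QF" using X by (simp_all add: QF_def)
  have J: "J_field X = (\<lambda>x. 0)" "J_field Y = (\<lambda>x. 0)" using X J_zero by (auto simp: J_field_def)
  have bT: "br X Y x \<in> T x" using VF_T[OF VF_bracket[OF X(1,2)]] .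
  have "J x (br X Y x) = 0"
  proof (rule tangent_eqI[OF J_T[OF bT] subspace_0[OF subspace_tangent]])
    fix f assume f: "f \<in> C"
    obtain \<eta> where \<eta>: "\<And>X. X \<in> VF \<Longrightarrow> on_fields \<eta> [X] = (\<lambda>x. J_field X x f)"
      "\<And>X Y. X \<in> QF \<Longrightarrow> Y \<in> QF \<Longrightarrow> ext_der A [X, Y] (on_fields \<eta>) = (\<lambda>x. 0)"
      by (rule d_E_function[OF f]) blast
    have "ext_der A [X, Y] (on_fields \<eta>) x = 0" using \<eta>(2)[OF QF] by simp
    \<comment> \<open>Both fields are annihilated by \<open>J\<close>, so the first two terms of the
      derivative of \<open>\<eta>\<close> differentiate the function 0, and only
      \<open>\<eta>\<close> on the bracket is left.\<close>
    then show "J x (br X Y x) f = 0 f"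
      using \<eta>(1)[OF X(1)] \<eta>(1)[OF X(2)] \<eta>(1)[OF VF_bracket[OF X(1,2)]]
      by (simp add: J VF_const[OF X(1)] VF_const[OF X(2)]) (simp add: J_field_def)
  qed
  then show "br X Y x \<in> Q x" using J_Q[OF bT] by simp
qed

end

end

section \<open>Equivalence of the two descriptions of a local product\<close>

theorem proposition45:
  fixes A :: "('a::{t2_space, second_countable_topology}, 'b::{real_inner, heine_borel}) atlas"
    and E :: "'a \<Rightarrow> 'a gvec set"
  assumes "smooth_manifold A"
    and "connected (UNIV :: 'a set)"
    and "split_structure A E"
  shows "gen_local_product A E \<longleftrightarrow>
    gen_almost_product A E \<and> (\<forall>k. \<forall>\<omega>\<in>forms A k. d_E A E (Suc k) (d_E A E k \<omega>) = 0)"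
proof
  assume lp: "gen_local_product A E"
  from assms(3) obtain r where r: "subbundle (gen_tangent_space A) (gen_section_on A) (2 * r) E"
    "\<forall>x. nondegenerate_on (E x) pairing" "split_structure_of_rank A (2 * r) E"
    unfolding split_structure_def split_structure_of_rank_def by blast
  \<comment> \<open>The direct sum is part of the definition of a local product; the rank of the
    projection then comes out as \<open>r\<close> by \<open>dim_P\<close>.\<close>
  interpret gproduct A E r
    using assms(1) r(1,2) lp by unfold_locales (auto simp: gen_local_product_def)
  have "gen_almost_product A E" using r(3) dim_P by (auto simp: gen_almost_product_def)
  moreover have "involutive A P" "involutive A Q"
    using lp by (auto simp: gen_local_product_def foliation_def)
  ultimately show "gen_almost_product A E \<and> (\<forall>k. \<forall>\<omega>\<in>forms A k. d_E A E (Suc k) (d_E A E k \<omega>) = 0)"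
    using d_E_squared by blast
next
  assume ap: "gen_almost_product A E \<and> (\<forall>k. \<forall>\<omega>\<in>forms A k. d_E A E (Suc k) (d_E A E k \<omega>) = 0)"
  then obtain r where r: "subbundle (gen_tangent_space A) (gen_section_on A) (2 * r) E"
    "\<forall>x. nondegenerate_on (E x) pairing" "\<forall>x. dim (fst ` E x) = r"
    unfolding gen_almost_product_def split_structure_of_rank_def by auto
  interpret S: gsplit A E r
    using assms(1) r(1,2) by unfold_locales auto
  \<comment> \<open>In this direction the direct sum is deduced from the rank of the projection,
    before anything is known about brackets.\<close>
  interpret gproduct A E r
    using S.direct_sum_of_rank r(3) by unfold_locales blast
  have "involutive A S.P" "involutive A S.Q" using involutive_P involutive_Q ap by blast+
  then show "gen_local_product A E"
    using assms(3) PQ_subbundle PQ_direct by (auto simp: gen_local_product_def foliation_def)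
qed

end
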